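(* Let $(X,d,\mu)$ be a space of homogeneous type, let $p(\cdot)\in \mathrm{LH}$ be an exponent with $1<p_-\le p_+<\infty$, and let $w$ be a weight on $X$. Then there exists a constant $C$ such that \[ \|(Mf)\,w\|_{p(\cdot)} \le C\,\|f w\|_{p(\cdot)} \quad\text{for all measurable } f \] if and only if $w\in A_{p(\cdot)}$.
   Context: A space of homogeneous type $(X,d,\mu)$ consists of a nonempty set $X$, a quasi-metric $d:X\times X\to[0,\infty)$ (i.e. $d(x,y)=0$ iff $x=y$, $d(x,y)=d(y,x)$, and $d(x,y)\le A_0(d(x,z)+d(z,y))$ for all $x,y,z$, for some constant $A_0\ge 1$), and a regular measure $\mu$ on the $\sigma$-algebra generated by quasi-metric balls $B(x,r)=\{y:d(x,y)<r\}$ and open sets, which is doubling: there is $C_\mu\ge1$ with $0<\mu(B(x,2r))\le C_\mu\mu(B(x,r))<\infty$ for all $x\in X$, $r>0$. An exponent is a measurable $p:X\to[1,\infty]$; for $E\subseteq X$, $p_-(E)=\operatorname{ess\,inf}_E p$, $p_+(E)=\operatorname{ess\,sup}_E p$, $p_\pm=p_\pm(X)$. With $X_\infty=\{p=\infty\}$, the modular is $\rho_{p(\cdot)}(f)=\int_{X\setminus X_\infty}|f(x)|^{p(x)}d\mu+\|f\|_{L^\infty(X_\infty)}$ and $\|f\|_{p(\cdot)}=\inf\{\lambda>0:\rho_{p(\cdot)}(f/\lambda)\le1\}$. The conjugate exponent is $p'(x)=p(x)/(p(x)-1)$ (with $1/0=\infty$, $1/\infty=0$). $p(\cdot)\in\mathrm{LH}_0$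 if there is $C_0$ with $|p(x)-p(y)|<-C_0/\log d(x,y)$ whenever $d(x,y)<1/2$; $p(\cdot)\in\mathrm{LH}_\infty$ if there are constants $C_\infty,p_\infty$ with $|p(x)-p_\infty|<C_\infty/\log(e+d(x,x_0))$ for all $x\in X$, where $x_0\in X$ is a fixed base point (the choice of base point does not matter); $\mathrm{LH}=\mathrm{LH}_0\cap\mathrm{LH}_\infty$. A weight is a locally integrable $w:X\to[0,\infty]$ with $0<w<\infty$ $\mu$-a.e. $w\in A_{p(\cdot)}$ means there is $K$ with $\|w\chi_B\|_{p(\cdot)}\|w^{-1}\chi_B\|_{p'(\cdot)}\le K\mu(B)$ for every ball $B$. $M$ is the uncentered Hardy–Littlewood maximal operator $Mf(x)=\sup_{B\ni x}\frac{1}{\mu(B)}\int_B|f|\,d\mu$, supremum over balls $B$ containing $x$. *)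

theory Defs
  imports "HOL-Analysis.Analysis"
begin

definition qball :: "'a set \<Rightarrow> ('a \<Rightarrow> 'a \<Rightarrow> real) \<Rightarrow> 'a \<Rightarrow> real \<Rightarrow> 'a set" where
  "qball X d x r = {y \<in> X. d x y < r}"

definition quasi_metric :: "'a set \<Rightarrow> ('a \<Rightarrow> 'a \<Rightarrow> real) \<Rightarrow> bool" where
  "quasi_metric X d \<longleftrightarrow>
     (\<forall>x\<in>X. \<forall>y\<in>X. 0 \<le> d x y \<and> (d x y = 0 \<longleftrightarrow> x = y) \<and> d x y = d y x) \<and>
     (\<exists>A0\<ge>1. \<forall>x\<in>X. \<forall>y\<in>X. \<forall>z\<in>X. d x y \<le> A0 * (d x z + d z y))"

definition qopen :: "'a set \<Rightarrow> ('a \<Rightarrow> 'a \<Rightarrow> real) \<Rightarrow> 'a set \<Rightarrow> bool" where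
  "qopen X d U \<longleftrightarrow> U \<subseteq> X \<and> (\<forall>x\<in>U. \<exists>r>0. qball X d x r \<subseteq> U)"

definition qballs :: "'a set \<Rightarrow> ('a \<Rightarrow> 'a \<Rightarrow> real) \<Rightarrow> 'a set set" where
  "qballs X d = {qball X d x r | x r. x \<in> X \<and> 0 < r}"

definition homogeneous_space :: "('a \<Rightarrow> 'a \<Rightarrow> real) \<Rightarrow> 'a measure \<Rightarrow> bool" where
  "homogeneous_space d M \<longleftrightarrow>
     space M \<noteq> {} \<and>
     quasi_metric (space M) d \<and>
     sets M = sigma_sets (space M) (qballs (space M) d \<union> {U. qopen (space M) d U}) \<and>
     (\<forall>E\<in>sets M. emeasure M E = (INF U\<in>{U. qopen (space M) d U \<and> E \<subseteq> U}. emeasure M U)) \<and>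
     (\<exists>C\<mu>\<ge>1. \<forall>x\<in>space M. \<forall>r>0.
        0 < emeasure M (qball (space M) d x (2 * r)) \<and>
        emeasure M (qball (space M) d x (2 * r)) \<le> ennreal C\<mu> * emeasure M (qball (space M) d x r) \<and>
        emeasure M (qball (space M) d x r) < \<infinity>)"

definition exponent :: "'a measure \<Rightarrow> ('a \<Rightarrow> ereal) \<Rightarrow> bool" where
  "exponent M p \<longleftrightarrow> p \<in> borel_measurable M \<and> (\<forall>x\<in>space M. 1 \<le> p x \<and> p x \<le> \<infinity>)"

definition ess_inf_exp :: "'a measure \<Rightarrow> ('a \<Rightarrow> ereal) \<Rightarrow> ereal" where
  "ess_inf_exp M p = Sup {c. AE x in M. c \<le> p x}"

definition ess_sup_exp :: "'a measure \<Rightarrow> ('a \<Rightarrow> ereal) \<Rightarrow> ereal" where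
  "ess_sup_exp M p = Inf {c. AE x in M. p x \<le> c}"

definition conj_exp :: "('a \<Rightarrow> ereal) \<Rightarrow> 'a \<Rightarrow> ereal" where
  "conj_exp p x = (if p x = \<infinity> then 1 else if p x = 1 then \<infinity>
                   else ereal (real_of_ereal (p x) / (real_of_ereal (p x) - 1)))"

text \<open>a^r for a in [0,infinity] and real r \<ge> 1.\<close>
definition epow :: "ennreal \<Rightarrow> real \<Rightarrow> ennreal" where
  "epow a r = (if a = \<infinity> then \<infinity> else ennreal (enn2real a powr r))"

definition ess_sup_on :: "'a measure \<Rightarrow> 'a set \<Rightarrow> ('a \<Rightarrow> ennreal) \<Rightarrow> ennreal" where
  "ess_sup_on M E g = Inf {c. AE x in M. x \<in> E \<longrightarrow> g x \<le> c}"

definition modular :: "'a measure \<Rightarrow> ('a \<Rightarrow> ereal) \<Rightarrow> ('a \<Rightarrow> ennreal) \<Rightarrow> ennreal" where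
  "modular M p g =
     (\<integral>\<^sup>+ x \<in> {x \<in> space M. p x \<noteq> \<infinity>}. epow (g x) (real_of_ereal (p x)) \<partial>M)
     + ess_sup_on M {x \<in> space M. p x = \<infinity>} g"

text \<open>The Luxemburg norm (value infinity if no admissible lambda exists).\<close>
definition var_norm :: "'a measure \<Rightarrow> ('a \<Rightarrow> ereal) \<Rightarrow> ('a \<Rightarrow> ennreal) \<Rightarrow> ennreal" where
  "var_norm M p g = Inf {ennreal t | t. 0 < t \<and> modular M p (\<lambda>x. g x / ennreal t) \<le> 1}"

definition LH0 :: "('a \<Rightarrow> 'a \<Rightarrow> real) \<Rightarrow> 'a set \<Rightarrow> ('a \<Rightarrow> ereal) \<Rightarrow> bool" where
  "LH0 d X p \<longleftrightarrow> (\<exists>C0. \<forall>x\<in>X. \<forall>y\<in>X. 0 < d x y \<and> d x y < 1/2 \<longrightarrow>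
       \<bar>p x - p y\<bar> < ereal (- C0 / ln (d x y)))"

definition LHinf :: "('a \<Rightarrow> 'a \<Rightarrow> real) \<Rightarrow> 'a set \<Rightarrow> ('a \<Rightarrow> ereal) \<Rightarrow> bool" where
  "LHinf d X p \<longleftrightarrow> (\<exists>x0\<in>X. \<exists>Cinf pinf::real. \<forall>x\<in>X.
       \<bar>p x - ereal pinf\<bar> < ereal (Cinf / ln (exp 1 + d x x0)))"

definition LH :: "('a \<Rightarrow> 'a \<Rightarrow> real) \<Rightarrow> 'a set \<Rightarrow> ('a \<Rightarrow> ereal) \<Rightarrow> bool" where
  "LH d X p \<longleftrightarrow> LH0 d X p \<and> LHinf d X p"

definition weight :: "('a \<Rightarrow> 'a \<Rightarrow> real) \<Rightarrow> 'a measure \<Rightarrow> ('a \<Rightarrow> ennreal) \<Rightarrow> bool" where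
  "weight d M w \<longleftrightarrow> w \<in> borel_measurable M \<and>
     (\<forall>B\<in>qballs (space M) d. (\<integral>\<^sup>+ x \<in> B. w x \<partial>M) < \<infinity>) \<and>
     (AE x in M. 0 < w x \<and> w x < \<infinity>)"

definition maxf :: "('a \<Rightarrow> 'a \<Rightarrow> real) \<Rightarrow> 'a measure \<Rightarrow> ('a \<Rightarrow> real) \<Rightarrow> 'a \<Rightarrow> ennreal" where
  "maxf d M f x = (SUP B\<in>{B \<in> qballs (space M) d. x \<in> B}.
       (\<integral>\<^sup>+ y \<in> B. ennreal \<bar>f y\<bar> \<partial>M) / emeasure M B)"

definition A_var :: "('a \<Rightarrow> 'a \<Rightarrow> real) \<Rightarrow> 'a measure \<Rightarrow> ('a \<Rightarrow> ereal) \<Rightarrow> ('a \<Rightarrow> ennreal) \<Rightarrow> bool" where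
  "A_var d M p w \<longleftrightarrow> (\<exists>K::real. \<forall>B\<in>qballs (space M) d.
       var_norm M p (\<lambda>x. w x * indicator B x) * var_norm M (conj_exp p) (\<lambda>x. inverse (w x) * indicator B x)
         \<le> ennreal K * emeasure M B)"

end

theory Submission
  imports Defs
begin

text \<open>
  Sufficiency adapts Lerner's proof of Muckenhoupt's theorem, so that neither dyadic cubes nor \<open>A\<^sub>\<infinity>\<close> are needed.
  With \<open>W = w\<^sup>p\<close> and \<open>\<sigma> = w\<^bsup>-p'\<^esup>\<close>, the maximal function of \<open>f\<close> is dominated pointwise by composing two unweighted
  variable exponent maximal operators: if \<open>G = M\<^sub>\<sigma>(f / \<sigma>)\<close> and \<open>H = M\<^sub>W(G\<^bsup>p-1\<^esup> / W)\<close>, then \<open>(M f)\<^bsup>p-1\<^esup> \<le> C H\<close>.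
  The \<open>A\<^sub>p\<close> condition and Hoelder's inequality make \<open>W\<close> and \<open>\<sigma>\<close> doubling measures, so Vitali's covering lemma and log-Hoelder
  continuity bound \<open>M\<^sub>\<sigma>\<close> on \<open>L\<^sup>p(\<sigma>)\<close> and \<open>M\<^sub>W\<close> on \<open>L\<^bsup>p'\<^esup>(W)\<close>.

  Write \<open>E(x) = e + d(x, x\<^sub>0)\<close>. On a ball whose radius is small compared with \<open>E\<close> the exponent is constant for all practical
  purposes, since every quantity attached to the ball is between powers of \<open>E\<close> and of the radius. On the remaining balls \<open>p\<close> is
  exchanged for \<open>p\<^sub>\<infinity>\<close> at the price of an error \<open>E\<^sup>-\<^sup>t\<close>, integrable with respect to \<open>W\<close> and \<open>\<sigma>\<close> for large \<open>t\<close>. Adding \<open>E\<^sup>-\<^sup>t\<close> to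
  \<open>f / \<sigma>\<close> and to \<open>G\<^bsup>p-1\<^esup>\<close> from the outset keeps averages from being too small for these exchanges.

  Balls need not be open, so \<open>M f\<close> need not be measurable. All estimates are made for maximal functions over finite families of
  balls, with constants independent of the family, and a countable family of balls dominates all others.

  Necessity tests the inequality on truncations of \<open>w\<^bsup>-p'\<^esup> \<chi>\<^sub>B\<close>.
\<close>

section \<open>Elementary inequalities\<close>

text \<open>For a constant exponent, let \<open>a\<close> be the \<sigma>-average of f / \<sigma>
  over a ball B. Then a \<le> G on all of B, so a^(p-1) mu(B) / W(B) is at most the W-average of
  G^(p-1) / W over B, and the bound on W(B) \<sigma>(B)^(p-1) / mu(B)^p turns this into a bound for
  the mu-average of f. The identities W = \<sigma>^(1-p) and \<sigma> = W^(1-p') make both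
  substitutions preserve modulars: f / \<sigma> in L^p(\<sigma>) matches f in L^p(W), and G^(p-1) /
  W in L^p'(W) matches G in L^p(\<sigma>). With a variable exponent, a^(p(y)-1) depends on y.
  Replacing p(y) by p(x) costs exp(|p(x)-p(y)| |ln a|), so |ln a| must be controlled by size and
  position of the ball: from above by the modular, from below only by the added tail. There is also
  a threat of circularity: W(B) is comparable with a power of the norm N(B) of w chi_B only up to
  tail integrals against W. Hence N, not W, is first shown to double; this gives polynomial growth
  of W(B), then finite tails, then the comparison, and only then doubling of W.\<close>

lemma powr_exponent_change:
  fixes s \<alpha> \<beta> K :: real
  assumes "0 < s" "\<bar>\<alpha> - \<beta>\<bar> * \<bar>ln s\<bar> \<le> K"
  shows "s powr \<alpha> \<le> exp K * s powr \<beta>"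
proof -
  have "(\<alpha> - \<beta>) * ln s \<le> \<bar>(\<alpha> - \<beta>) * ln s\<bar>" by linarith
  then have "(\<alpha> - \<beta>) * ln s \<le> K" using assms(2) by (simp add: abs_mult)
  then have "\<alpha> * ln s \<le> K + \<beta> * ln s" by (simp add: algebra_simps)
  then have "exp (\<alpha> * ln s) \<le> exp (K + \<beta> * ln s)" by simp
  then show ?thesis using assms(1) by (simp add: powr_def exp_add)
qed

text \<open>In applications \<open>L = ln (E y)\<close>, so the error is \<delta> E(y)^(-t). Below
  the threshold \<theta> with \<theta>^b = \<delta> exp(-tL) the left side is itself at most the
  error; above it |ln s| is at most a constant times \<open>L\<close>, and the oscillation
  hypothesis makes the change of exponent cost only a constant. The free factor \<delta> allows the
  error to be absorbed where a lower bound is wanted.\<close>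

lemma powr_exponent_switch:
  fixes s \<alpha> \<beta> b C L S \<delta> t :: real
  assumes b: "0 < b" "b \<le> \<alpha>" and osc: "\<bar>\<alpha> - \<beta>\<bar> * L \<le> C" and L: "1 \<le> L"
    and s: "0 \<le> s" "s \<le> S" "1 \<le> S" and \<delta>: "0 < \<delta>" "\<delta> \<le> 1" and t: "0 < t"
  shows "s powr \<alpha> \<le> exp (C * ((t + ln (1/\<delta>)) / b + ln S)) * s powr \<beta> + \<delta> * exp (- (t * L))"
proof -
  define \<theta> where "\<theta> = exp (- ((t * L + ln (1/\<delta>)) / b))"
  have ln\<delta>: "0 \<le> ln (1/\<delta>)" using \<delta> by simp
  have \<theta>1: "\<theta> \<le> 1" unfolding \<theta>_def using b(1) t L ln\<delta> by simp
  have "\<theta> powr b = exp (ln \<delta> - t * L)"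
    unfolding \<theta>_def using b(1) \<delta> by (simp add: powr_def ln_div)
  then have \<theta>b: "\<theta> powr b = \<delta> * exp (- (t * L))"
    using \<delta> by (simp add: exp_diff exp_minus divide_inverse)
  show ?thesis
  proof (cases "s \<le> \<theta>")
    case True
    have "s powr \<alpha> \<le> \<theta> powr \<alpha>" using True s b by (intro powr_mono2) auto
    also have "\<dots> \<le> \<theta> powr b" using \<theta>1 b by (intro powr_mono') (auto simp: \<theta>_def)
    finally show ?thesis using \<theta>b by (smt (verit) exp_gt_zero mult_nonneg_nonneg powr_ge_zero)
  next
    case False
    then have s0: "0 < s" using \<theta>_def by (smt (verit) exp_gt_zero)
    have "0 < \<theta>" by (simp add: \<theta>_def)
    then have "ln \<theta> \<le> ln s" using False s0 by simp
    then have lo: "- ((t * L + ln (1/\<delta>)) / b) \<le> ln s" by (simp add: \<theta>_def)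
    have up: "ln s \<le> ln S" using s s0 by simp
    have lnS: "0 \<le> ln S" using s by simp
    define U where "U = (t * L + ln (1/\<delta>)) / b"
    define U' where "U' = (t * L + ln (1/\<delta>) * L) / b"
    have "U \<le> U'" unfolding U_def U'_def
      using L ln\<delta> b by (intro divide_right_mono add_left_mono) (auto simp: mult_le_cancel_left1)
    moreover have "ln S \<le> ln S * L" using lnS L by (simp add: mult_le_cancel_left1)
    moreover have "0 \<le> U" unfolding U_def using b t L ln\<delta> by simp
    ultimately have "\<bar>ln s\<bar> \<le> U' + ln S * L" using lo[folded U_def] up lnS by linarith
    also have "\<dots> = L * ((t + ln (1/\<delta>)) / b + ln S)" by (simp add: U'_def algebra_simps add_divide_distrib)
    finally have 1: "\<bar>ln s\<bar> \<le> L * ((t + ln (1/\<delta>)) / b + ln S)" .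
    have pos: "0 \<le> (t + ln (1/\<delta>)) / b + ln S" using b t ln\<delta> lnS by simp
    have "\<bar>\<alpha> - \<beta>\<bar> * \<bar>ln s\<bar> \<le> \<bar>\<alpha> - \<beta>\<bar> * (L * ((t + ln (1/\<delta>)) / b + ln S))"
      using 1 by (intro mult_left_mono) auto
    also have "\<dots> = (\<bar>\<alpha> - \<beta>\<bar> * L) * ((t + ln (1/\<delta>)) / b + ln S)" by simp
    also have "\<dots> \<le> C * ((t + ln (1/\<delta>)) / b + ln S)" using osc pos by (intro mult_right_mono)
    finally have "s powr \<alpha> \<le> exp (C * ((t + ln (1/\<delta>)) / b + ln S)) * s powr \<beta>"
      by (rule powr_exponent_change[OF s0])
    then show ?thesis using \<delta> by (smt (verit) exp_gt_zero mult_nonneg_nonneg)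
  qed
qed

lemma young_unit:
  fixes a b p q :: real
  assumes "1 < p" "q = p / (p - 1)" "0 \<le> a" "0 \<le> b"
  shows "a * b \<le> a powr p + b powr q"
proof -
  have q: "1 < q" "1/p + 1/q = 1" using assms(1) unfolding assms(2) by (auto simp: field_simps)
  have "a * b \<le> a powr p / p + b powr q / q"
    using Youngs_inequality[of p q a b] q assms by simp
  also have "\<dots> \<le> a powr p + b powr q"
  proof (rule add_mono)
    show "a powr p / p \<le> a powr p"
      using mult_left_mono[of 1 p "a powr p"] assms(1) by (simp add: field_simps)
    show "b powr q / q \<le> b powr q"
      using mult_left_mono[of 1 q "b powr q"] q by (simp add: field_simps)
  qed
  finally show ?thesis .
qed

text \<open>The convex function s^q lies above its tangent at \<open>a\<close>. The form without
  subtraction can be integrated in \<open>ennreal\<close>.\<close>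

lemma powr_tangent:
  fixes a s q :: real
  assumes "1 \<le> q" "0 < a" "0 \<le> s"
  shows "q * a powr (q - 1) * s \<le> s powr q + (q - 1) * a powr q"
proof (cases "q = 1")
  case True then show ?thesis using assms by simp
next
  case False
  then have q: "1 < q" using assms by simp
  define q' where "q' = q / (q - 1)"
  have q': "1 < q'" "1/q + 1/q' = 1" using q by (auto simp: q'_def field_simps)
  have "s * a powr (q - 1) \<le> s powr q / q + (a powr (q - 1)) powr q' / q'"
    using Youngs_inequality[of q q' s "a powr (q-1)"] q q' assms by simp
  also have "(a powr (q - 1)) powr q' = a powr q" using q by (simp add: powr_powr q'_def)
  also have "s powr q / q + a powr q / q' = (s powr q + (q - 1) * a powr q) / q"
    using q by (simp add: q'_def field_simps)
  finally show ?thesis using q by (simp add: field_simps)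
qed

lemma powr_add_le:
  fixes a b p :: real
  assumes "0 \<le> a" "0 \<le> b" "0 \<le> p"
  shows "(a + b) powr p \<le> 2 powr p * (a powr p + b powr p)"
proof -
  have "(a + b) powr p \<le> (2 * max a b) powr p" using assms by (intro powr_mono2) auto
  also have "\<dots> = 2 powr p * max a b powr p" using assms by (simp add: powr_mult)
  also have "\<dots> \<le> 2 powr p * (a powr p + b powr p)" by (intro mult_left_mono) (auto simp: max_def)
  finally show ?thesis .
qed

lemma le_one_plus_powr:
  fixes s p :: real
  assumes "0 \<le> s" "1 \<le> p"
  shows "s \<le> 1 + s powr p"
proof (cases "s \<le> 1")
  case True then show ?thesis by (smt (verit) powr_ge_zero)
next
  case False
  then have "s powr 1 \<le> s powr p" using assms by (intro powr_mono) auto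
  then show ?thesis using False by simp
qed

lemma nn_integral_powr_layer:
  fixes m a :: real
  assumes m: "0 \<le> m" and a: "-1 < a"
  shows "(\<integral>\<^sup>+ l. ennreal (l powr a) * indicator {0<..<m} l \<partial>lborel) = ennreal (m powr (a + 1) / (a + 1))"
proof -
  have "((\<lambda>l. l powr a) has_integral (m powr (a + 1) / (a + 1))) {0..m}"
    using has_integral_powr_from_0[OF a m] by simp
  then have "(\<integral>\<^sup>+ l. ennreal (l powr a) * indicator {0..m} l \<partial>lborel) = ennreal (m powr (a + 1) / (a + 1))"
    by (intro nn_integral_has_integral_lebesgue') auto
  moreover have "(\<integral>\<^sup>+ l. ennreal (l powr a) * indicator {0<..<m} l \<partial>lborel)
      = (\<integral>\<^sup>+ l. ennreal (l powr a) * indicator {0..m} l \<partial>lborel)"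
    by (rule nn_integral_cong_AE)
      (use AE_lborel_singleton[of 0] AE_lborel_singleton[of m] in \<open>eventually_elim, auto simp: indicator_def\<close>)
  ultimately show ?thesis by simp
qed

lemma ennreal_mult_left_assoc:
  "0 \<le> a \<Longrightarrow> 0 \<le> b \<Longrightarrow> ennreal a * (ennreal b * c) = ennreal (a * b) * c"
  by (simp add: ennreal_mult mult.assoc)

text \<open>Integrating the tangent inequality at the mean \<open>a\<close> makes the linear term
  and the constant term collapse to the claim. No division by the measure of the set occurs.\<close>

lemma jensen_powr:
  assumes [measurable]: "B \<in> sets \<nu>" "h \<in> borel_measurable \<nu>"
    and h: "\<And>x. x \<in> space \<nu> \<Longrightarrow> 0 \<le> h x" and q: "1 \<le> (q::real)" and a: "0 \<le> a"
    and B: "emeasure \<nu> B < \<infinity>"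
    and av: "(\<integral>\<^sup>+x\<in>B. ennreal (h x) \<partial>\<nu>) = ennreal (a * measure \<nu> B)"
  shows "ennreal (a powr q * measure \<nu> B) \<le> (\<integral>\<^sup>+x\<in>B. ennreal (h x powr q) \<partial>\<nu>)"
\<comment> \<open>The two trivial cases are removed first, since the final cancellation takes place
  in the reals and needs a finite right side.\<close>
proof (cases "a = 0 \<or> (\<integral>\<^sup>+x\<in>B. ennreal (h x powr q) \<partial>\<nu>) = \<infinity>")
  case True then show ?thesis by auto
next
  case False
  then have a0: "0 < a" and "(\<integral>\<^sup>+x\<in>B. ennreal (h x powr q) \<partial>\<nu>) \<noteq> \<infinity>" using a by auto
  then obtain J where J: "0 \<le> J" "(\<integral>\<^sup>+x\<in>B. ennreal (h x powr q) \<partial>\<nu>) = ennreal J"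
    by (metis ennreal_cases infinity_ennreal_def)
  have eB: "emeasure \<nu> B = ennreal (measure \<nu> B)" using B by (simp add: emeasure_eq_ennreal_measure)
  have "ennreal (q * a powr (q - 1) * (a * measure \<nu> B))
      = ennreal (q * a powr (q - 1)) * (\<integral>\<^sup>+x\<in>B. ennreal (h x) \<partial>\<nu>)"
    using q a0 by (simp add: av ennreal_mult)
  also have "\<dots> = (\<integral>\<^sup>+x. ennreal (q * a powr (q - 1)) * (ennreal (h x) * indicator B x) \<partial>\<nu>)"
    by (rule nn_integral_cmult[symmetric]) measurable
  also have "\<dots> \<le> (\<integral>\<^sup>+x. ennreal (h x powr q) * indicator B x + ennreal ((q - 1) * a powr q) * indicator B x \<partial>\<nu>)"
  proof (rule nn_integral_mono)
    fix x assume x: "x \<in> space \<nu>"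
    have "ennreal (q * a powr (q - 1) * h x) \<le> ennreal (h x powr q + (q - 1) * a powr q)"
      using powr_tangent[OF q a0 h[OF x]] by (rule ennreal_leI)
    then show "ennreal (q * a powr (q - 1)) * (ennreal (h x) * indicator B x)
       \<le> ennreal (h x powr q) * indicator B x + ennreal ((q - 1) * a powr q) * indicator B x"
      using h[OF x] q by (simp add: indicator_def ennreal_mult)
  qed
  also have "\<dots> = ennreal J + ennreal ((q - 1) * a powr q) * emeasure \<nu> B"
    by (subst nn_integral_add) (auto simp: J nn_integral_cmult_indicator)
  also have "\<dots> = ennreal (J + (q - 1) * a powr q * measure \<nu> B)"
    using J q by (simp add: eB ennreal_mult[symmetric] ennreal_plus[symmetric] del: ennreal_plus)
  finally have "q * a powr (q - 1) * (a * measure \<nu> B) \<le> J + (q - 1) * a powr q * measure \<nu> B"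
    using J q by (subst (asm) ennreal_le_iff) (auto intro!: add_nonneg_nonneg mult_nonneg_nonneg)
  moreover have "a powr q = a powr (q - 1) * a" using a0 by (metis powr_mult_base mult.commute add.commute diff_add_cancel le_less)
  ultimately have "a powr q * measure \<nu> B \<le> J" by (simp add: algebra_simps)
  then show ?thesis by (simp add: J ennreal_leI)
qed

section \<open>Quasi-metric measure spaces\<close>

text \<open>An infinite average is \<open>0\<close> (by \<open>enn2real\<close>), so bounds from above hold without integrability.\<close>
definition avg :: "'a measure \<Rightarrow> 'a set \<Rightarrow> ('a \<Rightarrow> real) \<Rightarrow> real" where
  "avg \<nu> A g = enn2real (\<integral>\<^sup>+y\<in>A. ennreal (g y) \<partial>\<nu>) / measure \<nu> A"

lemma avg_nonneg [simp]: "0 \<le> avg \<nu> A g"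
  by (simp add: avg_def)

lemma avg_le_integral:
  assumes "0 < emeasure \<nu> A" "emeasure \<nu> A < \<infinity>"
  shows "ennreal (avg \<nu> A g * measure \<nu> A) \<le> (\<integral>\<^sup>+y\<in>A. ennreal (g y) \<partial>\<nu>)"
proof (cases "(\<integral>\<^sup>+y\<in>A. ennreal (g y) \<partial>\<nu>) = \<infinity>")
  case False
  have "0 < measure \<nu> A" using assms by (simp add: measure_def enn2real_positive_iff)
  then show ?thesis using False by (simp add: avg_def less_top)
qed simp

lemma avg_eq_integral:
  assumes "0 < emeasure \<nu> A" "emeasure \<nu> A < \<infinity>" "(\<integral>\<^sup>+y\<in>A. ennreal (g y) \<partial>\<nu>) < \<infinity>"
  shows "(\<integral>\<^sup>+y\<in>A. ennreal (g y) \<partial>\<nu>) = ennreal (avg \<nu> A g * measure \<nu> A)"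
proof -
  have "0 < measure \<nu> A" using assms by (simp add: measure_def enn2real_positive_iff)
  then show ?thesis using assms by (simp add: avg_def)
qed

lemma avg_ge_const:
  assumes A: "A \<in> sets \<nu>" "0 < emeasure \<nu> A" "emeasure \<nu> A < \<infinity>" "(\<integral>\<^sup>+y\<in>A. ennreal (g y) \<partial>\<nu>) < \<infinity>"
    and k: "\<And>y. y \<in> A \<Longrightarrow> k \<le> g y"
  shows "k \<le> avg \<nu> A g"
proof (cases "0 \<le> k")
  case True
  have pos: "0 < measure \<nu> A" using assms by (simp add: measure_def enn2real_positive_iff)
  have "ennreal (k * measure \<nu> A) = (\<integral>\<^sup>+y\<in>A. ennreal k \<partial>\<nu>)"
    using A True by (simp add: nn_integral_cmult_indicator emeasure_eq_ennreal_measure ennreal_mult)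
  also have "\<dots> \<le> (\<integral>\<^sup>+y\<in>A. ennreal (g y) \<partial>\<nu>)"
    by (intro nn_integral_mono) (use k in \<open>auto simp: indicator_def intro!: ennreal_leI\<close>)
  also have "\<dots> = ennreal (avg \<nu> A g * measure \<nu> A)" by (rule avg_eq_integral) (use A in auto)
  finally show ?thesis using pos True by (simp add: ennreal_le_iff)
next
  case False
  then show ?thesis using avg_nonneg[of \<nu> A g] by linarith
qed

lemma avg_le_bound:
  assumes A: "0 < emeasure \<nu> A" "emeasure \<nu> A < \<infinity>" and k: "0 \<le> k"
    and "(\<integral>\<^sup>+y\<in>A. ennreal (g y) \<partial>\<nu>) \<le> ennreal (k * measure \<nu> A)"
  shows "avg \<nu> A g \<le> k"
proof -
  have pos: "0 < measure \<nu> A" using assms by (simp add: measure_def enn2real_positive_iff)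
  have "ennreal (avg \<nu> A g * measure \<nu> A) \<le> ennreal (k * measure \<nu> A)"
    using avg_le_integral[OF A, of g] assms(4) by (rule order_trans)
  then show ?thesis using pos k by (simp add: ennreal_le_iff)
qed

section \<open>Balls in a quasi-metric space and the finite Vitali covering lemma\<close>

locale quasi_metric_measurable =
  fixes M :: "'a measure" and d :: "'a \<Rightarrow> 'a \<Rightarrow> real" and A0 :: real and x0 :: 'a
  assumes A0: "1 \<le> A0" and x0 [simp]: "x0 \<in> space M"
    and d_nonneg: "\<lbrakk>x \<in> space M; y \<in> space M\<rbrakk> \<Longrightarrow> 0 \<le> d x y"
    and d_zero: "\<lbrakk>x \<in> space M; y \<in> space M\<rbrakk> \<Longrightarrow> d x y = 0 \<longleftrightarrow> x = y"
    and d_sym: "\<lbrakk>x \<in> space M; y \<in> space M\<rbrakk> \<Longrightarrow> d x y = d y x"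
    and d_tri: "\<lbrakk>x \<in> space M; y \<in> space M; z \<in> space M\<rbrakk> \<Longrightarrow> d x y \<le> A0 * (d x z + d z y)"
    and ball_sets: "\<lbrakk>c \<in> space M; 0 < r\<rbrakk> \<Longrightarrow> qball (space M) d c r \<in> sets M"
begin

abbreviation B where "B \<equiv> qball (space M) d"

lemma ball_iff: "y \<in> B c r \<longleftrightarrow> y \<in> space M \<and> d c y < r"
  by (simp add: qball_def)

lemma ball_center [simp]: "c \<in> space M \<Longrightarrow> 0 < r \<Longrightarrow> c \<in> B c r"
  using d_zero[of c c] by (simp add: ball_iff)

lemma ball_mono: "r \<le> s \<Longrightarrow> B c r \<subseteq> B c s"
  by (auto simp: ball_iff)

lemma ball_subset:
  assumes "c \<in> space M" "c' \<in> space M" "A0 * (d c c' + r') \<le> r"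
  shows "B c' r' \<subseteq> B c r"
proof
  fix y assume "y \<in> B c' r'"
  then have y: "y \<in> space M" "d c' y < r'" by (auto simp: ball_iff)
  have "d c y \<le> A0 * (d c c' + d c' y)" using d_tri y assms by blast
  also have "\<dots> < A0 * (d c c' + r')" using y A0 by simp
  finally show "y \<in> B c r" using assms(3) y by (simp add: ball_iff)
qed

lemma d_ball2:
  assumes "c \<in> space M" "x \<in> B c r" "y \<in> B c r"
  shows "d x y < 2 * A0 * r"
proof -
  have "d x y \<le> A0 * (d x c + d c y)" using assms d_tri by (simp add: ball_iff)
  also have "\<dots> < A0 * (r + r)" using assms A0 d_sym[of x c]
    by (intro mult_strict_left_mono) (auto simp: ball_iff)
  finally show ?thesis by (simp add: algebra_simps)
qed

text \<open>For a common point z, d(c',z) < A0 r' and d(z,y) < 2 A0 r'; one more use of the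
  quasi-triangle inequality gives the factor 3 A0^2.\<close>

lemma ball_intersect_subset:
  assumes "c \<in> space M" "c' \<in> space M" "B c r \<inter> B c' r' \<noteq> {}" "r \<le> r'" "0 < r"
  shows "B c r \<subseteq> B c' (3 * A0\<^sup>2 * r')"
proof
  fix y assume y: "y \<in> B c r"
  obtain z where z: "z \<in> B c r" "z \<in> B c' r'" using assms(3) by auto
  have "d z y < 2 * A0 * r" using d_ball2 assms(1) z y by blast
  then have 1: "d z y < 2 * A0 * r'" using assms(4) A0
    by (smt (verit) mult_left_mono)
  have "r' \<le> A0 * r'" using A0 assms by (simp add: mult_le_cancel_right1)
  then have 2: "d c' z < A0 * r'" using z by (auto simp: ball_iff)
  have "d c' y \<le> A0 * (d c' z + d z y)" using d_tri y z assms by (simp add: ball_iff)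
  also have "\<dots> < A0 * (3 * A0 * r')" using A0 1 2 by (intro mult_strict_left_mono) auto
  finally show "y \<in> B c' (3 * A0\<^sup>2 * r')" using y by (simp add: ball_iff power2_eq_square algebra_simps)
qed

text \<open>Greedy selection: keep a ball of largest radius, discard every ball that meets it (those
  lie in its dilate), and continue by induction with the fewer balls that remain.\<close>

lemma vitali_finite:
  assumes "finite J" "J \<subseteq> space M \<times> {0<..}"
  shows "\<exists>J'\<subseteq>J. disjoint_family_on (\<lambda>(c,r). B c r) J' \<and>
     (\<Union>(c,r)\<in>J. B c r) \<subseteq> (\<Union>(c,r)\<in>J'. B c (3 * A0\<^sup>2 * r))"
  using assms
proof (induction "card J" arbitrary: J rule: less_induct)
  case less
  show ?case
  proof (cases "J = {}")
    case True then show ?thesis by (intro exI[of _ "{}"]) (auto simp: disjoint_family_on_def)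
  next
    case False
    have "finite (snd ` J)" "snd ` J \<noteq> {}" using less.prems False by auto
    then have "Max (snd ` J) \<in> snd ` J" by (rule Max_in)
    then obtain c0 r0 where cr: "(c0, r0) \<in> J" "r0 = Max (snd ` J)" by auto
    have mx: "r \<le> r0" if "(c, r) \<in> J" for c r
      using that less.prems unfolding cr(2) by (intro Max_ge) force+
    have cr0: "c0 \<in> space M" "0 < r0" using cr less.prems by auto
    define K where "K = {(c,r) \<in> J. B c r \<inter> B c0 r0 = {}}"
    have "K \<subseteq> J" by (auto simp: K_def)
    moreover have "(c0,r0) \<notin> K" using cr0 by (auto simp: K_def intro: ball_center)
    ultimately have "card K < card J" using cr less.prems by (intro psubset_card_mono) auto
    then obtain K' where K': "K' \<subseteq> K" "disjoint_family_on (\<lambda>(c,r). B c r) K'"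
       "(\<Union>(c,r)\<in>K. B c r) \<subseteq> (\<Union>(c,r)\<in>K'. B c (3 * A0\<^sup>2 * r))"
      using less.hyps[of K] \<open>K \<subseteq> J\<close> less.prems by (meson finite_subset subset_trans)
    show ?thesis
    proof (intro exI[of _ "insert (c0,r0) K'"] conjI)
      show "insert (c0, r0) K' \<subseteq> J" using cr K' \<open>K \<subseteq> J\<close> by auto
      show "disjoint_family_on (\<lambda>(c,r). B c r) (insert (c0,r0) K')"
        using K'(1,2) unfolding disjoint_family_on_def K_def by fastforce
      show "(\<Union>(c,r)\<in>J. B c r) \<subseteq> (\<Union>(c,r)\<in>insert (c0,r0) K'. B c (3 * A0\<^sup>2 * r))"
      proof (clarify)
        fix y c r assume J: "(c, r) \<in> J" and y: "y \<in> B c r"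
        show "y \<in> (\<Union>(c,r)\<in>insert (c0,r0) K'. B c (3 * A0\<^sup>2 * r))"
        proof (cases "(c,r) \<in> K")
          case True
          then have "y \<in> (\<Union>(c,r)\<in>K. B c r)" using y by auto
          then show ?thesis using K'(3) by auto
        next
          case False
          then have "B c r \<inter> B c0 r0 \<noteq> {}" using J by (auto simp: K_def)
          then have "B c r \<subseteq> B c0 (3 * A0\<^sup>2 * r0)"
            using J less.prems cr0 mx by (intro ball_intersect_subset) auto
          then show ?thesis using y by auto
        qed
      qed
    qed
  qed
qed

section \<open>Doubling measures\<close>

definition doubling :: "'a measure \<Rightarrow> real \<Rightarrow> bool" where
  "doubling \<nu> D \<longleftrightarrow> sets \<nu> = sets M \<and> 1 \<le> D \<and> (\<forall>c\<in>space M. \<forall>r>0. 0 < emeasure \<nu> (B c r) \<and>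
     emeasure \<nu> (B c r) < \<infinity> \<and> measure \<nu> (B c (2 * r)) \<le> D * measure \<nu> (B c r))"

lemma doublingD:
  assumes "doubling \<nu> D"
  shows "sets \<nu> = sets M" "1 \<le> D" "space \<nu> = space M"
    and "\<And>c r. c \<in> space M \<Longrightarrow> 0 < r \<Longrightarrow> 0 < emeasure \<nu> (B c r)"
    and "\<And>c r. c \<in> space M \<Longrightarrow> 0 < r \<Longrightarrow> emeasure \<nu> (B c r) < \<infinity>"
    and "\<And>c r. c \<in> space M \<Longrightarrow> 0 < r \<Longrightarrow> 0 < measure \<nu> (B c r)"
    and "\<And>c r. c \<in> space M \<Longrightarrow> 0 < r \<Longrightarrow> emeasure \<nu> (B c r) = ennreal (measure \<nu> (B c r))"
    and "\<And>c r. c \<in> space M \<Longrightarrow> 0 < r \<Longrightarrow> measure \<nu> (B c (2 * r)) \<le> D * measure \<nu> (B c r)"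
    and "\<And>c r. c \<in> space M \<Longrightarrow> 0 < r \<Longrightarrow> B c r \<in> sets \<nu>"
proof -
  show "sets \<nu> = sets M" "1 \<le> D" using assms by (auto simp: doubling_def)
  then show "space \<nu> = space M" by (intro sets_eq_imp_space_eq)
  fix c r assume cr: "c \<in> space M" "0 < (r::real)"
  show 1: "0 < emeasure \<nu> (B c r)" "emeasure \<nu> (B c r) < \<infinity>" 
    "measure \<nu> (B c (2 * r)) \<le> D * measure \<nu> (B c r)" using assms cr by (auto simp: doubling_def)
  show "0 < measure \<nu> (B c r)" using 1 by (simp add: measure_def enn2real_positive_iff)
  show "emeasure \<nu> (B c r) = ennreal (measure \<nu> (B c r))" using 1 by (simp add: emeasure_eq_ennreal_measure)
  show "B c r \<in> sets \<nu>" using ball_sets[OF cr] \<open>sets \<nu> = sets M\<close> by simp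
qed

lemma doubling_iterate:
  fixes \<phi> :: "'a \<Rightarrow> real \<Rightarrow> real"
  assumes "\<And>c r. c \<in> space M \<Longrightarrow> 0 < r \<Longrightarrow> \<phi> c (2 * r) \<le> D * \<phi> c r" "1 \<le> D" "c \<in> space M" "0 < r"
  shows "\<phi> c (2 ^ k * r) \<le> D ^ k * \<phi> c r"
proof (induction k)
  case (Suc k)
  have "\<phi> c (2 * (2 ^ k * r)) \<le> D * \<phi> c (2 ^ k * r)" using assms by simp
  also have "\<dots> \<le> D * (D ^ k * \<phi> c r)" using Suc assms(2) by (intro mult_left_mono) auto
  finally show ?case by (simp add: mult.assoc)
qed simp

lemma doubling_sigma_finite:
  assumes "doubling \<nu> D"
  shows "sigma_finite_measure \<nu>"
proof
  note D = doublingD[OF assms]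
  show "\<exists>A. countable A \<and> A \<subseteq> sets \<nu> \<and> \<Union> A = space \<nu> \<and> (\<forall>a\<in>A. emeasure \<nu> a \<noteq> \<infinity>)"
  proof (intro exI[of _ "range (\<lambda>n::nat. B x0 (real n + 1))"] conjI)
    show "range (\<lambda>n::nat. B x0 (real n + 1)) \<subseteq> sets \<nu>" using D(9)[OF x0] by auto
    show "\<Union> (range (\<lambda>n::nat. B x0 (real n + 1))) = space \<nu>"
    proof (auto simp: D(3) ball_iff)
      fix x assume "x \<in> space M"
      obtain n where "d x0 x < real n" using reals_Archimedean2 by blast
      then show "\<exists>n. d x0 x < real n + 1" by (intro exI[of _ n]) simp
    qed
    show "\<forall>a\<in>range (\<lambda>n::nat. B x0 (real n + 1)). emeasure \<nu> a \<noteq> \<infinity>"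
    proof clarify
      fix n :: nat assume "emeasure \<nu> (B x0 (real n + 1)) = \<infinity>"
      then show False using D(5)[OF x0, of "real n + 1"] by simp
    qed
  qed auto
qed

section \<open>Maximal functions over finite families, with weak and strong type bounds\<close>

definition MF :: "'a measure \<Rightarrow> ('a \<times> real) set \<Rightarrow> ('a \<Rightarrow> real) \<Rightarrow> 'a \<Rightarrow> real" where
  "MF \<nu> I g x = Max ((\<lambda>(c,r). avg \<nu> (B c r) g * indicat_real (B c r) x) ` I)"

definition family :: "('a \<times> real) set \<Rightarrow> bool" where
  "family I \<longleftrightarrow> finite I \<and> I \<noteq> {} \<and> I \<subseteq> space M \<times> {0<..}"

lemma MF_nonneg:
  assumes "family I"
  shows "0 \<le> MF \<nu> I g x"
proof -
  obtain c r where "(c,r) \<in> I" using assms by (auto simp: family_def)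
  then show ?thesis
    unfolding MF_def using assms by (subst Max_ge_iff) (auto simp: family_def intro!: bexI[of _ "(c,r)"])
qed

lemma MF_ge: "family I \<Longrightarrow> (c,r) \<in> I \<Longrightarrow> x \<in> B c r \<Longrightarrow> avg \<nu> (B c r) g \<le> MF \<nu> I g x"
  unfolding MF_def family_def by (subst Max_ge_iff) (auto intro!: bexI[of _ "(c,r)"])

text \<open>A finite maximum is attained, so every pointwise bound for averages over balls through x
  passes to \<open>MF\<close> without approximating a supremum.\<close>

lemma MF_cases:
  assumes "family I"
  shows "MF \<nu> I g x = 0 \<or> (\<exists>c r. (c,r) \<in> I \<and> x \<in> B c r \<and> MF \<nu> I g x = avg \<nu> (B c r) g)"
proof -
  have "MF \<nu> I g x \<in> (\<lambda>(c,r). avg \<nu> (B c r) g * indicat_real (B c r) x) ` I"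
    unfolding MF_def using assms by (intro Max_in) (auto simp: family_def)
  then show ?thesis by (fastforce simp: indicator_def split: if_splits)
qed

lemma MF_measurable [measurable]:
  assumes "family I"
  shows "MF \<nu> I g \<in> borel_measurable M"
proof -
  have "(\<lambda>x. Max ((\<lambda>i. (case i of (c,r) \<Rightarrow> avg \<nu> (B c r) g * indicat_real (B c r) x)) ` I)) \<in> borel_measurable M"
  proof (rule borel_measurable_Max)
    show "finite I" using assms by (simp add: family_def)
    fix i assume "i \<in> I"
    then obtain c r where i: "i = (c,r)" "c \<in> space M" "0 < r" using assms by (auto simp: family_def)
    have [measurable]: "B c r \<in> sets M" using ball_sets i by blast
    show "(\<lambda>x. (case i of (c,r) \<Rightarrow> avg \<nu> (B c r) g * indicat_real (B c r) x)) \<in> borel_measurable M"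
      unfolding i by simp
  qed
  then show ?thesis by (simp add: MF_def[abs_def])
qed

text \<open>Vitali's lemma selects disjoint balls with average above \<open>l\<close> whose dilates
  cover the level set; \<open>k\<close> doublings pay for the dilation. Only the part of g above l/2
  appears on the right, which is what lets the inequality be integrated in \<open>l\<close> for
  every exponent s > 1.\<close>

lemma weak_type:
  assumes dbl: "doubling \<nu> D" and k: "3 * A0\<^sup>2 \<le> 2 ^ k"
    and I: "family I" and [measurable]: "g \<in> borel_measurable M" and g: "\<And>x. x \<in> space M \<Longrightarrow> 0 \<le> g x"
    and l: "0 < (l::real)"
  shows "emeasure \<nu> {x\<in>space M. l < MF \<nu> I g x} 
     \<le> ennreal (2 * D ^ k / l) * (\<integral>\<^sup>+x. ennreal (g x) * indicator {x. l < 2 * g x} x \<partial>\<nu>)"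
proof -
  note D = doublingD[OF dbl]
  note [measurable_cong] = D(1)
  define J where "J = {(c,r)\<in>I. l < avg \<nu> (B c r) g}"
  have "J \<subseteq> I" by (auto simp: J_def)
  then have J: "finite J" "J \<subseteq> space M \<times> {0<..}" using I by (auto simp: family_def intro: finite_subset)
  obtain J' where J': "J' \<subseteq> J" "disjoint_family_on (\<lambda>(c,r). B c r) J'"
     "(\<Union>(c,r)\<in>J. B c r) \<subseteq> (\<Union>(c,r)\<in>J'. B c (3 * A0\<^sup>2 * r))" using vitali_finite[OF J] by blast
  have J'fin: "finite J'" using J' J finite_subset by blast
  let ?h = "\<lambda>x. ennreal (g x) * indicator {x. l < 2 * g x} x"
  have m1: "(\<lambda>x. ?h x) \<in> borel_measurable \<nu>"
    by (intro borel_measurable_times_ennreal) auto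
  note [measurable] = m1
  have cr: "c \<in> space M" "0 < r" "l < avg \<nu> (B c r) g" if "(c,r) \<in> J'" for c r
    using that J'(1) J(2) by (auto simp: J_def)
  have 3: "0 < 3 * A0\<^sup>2 * r" if "0 < r" for r using that A0 by (simp add: power2_eq_square)
  have "{x\<in>space M. l < MF \<nu> I g x} \<subseteq> (\<Union>(c,r)\<in>J. B c r)"
  proof (clarify)
    fix x assume "x \<in> space M" "l < MF \<nu> I g x"
    then obtain c r where "(c,r) \<in> J" "x \<in> B c r" using MF_cases[OF I, of \<nu> g x] l by (auto simp: J_def)
    then show "x \<in> (\<Union>(c,r)\<in>J. B c r)" by auto
  qed
  also have "\<dots> \<subseteq> (\<Union>(c,r)\<in>J'. B c (3 * A0\<^sup>2 * r))" by (rule J')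
  finally have "emeasure \<nu> {x\<in>space M. l < MF \<nu> I g x} \<le> emeasure \<nu> (\<Union>i\<in>J'. (case i of (c,r) \<Rightarrow> B c (3 * A0\<^sup>2 * r)))"
    using cr 3 by (intro emeasure_mono sets.finite_UN J'fin) (auto intro!: D(9))
  also have "\<dots> \<le> (\<Sum>i\<in>J'. emeasure \<nu> (case i of (c,r) \<Rightarrow> B c (3 * A0\<^sup>2 * r)))"
    using cr 3 by (intro emeasure_subadditive_finite J'fin) (auto intro!: D(9))
  also have "\<dots> \<le> (\<Sum>i\<in>J'. ennreal (2 * D ^ k / l) * (\<integral>\<^sup>+x\<in>(case i of (c,r) \<Rightarrow> B c r). ?h x \<partial>\<nu>))"
  proof (rule sum_mono)
    fix i assume "i \<in> J'"
    then obtain c r where i: "i = (c,r)" "c \<in> space M" "0 < r" "l < avg \<nu> (B c r) g"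
      using cr by (cases i) auto
    have [measurable]: "B c r \<in> sets M" using ball_sets i by blast
    have pos: "0 < measure \<nu> (B c r)" using D(6) i by blast
    have "measure \<nu> (B c (3 * A0\<^sup>2 * r)) \<le> measure \<nu> (B c (2 ^ k * r))"
      using k i D(9)[of c "2^k * r"] D(9)[of c "3 * A0\<^sup>2 * r"] D(5)[of c "2^k * r"] 3
      by (intro measure_mono_fmeasurable ball_mono mult_right_mono) (auto simp: fmeasurable_def)
    also have "\<dots> \<le> D ^ k * measure \<nu> (B c r)"
      using doubling_iterate[of "\<lambda>c r. measure \<nu> (B c r)" D] D i by blast
    finally have 1: "emeasure \<nu> (B c (3 * A0\<^sup>2 * r)) \<le> ennreal (D ^ k * measure \<nu> (B c r))"
      using i 3 D(7)[of c "3 * A0\<^sup>2 * r"] by (simp add: ennreal_leI)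
    have "ennreal (l * measure \<nu> (B c r)) \<le> ennreal (avg \<nu> (B c r) g * measure \<nu> (B c r))"
      using i pos by (intro ennreal_leI mult_right_mono) auto
    also have "\<dots> \<le> (\<integral>\<^sup>+y\<in>B c r. ennreal (g y) \<partial>\<nu>)" using avg_le_integral D i by blast
    \<comment> \<open>Where g \<le> l/2, its contribution is at most half of l times the measure of
      the ball and is absorbed on the left.\<close>
    also have "\<dots> \<le> (\<integral>\<^sup>+y. ?h y * indicator (B c r) y + ennreal (l/2) * indicator (B c r) y \<partial>\<nu>)"
      using l by (intro nn_integral_mono) (auto simp: indicator_def intro!: ennreal_leI)
    also have "\<dots> = (\<integral>\<^sup>+y\<in>B c r. ?h y \<partial>\<nu>) + ennreal (l/2) * ennreal (measure \<nu> (B c r))"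
      using D(7)[OF i(2,3)] by (subst nn_integral_add) (auto simp: nn_integral_cmult_indicator)
    finally have 2: "ennreal (l * measure \<nu> (B c r)) \<le> (\<integral>\<^sup>+y\<in>B c r. ?h y \<partial>\<nu>) + ennreal (l/2 * measure \<nu> (B c r))"
      using l by (subst (asm) ennreal_mult[symmetric]) auto
    have "ennreal (measure \<nu> (B c r)) \<le> ennreal (2 / l) * (\<integral>\<^sup>+y\<in>B c r. ?h y \<partial>\<nu>)"
    proof (cases "(\<integral>\<^sup>+y\<in>B c r. ?h y \<partial>\<nu>) = \<infinity>")
      case True then show ?thesis using l by (simp add: ennreal_mult_top)
    next
      case False
      then obtain q where q: "0 \<le> q" "(\<integral>\<^sup>+y\<in>B c r. ?h y \<partial>\<nu>) = ennreal q"
        by (cases "\<integral>\<^sup>+y\<in>B c r. ?h y \<partial>\<nu>" rule: ennreal_cases) (simp_all only: infinity_ennreal_def)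
      have "ennreal (l * measure \<nu> (B c r)) \<le> ennreal (q + l/2 * measure \<nu> (B c r))"
        using 2 unfolding q(2) by (subst ennreal_plus) (use l q(1) in auto)
      then have "l * measure \<nu> (B c r) \<le> q + l/2 * measure \<nu> (B c r)"
        by (subst (asm) ennreal_le_iff) (use l q(1) in auto)
      then have "measure \<nu> (B c r) \<le> 2 / l * q" using l by (simp add: field_simps)
      then have "ennreal (measure \<nu> (B c r)) \<le> ennreal (2 / l * q)" by (rule ennreal_leI)
      then show ?thesis unfolding q(2) by (subst (asm) ennreal_mult) (use l q(1) in auto)
    qed
    then have "ennreal (D ^ k) * ennreal (measure \<nu> (B c r)) \<le> ennreal (D ^ k) * (ennreal (2 / l) * (\<integral>\<^sup>+y\<in>B c r. ?h y \<partial>\<nu>))"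
      by (intro mult_left_mono) auto
    also have "\<dots> = ennreal (2 * D ^ k / l) * (\<integral>\<^sup>+y\<in>B c r. ?h y \<partial>\<nu>)"
      using l D(2) by (subst ennreal_mult_left_assoc) (auto simp: mult.commute)
    finally show "emeasure \<nu> (case i of (c,r) \<Rightarrow> B c (3 * A0\<^sup>2 * r)) \<le> ennreal (2 * D ^ k / l) * (\<integral>\<^sup>+x\<in>(case i of (c,r) \<Rightarrow> B c r). ?h x \<partial>\<nu>)"
      using 1 D(2) by (simp add: i(1) ennreal_mult)
  qed
  also have "\<dots> = ennreal (2 * D ^ k / l) * (\<integral>\<^sup>+x. (\<Sum>i\<in>J'. ?h x * indicator (case i of (c,r) \<Rightarrow> B c r) x) \<partial>\<nu>)"
    using cr by (subst nn_integral_sum) (auto simp: sum_distrib_left intro!: borel_measurable_times_ennreal m1 borel_measurable_indicator D(9))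
  also have "\<dots> \<le> ennreal (2 * D ^ k / l) * (\<integral>\<^sup>+x. ?h x \<partial>\<nu>)"
  proof (intro mult_left_mono nn_integral_mono)
    fix x
    have "(\<Sum>i\<in>J'. indicator (case i of (c,r) \<Rightarrow> B c r) x) = (indicator (\<Union>i\<in>J'. case i of (c,r) \<Rightarrow> B c r) x :: ennreal)"
      by (rule indicator_UN_disjoint[symmetric]) (use J'fin J' in auto)
    then show "(\<Sum>i\<in>J'. ?h x * indicator (case i of (c,r) \<Rightarrow> B c r) x) \<le> ?h x"
      by (simp add: sum_distrib_left[symmetric] mult_left_le indicator_def)
  qed simp
  finally show ?thesis .
qed

text \<open>Marcinkiewicz interpolation by hand: the layer cake formula, the truncated weak type
  bound at each level, and Fubini.\<close>

lemma strong_type: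
  assumes dbl: "doubling \<nu> D" and s: "1 < (s::real)"
  shows "\<exists>C\<ge>0. \<forall>I g. family I \<longrightarrow> g \<in> borel_measurable M \<longrightarrow> (\<forall>x\<in>space M. 0 \<le> g x) \<longrightarrow>
     (\<integral>\<^sup>+x. ennreal (MF \<nu> I g x powr s) \<partial>\<nu>) \<le> ennreal C * (\<integral>\<^sup>+x. ennreal (g x powr s) \<partial>\<nu>)"
proof -
  note D = doublingD[OF dbl]
  note [measurable_cong] = D(1)
  obtain k :: nat where k: "3 * A0\<^sup>2 \<le> 2 ^ k" using real_arch_pow[of 2 "3 * A0\<^sup>2"] by (auto intro: less_imp_le)
  \<comment> \<open>The factor s comes from the layer cake formula, 2 D^k from the weak type bound,
    and the last one from integrating l^(s-2) over 0 < l < 2 g(x).\<close>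
  define C where "C = s * (2 * D ^ k) * (2 powr (s - 1) / (s - 1))"
  interpret sigma_finite_measure \<nu> using doubling_sigma_finite[OF dbl] .
  interpret pair_sigma_finite \<nu> lborel ..
  have "(\<integral>\<^sup>+x. ennreal (MF \<nu> I g x powr s) \<partial>\<nu>) \<le> ennreal C * (\<integral>\<^sup>+x. ennreal (g x powr s) \<partial>\<nu>)"
    if I: "family I" and [measurable]: "g \<in> borel_measurable M" and g: "\<And>x. x \<in> space M \<Longrightarrow> 0 \<le> g x" for I g
  proof -
    note [measurable] = MF_measurable[OF I]
    let ?m = "MF \<nu> I g"
    have "(\<integral>\<^sup>+x. ennreal (?m x powr s) \<partial>\<nu>)
       = (\<integral>\<^sup>+x. ennreal s * (\<integral>\<^sup>+ l. ennreal (l powr (s - 1)) * indicator {0<..<?m x} l \<partial>lborel) \<partial>\<nu>)"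
      using s MF_nonneg[OF I] by (intro nn_integral_cong) (subst nn_integral_powr_layer, auto simp: ennreal_mult[symmetric])
    also have "\<dots> = ennreal s * (\<integral>\<^sup>+x. (\<integral>\<^sup>+ l. ennreal (l powr (s - 1)) * indicator {0<..<?m x} l \<partial>lborel) \<partial>\<nu>)"
      by (rule nn_integral_cmult) (simp add: indicator_def greaterThanLessThan_iff)
    finally have layer: "(\<integral>\<^sup>+x. ennreal (?m x powr s) \<partial>\<nu>)
       = ennreal s * (\<integral>\<^sup>+x. (\<integral>\<^sup>+ l. ennreal (l powr (s - 1)) * indicator {0<..<?m x} l \<partial>lborel) \<partial>\<nu>)" .
    have "(\<integral>\<^sup>+x. (\<integral>\<^sup>+ l. ennreal (l powr (s - 1)) * indicator {0<..<?m x} l \<partial>lborel) \<partial>\<nu>)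
        = (\<integral>\<^sup>+l. (\<integral>\<^sup>+ x. ennreal (l powr (s - 1)) * indicator {0<..<?m x} l \<partial>\<nu>) \<partial>lborel)"
      by (rule Fubini'[symmetric]) (simp add: indicator_def greaterThanLessThan_iff split_beta')
    also have "\<dots> \<le> (\<integral>\<^sup>+l. (\<integral>\<^sup>+ x. ennreal (2 * D ^ k) * (ennreal (g x) * (ennreal (l powr (s - 2)) * indicator {0<..<2 * g x} l)) \<partial>\<nu>) \<partial>lborel)"
    proof (rule nn_integral_mono)
      fix l :: real
      show "(\<integral>\<^sup>+ x. ennreal (l powr (s - 1)) * indicator {0<..<?m x} l \<partial>\<nu>)
        \<le> (\<integral>\<^sup>+ x. ennreal (2 * D ^ k) * (ennreal (g x) * (ennreal (l powr (s - 2)) * indicator {0<..<2 * g x} l)) \<partial>\<nu>)"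
      proof (cases "0 < l")
        case False then show ?thesis by simp
      next
        case True
        have "(\<integral>\<^sup>+ x. ennreal (l powr (s - 1)) * indicator {0<..<?m x} l \<partial>\<nu>)
          = (\<integral>\<^sup>+ x. ennreal (l powr (s - 1)) * indicator {x\<in>space M. l < ?m x} x \<partial>\<nu>)"
          using True by (intro nn_integral_cong) (auto simp: indicator_def D(3))
        also have "\<dots> = ennreal (l powr (s - 1)) * emeasure \<nu> {x\<in>space M. l < ?m x}"
          by (rule nn_integral_cmult_indicator) (simp add: D(1))
        also have "\<dots> \<le> ennreal (l powr (s - 1)) * (ennreal (2 * D ^ k / l) * (\<integral>\<^sup>+x. ennreal (g x) * indicator {x. l < 2 * g x} x \<partial>\<nu>))"
          using weak_type[OF dbl k I _ g True] by (intro mult_left_mono) auto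
        also have "\<dots> = ennreal (2 * D ^ k * l powr (s - 2)) * (\<integral>\<^sup>+x. ennreal (g x) * indicator {x. l < 2 * g x} x \<partial>\<nu>)"
        proof -
          have "l powr (s - 1) = l powr (s - 2) * l" using powr_mult_base[of l "s-2"] True by (simp add: mult.commute)
          then have "l powr (s - 1) * (2 * D ^ k / l) = 2 * D ^ k * l powr (s - 2)" using True by simp
          then show ?thesis using True D(2) by (subst ennreal_mult_left_assoc) auto
        qed
        also have "\<dots> = (\<integral>\<^sup>+x. ennreal (2 * D ^ k * l powr (s - 2)) * (ennreal (g x) * indicator {x. l < 2 * g x} x) \<partial>\<nu>)"
          by (rule nn_integral_cmult[symmetric]) (auto intro!: borel_measurable_times_ennreal)
        also have "\<dots> = (\<integral>\<^sup>+ x. ennreal (2 * D ^ k) * (ennreal (g x) * (ennreal (l powr (s - 2)) * indicator {0<..<2 * g x} l)) \<partial>\<nu>)"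
          using True D(2) by (intro nn_integral_cong) (auto simp: indicator_def ennreal_mult mult_ac)
        finally show ?thesis .
      qed
    qed
    also have "\<dots> = (\<integral>\<^sup>+x. (\<integral>\<^sup>+ l. ennreal (2 * D ^ k) * (ennreal (g x) * (ennreal (l powr (s - 2)) * indicator {0<..<2 * g x} l)) \<partial>lborel) \<partial>\<nu>)"
      by (rule Fubini') (simp add: indicator_def greaterThanLessThan_iff split_beta')
    also have "\<dots> = (\<integral>\<^sup>+x. ennreal (2 * D ^ k * (2 powr (s - 1) / (s - 1))) * ennreal (g x powr s) \<partial>\<nu>)"
    proof (rule nn_integral_cong)
      fix x assume "x \<in> space \<nu>"
      then have g0: "0 \<le> g x" using g D(3) by auto
      have "(\<integral>\<^sup>+ l. ennreal (2 * D ^ k) * (ennreal (g x) * (ennreal (l powr (s - 2)) * indicator {0<..<2 * g x} l)) \<partial>lborel)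
        = ennreal (2 * D ^ k) * (ennreal (g x) * (\<integral>\<^sup>+ l. ennreal (l powr (s - 2)) * indicator {0<..<2 * g x} l \<partial>lborel))"
        by (simp add: nn_integral_cmult)
      also have "\<dots> = ennreal (2 * D ^ k) * (ennreal (g x) * ennreal ((2 * g x) powr (s - 1) / (s - 1)))"
        using s g0 by (subst nn_integral_powr_layer) auto
      also have "\<dots> = ennreal (2 * D ^ k * (g x * ((2 * g x) powr (s - 1) / (s - 1))))"
        using g0 s D(2) by (simp add: ennreal_mult[symmetric])
      also have "g x * ((2 * g x) powr (s - 1) / (s - 1)) = 2 powr (s - 1) / (s - 1) * g x powr s"
        using g0 powr_mult_base[of "g x" "s - 1"] by (simp add: powr_mult mult_ac)
      finally show "(\<integral>\<^sup>+ l. ennreal (2 * D ^ k) * (ennreal (g x) * (ennreal (l powr (s - 2)) * indicator {0<..<2 * g x} l)) \<partial>lborel)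
         = ennreal (2 * D ^ k * (2 powr (s - 1) / (s - 1))) * ennreal (g x powr s)"
        using g0 s D(2) by (simp add: ennreal_mult[symmetric] mult.assoc)
    qed
    also have "\<dots> = ennreal (2 * D ^ k * (2 powr (s - 1) / (s - 1))) * (\<integral>\<^sup>+x. ennreal (g x powr s) \<partial>\<nu>)"
      by (rule nn_integral_cmult) measurable
    finally have "(\<integral>\<^sup>+x. ennreal (?m x powr s) \<partial>\<nu>) \<le> ennreal s *
        (ennreal (2 * D ^ k * (2 powr (s - 1) / (s - 1))) * (\<integral>\<^sup>+x. ennreal (g x powr s) \<partial>\<nu>))"
      unfolding layer by (rule mult_left_mono) simp
    then show ?thesis
      using s D(2) by (subst (asm) ennreal_mult_left_assoc) (auto simp: C_def mult.assoc)
  qed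
  moreover have "0 \<le> C" using s D(2) by (simp add: C_def)
  ultimately show ?thesis by blast
qed

end

section \<open>Growth of balls and oscillation of log-Hoelder exponents\<close>

lemma ex_power2_ge:
  fixes T :: real
  assumes "1 \<le> T"
  shows "\<exists>n::nat. T \<le> 2 ^ n \<and> real n * ln 2 \<le> ln T + ln 2"
proof -
  define n where "n = nat \<lceil>log 2 T\<rceil>"
  have l: "0 \<le> log 2 T" using assms by simp
  have "log 2 T \<le> real n" "real n \<le> log 2 T + 1" using l unfolding n_def by linarith+
  then have "T \<le> 2 powr real n" "real n * ln 2 \<le> (log 2 T + 1) * ln 2"
    using assms by (auto simp: log_le_iff)
  then show ?thesis using assms by (intro exI[of _ n]) (auto simp: powr_realpow log_def algebra_simps)
qed

context quasi_metric_measurable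
begin

definition E :: "'a \<Rightarrow> real" where
  "E y = exp 1 + d y x0"

lemma E_ge: "y \<in> space M \<Longrightarrow> exp 1 \<le> E y"
  using d_nonneg[of y x0] by (simp add: E_def)

lemma E_ge1: "y \<in> space M \<Longrightarrow> 1 \<le> E y"
  using E_ge[of y] exp_ge_add_one_self[of "1::real"] by linarith

lemma ln_E: "y \<in> space M \<Longrightarrow> 1 \<le> ln (E y)"
  using E_ge[of y] by (subst ln_ge_iff) (auto intro: less_le_trans[OF exp_gt_zero])

lemma E_powr: "y \<in> space M \<Longrightarrow> E y powr (- t) = exp (- (t * ln (E y)))"
  using E_ge1[of y] by (auto simp: powr_def)

lemma E_powr_le1: "y \<in> space M \<Longrightarrow> 0 \<le> t \<Longrightarrow> E y powr (- t) \<le> 1"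
  using E_ge1[of y] powr_mono[of "-t" 0 "E y"] by auto

lemma E_measurable [measurable]: "E \<in> borel_measurable M"
proof (rule borel_measurableI_less)
  fix a :: real
  have "{x \<in> space M. E x < a} = B x0 (a - exp 1)"
    by (auto simp: ball_iff E_def d_sym)
  moreover have "B x0 (a - exp 1) \<in> sets M"
  proof (cases "0 < a - exp 1")
    case False
    then have "B x0 (a - exp 1) = {}" using d_nonneg[OF x0] by (force simp: ball_iff)
    then show ?thesis by simp
  qed (rule ball_sets, auto)
  ultimately show "{x \<in> space M. E x < a} \<in> sets M" by simp
qed

text \<open>The factor 2 A0 serves both alternatives: on a local ball \<open>E\<close> varies by a
  bounded factor, and a ball that is not local has a bounded dilate containing
  \<open>B x0 1\<close>.\<close>

definition local_ball :: "'a \<Rightarrow> real \<Rightarrow> bool" where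
  "local_ball c r \<longleftrightarrow> 2 * A0 * r \<le> 1 + d c x0"

lemma E_local:
  assumes "c \<in> space M" "0 < r" "local_ball c r" "y \<in> B c r"
  shows "E c \<le> 2 * A0 * E y" "E y \<le> 2 * A0 * E c"
proof -
  have y: "y \<in> space M" "d c y < r" using assms by (auto simp: ball_iff)
  have e: "1 \<le> exp (1::real)" by simp
  have Ae: "exp 1 \<le> A0 * exp 1" using A0 by simp
  have "d c x0 \<le> A0 * (d c y + d y x0)" using y assms by (intro d_tri) auto
  also have "\<dots> \<le> A0 * r + A0 * d y x0" using y A0 by (simp add: distrib_left mult_left_mono)
  finally have "d c x0 \<le> 1 + 2 * A0 * d y x0" using assms(3) by (simp add: local_ball_def)
  then show "E c \<le> 2 * A0 * E y" using Ae e unfolding E_def distrib_left by linarith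
  have "d y x0 \<le> A0 * (d y c + d c x0)" using y assms by (intro d_tri) auto
  also have "\<dots> \<le> A0 * r + A0 * d c x0" using y A0 assms d_sym[of y c] by (simp add: distrib_left mult_left_mono)
  finally have 1: "2 * d y x0 \<le> 1 + d c x0 + 2 * (A0 * d c x0)" using assms(3) by (simp add: local_ball_def)
  have "d c x0 \<le> A0 * d c x0" using d_nonneg[of c x0] assms A0 by (simp add: mult_le_cancel_right1)
  then have "2 * d y x0 \<le> 1 + 3 * (A0 * d c x0)" using 1 by linarith
  moreover have "0 \<le> A0 * d c x0" using A0 d_nonneg[of c x0] assms by simp
  ultimately show "E y \<le> 2 * A0 * E c" using Ae e unfolding E_def distrib_left by linarith
qed

text \<open>Serves both for the measure of a ball and for the norm of w chi_B; only monotonicity and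
  doubling matter. The value on a ball is compared with that on \<open>B x0 1\<close>: each of the
  two balls lies in a dilate of the other, and the number of doublings needed is of order ln E(c) +
  |ln r|. For a ball that is not local the dilate containing \<open>B x0 1\<close> has bounded
  ratio, whence the uniform lower bound.\<close>

lemma ball_functional_bounds:
  fixes \<phi> :: "'a \<Rightarrow> real \<Rightarrow> real"
  assumes D: "1 \<le> D"
    and pos: "\<And>c r. c \<in> space M \<Longrightarrow> 0 < r \<Longrightarrow> 0 < \<phi> c r"
    and mono: "\<And>c r c' r'. c \<in> space M \<Longrightarrow> 0 < r \<Longrightarrow> c' \<in> space M \<Longrightarrow> 0 < r' \<Longrightarrow> B c r \<subseteq> B c' r' \<Longrightarrow> \<phi> c r \<le> \<phi> c' r'"
    and dbl: "\<And>c r. c \<in> space M \<Longrightarrow> 0 < r \<Longrightarrow> \<phi> c (2 * r) \<le> D * \<phi> c r"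
  shows "\<exists>m\<ge>0. \<forall>c\<in>space M. \<forall>r>0. \<bar>ln (\<phi> c r)\<bar> \<le> m * (ln (E c) + \<bar>ln r\<bar>)"
    and "\<exists>\<kappa>>0. \<forall>c\<in>space M. \<forall>r>0. \<not> local_ball c r \<longrightarrow> \<kappa> \<le> \<phi> c r"
proof -
  define \<phi>0 where "\<phi>0 = \<phi> x0 1"
  have \<phi>0: "0 < \<phi>0" unfolding \<phi>0_def using pos by simp
  \<comment> \<open>With \<Lambda> = ln E(c) + |ln r| \<ge> 1, both comparisons use n doublings
    where n ln 2 \<le> ln A0 + 2 ln 2 + \<Lambda>, hence n \<le> a \<Lambda>.\<close>
  define a where "a = (ln A0 + 2 * ln 2 + 1) / ln 2"
  define m where "m = \<bar>ln \<phi>0\<bar> + a * ln D"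
  have lnD: "0 \<le> ln D" and lnA: "0 \<le> ln A0" using D A0 by auto
  have a0: "0 \<le> a" unfolding a_def using lnA by simp
  have m0: "0 \<le> m" unfolding m_def using a0 lnD by simp
  have e1: "1 \<le> exp (1::real)" by simp
  have "\<bar>ln (\<phi> c r)\<bar> \<le> m * (ln (E c) + \<bar>ln r\<bar>)" if c: "c \<in> space M" and r: "0 < r" for c r
  proof -
    define \<Lambda> where "\<Lambda> = ln (E c) + \<bar>ln r\<bar>"
    have \<Lambda>: "1 \<le> \<Lambda>" using ln_E[OF c] by (simp add: \<Lambda>_def)
    have E0: "0 < E c" using E_ge1[OF c] by simp
    have n_le: "real n \<le> a * \<Lambda>" if "real n * ln 2 \<le> ln A0 + ln 2 + \<Lambda> + ln 2" for n :: nat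
    proof -
      have "ln A0 + 2 * ln 2 \<le> (ln A0 + 2 * ln 2) * \<Lambda>" using \<Lambda> lnA mult_left_mono[of 1 \<Lambda> "ln A0 + 2 * ln 2"] by simp
      then have "real n * ln 2 \<le> (ln A0 + 2 * ln 2 + 1) * \<Lambda>" using that by (simp add: algebra_simps)
      then show ?thesis by (simp add: a_def field_simps)
    qed
    have fin: "real n * ln D \<le> a * ln D * \<Lambda>" if "real n \<le> a * \<Lambda>" for n :: nat
      using mult_right_mono[OF that lnD] by (simp add: mult_ac)
    have \<phi>le: "\<bar>ln \<phi>0\<bar> \<le> \<bar>ln \<phi>0\<bar> * \<Lambda>" using \<Lambda> by (simp add: mult_le_cancel_left1)
    have up: "ln (\<phi> c r) \<le> m * \<Lambda>"
    proof -
      have ge1: "1 \<le> A0 * (r + E c)" using A0 r E_ge1[OF c] by (smt (verit) mult_le_cancel_right1)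
      obtain n :: nat where n: "A0 * (r + E c) \<le> 2 ^ n" "real n * ln 2 \<le> ln (A0 * (r + E c)) + ln 2"
        using ex_power2_ge[OF ge1] by blast
      have lnmax: "ln (max r (E c)) \<le> \<Lambda>" using r E0 ln_E[OF c] by (auto simp: \<Lambda>_def max_def)
      have "ln (r + E c) \<le> ln (2 * max r (E c))" using r E0 by (intro ln_mono) auto
      also have "\<dots> = ln 2 + ln (max r (E c))" using r E0 by (subst ln_mult) (auto simp: max_def)
      finally have "ln (r + E c) \<le> ln 2 + \<Lambda>" using lnmax by simp
      then have "real n * ln 2 \<le> ln A0 + ln 2 + \<Lambda> + ln 2" using n(2) A0 r E0 by (simp add: ln_mult)
      then have nb: "real n \<le> a * \<Lambda>" by (rule n_le)
      have "B c r \<subseteq> B x0 (2 ^ n * 1)"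
      proof (rule ball_subset)
        have "A0 * (d x0 c + r) \<le> A0 * (r + E c)" using A0 d_sym[of c x0] c by (simp add: E_def)
        then show "A0 * (d x0 c + r) \<le> 2 ^ n * 1" using n(1) by simp
      qed (use c in auto)
      then have "\<phi> c r \<le> \<phi> x0 (2 ^ n * 1)" using mono c r x0 by simp
      also have "\<dots> \<le> D ^ n * \<phi>0" unfolding \<phi>0_def using doubling_iterate[of \<phi> D x0 1 n, OF dbl D x0] by simp
      finally have "ln (\<phi> c r) \<le> ln (D ^ n * \<phi>0)" using pos[OF c r] by simp
      also have "\<dots> = real n * ln D + ln \<phi>0" using D \<phi>0 by (simp add: ln_mult ln_realpow)
      also have "\<dots> \<le> m * \<Lambda>" using fin[OF nb] \<phi>le by (simp add: m_def distrib_right)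
      finally show ?thesis .
    qed
    have lo: "- ln (\<phi> c r) \<le> m * \<Lambda>"
    proof -
      obtain n :: nat where n: "max 1 (A0 * E c / r) \<le> 2 ^ n" "real n * ln 2 \<le> ln (max 1 (A0 * E c / r)) + ln 2"
        using ex_power2_ge[of "max 1 (A0 * E c / r)"] by auto
      have "ln (A0 * E c / r) = ln A0 + ln (E c) - ln r" using A0 E0 r by (simp add: ln_mult ln_div)
      then have "ln (max 1 (A0 * E c / r)) \<le> ln A0 + \<Lambda>" using lnA \<Lambda> by (auto simp: max_def \<Lambda>_def)
      moreover have "0 < ln (2::real)" by simp
      ultimately have "real n * ln 2 \<le> ln A0 + ln 2 + \<Lambda> + ln 2" using n(2) by linarith
      then have nb: "real n \<le> a * \<Lambda>" by (rule n_le)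
      have "B x0 1 \<subseteq> B c (2 ^ n * r)"
      proof (rule ball_subset)
        have "A0 * (d c x0 + 1) \<le> A0 * E c" using A0 e1 by (simp add: E_def)
        also have "\<dots> \<le> 2 ^ n * r" using n(1) r by (simp add: field_simps)
        finally show "A0 * (d c x0 + 1) \<le> 2 ^ n * r" .
      qed (use c in auto)
      then have "\<phi>0 \<le> \<phi> c (2 ^ n * r)" unfolding \<phi>0_def using mono c r x0 by simp
      also have "\<dots> \<le> D ^ n * \<phi> c r" using doubling_iterate[of \<phi> D c r n, OF dbl D c r] by simp
      finally have "ln \<phi>0 \<le> ln (D ^ n * \<phi> c r)" using \<phi>0 by simp
      also have "\<dots> = real n * ln D + ln (\<phi> c r)" using D pos[OF c r] by (simp add: ln_mult ln_realpow)
      finally show ?thesis using fin[OF nb] \<phi>le by (simp add: m_def distrib_right)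
    qed
    show ?thesis using up lo by (simp add: \<Lambda>_def)
  qed
  then show "\<exists>m\<ge>0. \<forall>c\<in>space M. \<forall>r>0. \<bar>ln (\<phi> c r)\<bar> \<le> m * (ln (E c) + \<bar>ln r\<bar>)"
    using m0 by blast
  obtain k :: nat where k: "2 * A0 * A0 \<le> 2 ^ k" using real_arch_pow[of 2 "2 * A0 * A0"] by (auto intro: less_imp_le)
  have "\<phi>0 / D ^ k \<le> \<phi> c r" if c: "c \<in> space M" and r: "0 < r" and nl: "\<not> local_ball c r" for c r
  proof -
    have "B x0 1 \<subseteq> B c (2 ^ k * r)"
    proof (rule ball_subset)
      have "A0 * (d c x0 + 1) \<le> A0 * (2 * A0 * r)" using nl A0 by (intro mult_left_mono) (auto simp: local_ball_def)
      also have "\<dots> \<le> 2 ^ k * r" using mult_right_mono[OF k, of r] r by (simp add: mult_ac)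
      finally show "A0 * (d c x0 + 1) \<le> 2 ^ k * r" .
    qed (use c in auto)
    then have "\<phi>0 \<le> \<phi> c (2 ^ k * r)" unfolding \<phi>0_def using mono c r x0 by simp
    also have "\<dots> \<le> D ^ k * \<phi> c r" using doubling_iterate[of \<phi> D c r k, OF dbl D c r] by simp
    finally show ?thesis using D by (simp add: field_simps)
  qed
  then show "\<exists>\<kappa>>0. \<forall>c\<in>space M. \<forall>r>0. \<not> local_ball c r \<longrightarrow> \<kappa> \<le> \<phi> c r"
    using \<phi>0 D by (intro exI[of _ "\<phi>0 / D ^ k"]) auto
qed

section \<open>Log-Hoelder exponents, their oscillation on local balls, and integrable tails\<close>

definition log_holder :: "('a \<Rightarrow> real) \<Rightarrow> real \<Rightarrow> real \<Rightarrow> real \<Rightarrow> real \<Rightarrow> bool" where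
  "log_holder P b b' Pinf C \<longleftrightarrow> P \<in> borel_measurable M \<and> 1 < b \<and> b \<le> Pinf \<and> Pinf \<le> b' \<and>
     (\<forall>x\<in>space M. b \<le> P x \<and> P x \<le> b' \<and> \<bar>P x - Pinf\<bar> * ln (E x) \<le> C) \<and>
     (\<forall>x\<in>space M. \<forall>y\<in>space M. 0 < d x y \<longrightarrow> d x y < 1/2 \<longrightarrow> \<bar>P x - P y\<bar> * (- ln (d x y)) \<le> C)"

lemma log_holderD:
  assumes "log_holder P b b' Pinf C"
  shows "P \<in> borel_measurable M" "1 < b" "b \<le> Pinf" "Pinf \<le> b'" "0 \<le> C"
    and "\<And>x. x \<in> space M \<Longrightarrow> b \<le> P x" "\<And>x. x \<in> space M \<Longrightarrow> P x \<le> b'"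
    and "\<And>x. x \<in> space M \<Longrightarrow> \<bar>P x - Pinf\<bar> * ln (E x) \<le> C"
    and "\<And>x. x \<in> space M \<Longrightarrow> \<bar>P x - Pinf\<bar> \<le> C"
    and "\<And>x y. x \<in> space M \<Longrightarrow> y \<in> space M \<Longrightarrow> 0 < d x y \<Longrightarrow> d x y < 1/2 \<Longrightarrow> \<bar>P x - P y\<bar> * (- ln (d x y)) \<le> C"
proof -
  show "P \<in> borel_measurable M" "1 < b" "b \<le> Pinf" "Pinf \<le> b'" 
    "\<And>x. x \<in> space M \<Longrightarrow> b \<le> P x" "\<And>x. x \<in> space M \<Longrightarrow> P x \<le> b'"
    and 1: "\<And>x. x \<in> space M \<Longrightarrow> \<bar>P x - Pinf\<bar> * ln (E x) \<le> C"
    and "\<And>x y. x \<in> space M \<Longrightarrow> y \<in> space M \<Longrightarrow> 0 < d x y \<Longrightarrow> d x y < 1/2 \<Longrightarrow> \<bar>P x - P y\<bar> * (- ln (d x y)) \<le> C"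
    using assms by (auto simp: log_holder_def)
  show 2: "\<bar>P x - Pinf\<bar> \<le> C" if "x \<in> space M" for x
  proof -
    have "\<bar>P x - Pinf\<bar> * 1 \<le> \<bar>P x - Pinf\<bar> * ln (E x)" using ln_E[OF that] by (intro mult_left_mono) auto
    then show ?thesis using 1[OF that] by simp
  qed
  show "0 \<le> C" using 2[OF x0] by simp
qed

text \<open>The two summands use the two conditions. Decay at infinity controls the factor ln E(c),
  because \<open>E\<close> is comparable to E(c) on a local ball; local continuity controls |ln r|
  when r is small, because two points of the ball are less than 2 A0 r apart.\<close>

lemma log_holder_local_osc:
  assumes "log_holder P b b' Pinf C"
  shows "\<exists>K\<ge>0. \<forall>c\<in>space M. \<forall>r>0. local_ball c r \<longrightarrow>
    (\<forall>x\<in>B c r. \<forall>y\<in>B c r. \<bar>P x - P y\<bar> * (ln (E c) + \<bar>ln r\<bar>) \<le> K)"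
proof -
  note L = log_holderD[OF assms]
  have ln2A: "0 \<le> ln (2 * A0)" and ln4A: "0 \<le> ln (4 * A0)" using A0 by auto
  define C1 where "C1 = 2 * C * (1 + ln (2 * A0))"
  define K where "K = C1 + 2 * C * ln (2 * A0) + C + 2 * C * ln (4 * A0) + C1"
  have C1: "0 \<le> C1" unfolding C1_def using L(5) ln2A by simp
  have "\<bar>P x - P y\<bar> * (ln (E c) + \<bar>ln r\<bar>) \<le> K"
    if c: "c \<in> space M" and r: "0 < r" and l: "local_ball c r" and x: "x \<in> B c r" and y: "y \<in> B c r" for c r x y
  proof -
    have xy: "x \<in> space M" "y \<in> space M" using x y by (auto simp: ball_iff)
    have E0: "0 < E c" using E_ge1[OF c] by simp
    have osc: "\<bar>P x - P y\<bar> \<le> 2 * C" using L(9)[OF xy(1)] L(9)[OF xy(2)] by linarith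
    have one: "\<bar>P z - Pinf\<bar> * ln (E c) \<le> C * (1 + ln (2 * A0))" if z: "z \<in> B c r" for z
    proof -
      have zX: "z \<in> space M" using z by (auto simp: ball_iff)
      have "ln (E c) \<le> ln (2 * A0 * E z)" using E_local(1)[OF c r l z] E0 by simp
      also have "\<dots> = ln (2 * A0) + ln (E z)" using A0 E_ge1[OF zX] by (subst ln_mult) auto
      finally have "\<bar>P z - Pinf\<bar> * ln (E c) \<le> \<bar>P z - Pinf\<bar> * (ln (2 * A0) + ln (E z))"
        by (intro mult_left_mono) auto
      also have "\<dots> \<le> C * ln (2 * A0) + C"
        using L(8)[OF zX] mult_right_mono[OF L(9)[OF zX] ln2A] by (simp add: distrib_left)
      finally show ?thesis by (simp add: algebra_simps)
    qed
    have "\<bar>P x - P y\<bar> * ln (E c) \<le> (\<bar>P x - Pinf\<bar> + \<bar>P y - Pinf\<bar>) * ln (E c)"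
      using ln_E[OF c] by (intro mult_right_mono) auto
    then have a: "\<bar>P x - P y\<bar> * ln (E c) \<le> C1" using one[OF x] one[OF y] by (simp add: C1_def distrib_right)
    have b: "\<bar>P x - P y\<bar> * \<bar>ln r\<bar> \<le> 2 * C * ln (2 * A0) + C + 2 * C * ln (4 * A0) + C1"
    proof (cases "2 * A0 * r < 1/2")
      case True
      show ?thesis
      proof (cases "x = y")
        case True then show ?thesis using L(5) ln2A ln4A C1 by simp
      next
        case False
        have d: "d x y < 2 * A0 * r" using d_ball2[OF c x y] .
        have d0: "0 < d x y" using False d_zero[OF xy] d_nonneg[OF xy] by linarith
        have "r * 2 * 1 \<le> r * 2 * A0" using A0 r by (intro mult_left_mono) auto
        then have r1: "r < 1" using True by (simp add: mult_ac)
        have "ln (d x y) \<le> ln (2 * A0 * r)" using d d0 by simp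
        also have "\<dots> = ln (2 * A0) + ln r" using A0 r by (subst ln_mult) auto
        finally have "\<bar>ln r\<bar> \<le> ln (2 * A0) + - ln (d x y)" using r r1 by (simp add: abs_of_neg)
        then have "\<bar>P x - P y\<bar> * \<bar>ln r\<bar> \<le> \<bar>P x - P y\<bar> * (ln (2 * A0) + - ln (d x y))" by (intro mult_left_mono) auto
        also have "\<dots> \<le> 2 * C * ln (2 * A0) + C"
          using L(10)[OF xy d0] d True mult_right_mono[OF osc ln2A] by (simp only: distrib_left) linarith
        finally show ?thesis using L(5) ln4A C1 mult_nonneg_nonneg[OF L(5) ln4A] by linarith
      qed
    next
      \<comment> \<open>The radius is bounded below, and on a local ball r \<le> E(c). So |ln r|
        \<le> ln (4 A0) + ln E(c), and the estimate for the factor ln E(c) applies again.\<close>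
      case False
      have "r * 2 * 1 \<le> r * 2 * A0" using A0 r by (intro mult_left_mono) auto
      then have "2 * r \<le> 1 + d c x0" using l by (simp add: local_ball_def mult_ac)
      then have "r \<le> E c" using r d_nonneg[OF c x0] exp_ge_add_one_self[of "1::real"] unfolding E_def by linarith
      then have 1: "ln r \<le> ln (E c)" using r by simp
      have "1 \<le> 4 * A0 * r" using False by simp
      then have "0 \<le> ln (4 * A0 * r)" by simp
      also have "\<dots> = ln (4 * A0) + ln r" using A0 r by (subst ln_mult) auto
      finally have "\<bar>ln r\<bar> \<le> ln (4 * A0) + ln (E c)" using 1 ln4A ln_E[OF c] by linarith
      then have "\<bar>P x - P y\<bar> * \<bar>ln r\<bar> \<le> \<bar>P x - P y\<bar> * (ln (4 * A0) + ln (E c))" by (intro mult_left_mono) auto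
      also have "\<dots> \<le> 2 * C * ln (4 * A0) + C1" using a mult_right_mono[OF osc ln4A] by (simp add: distrib_left)
      finally show ?thesis using L(5) mult_nonneg_nonneg[OF L(5) ln2A] by linarith
    qed
    show ?thesis using a b by (simp add: K_def distrib_left)
  qed
  moreover have "0 \<le> K" unfolding K_def using C1 L(5) ln2A ln4A by simp
  ultimately show ?thesis by blast
qed

text \<open>Summation over dyadic balls about \<open>x0\<close>. The hypothesis is polynomial growth
  rather than doubling, so that the lemma can be applied to a weighted measure before that measure
  is known to double.\<close>

lemma integrable_tail:
  assumes s: "sets \<nu> = sets M" and Q: "1 \<le> Q" and C0: "0 \<le> C0"
    and growth: "\<And>k::nat. emeasure \<nu> (B x0 (2 ^ k)) \<le> ennreal (C0 * Q ^ k)"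
  shows "\<exists>t0>0. \<forall>t\<ge>t0. (\<integral>\<^sup>+x. ennreal (E x powr (- t)) \<partial>\<nu>) < \<infinity>"
proof -
  note [measurable_cong] = s
  have sp: "space \<nu> = space M" using s by (rule sets_eq_imp_space_eq)
  \<comment> \<open>From 2^t \<ge> 2 Q, the growth Q^k against the decay 2^(-tk) leaves the ratio
    1/2.\<close>
  define t0 where "t0 = max 1 (log 2 (2 * Q))"
  have "(\<integral>\<^sup>+x. ennreal (E x powr (- t)) \<partial>\<nu>) < \<infinity>" if t: "t0 \<le> t" for t
  proof -
    have t1: "1 \<le> t" "log 2 (2 * Q) \<le> t" using t by (auto simp: t0_def)
    have "2 * Q = 2 powr (log 2 (2 * Q))" using Q by simp
    also have "\<dots> \<le> 2 powr t" using t1 by (intro powr_mono) auto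
    finally have Qt: "2 * Q \<le> 2 powr t" .
    define u where "u k = 2 powr t * (1 / (2 * Q)) ^ k" for k :: nat
    have u0: "0 \<le> u k" for k unfolding u_def using Q by simp
    have Bm [measurable]: "B x0 (2 ^ k) \<in> sets M" for k :: nat by (rule ball_sets) auto
    have pw: "ennreal (E x powr (- t)) \<le> (\<Sum>k. ennreal (u k) * indicator (B x0 (2 ^ k)) x)" if x: "x \<in> space M" for x
    proof -
      obtain n0 :: nat where "d x0 x < 2 ^ n0" using real_arch_pow[of 2 "d x0 x"] by auto
      \<comment> \<open>The least dyadic ball containing x: then also E(x) \<ge> 2^k / 2, for k = 0
        because E \<ge> 1.\<close>
      define k where "k = (LEAST k::nat. d x0 x < 2 ^ k)"
      have k: "d x0 x < 2 ^ k" unfolding k_def by (rule LeastI) fact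
      have Ek: "2 ^ k / 2 \<le> E x"
      proof (cases k)
        case 0 then show ?thesis using E_ge1[OF x] by simp
      next
        case (Suc j)
        have "\<not> d x0 x < 2 ^ j" using not_less_Least[of j "\<lambda>k. d x0 x < 2 ^ k"] Suc by (simp add: k_def)
        then show ?thesis using d_sym[OF x x0] exp_gt_zero[of "1::real"] unfolding E_def Suc by (simp add: add_increasing)
      qed
      have "E x powr (- t) \<le> (2 ^ k / 2) powr (- t)" using Ek t1 by (intro powr_mono2') auto
      also have "\<dots> = 2 powr t * (1 / 2 powr t) ^ k"
      proof -
        have "(2::real) ^ k / 2 = 2 powr (real k - 1)" by (simp add: powr_diff powr_realpow)
        then have "(2 ^ k / 2) powr (- t) = 2 powr (t + (- t) * real k)" by (simp only: powr_powr) (simp add: algebra_simps)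
        also have "\<dots> = 2 powr t * (2 powr (- t)) ^ k" by (simp only: powr_add) (simp add: powr_power mult.commute)
        finally show ?thesis by (simp only: powr_minus_divide)
      qed
      also have "\<dots> \<le> u k" unfolding u_def using Qt Q by (intro mult_left_mono power_mono divide_left_mono) auto
      finally have "ennreal (E x powr (- t)) \<le> ennreal (u k) * indicator (B x0 (2 ^ k)) x"
        using k x by (simp add: ball_iff ennreal_leI)
      also have "\<dots> \<le> (\<Sum>k. ennreal (u k) * indicator (B x0 (2 ^ k)) x)"
        using sum_le_suminf[of "\<lambda>k. ennreal (u k) * indicator (B x0 (2 ^ k)) x" "{k}"]
        by (simp del: sum_mult_indicator)
      finally show ?thesis .
    qed
    have "(\<integral>\<^sup>+x. ennreal (E x powr (- t)) \<partial>\<nu>) \<le> (\<integral>\<^sup>+x. (\<Sum>k. ennreal (u k) * indicator (B x0 (2 ^ k)) x) \<partial>\<nu>)"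
      using pw sp by (intro nn_integral_mono) auto
    also have "\<dots> = (\<Sum>k. (\<integral>\<^sup>+x. ennreal (u k) * indicator (B x0 (2 ^ k)) x \<partial>\<nu>))"
      by (rule nn_integral_suminf) simp
    also have "\<dots> = (\<Sum>k. ennreal (u k) * emeasure \<nu> (B x0 (2 ^ k)))"
      by (simp add: nn_integral_cmult_indicator)
    also have "\<dots> \<le> (\<Sum>k. ennreal (2 powr t * C0 * (1/2) ^ k))"
    proof (rule suminf_le)
      fix k
      have "ennreal (u k) * emeasure \<nu> (B x0 (2 ^ k)) \<le> ennreal (u k) * ennreal (C0 * Q ^ k)"
        using growth by (intro mult_left_mono) auto
      also have "\<dots> = ennreal (u k * (C0 * Q ^ k))" using u0 C0 Q by (simp add: ennreal_mult)
      also have "u k * (C0 * Q ^ k) = 2 powr t * C0 * (1/2) ^ k" using Q by (simp add: u_def power_divide power_mult_distrib)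
      finally show "ennreal (u k) * emeasure \<nu> (B x0 (2 ^ k)) \<le> ennreal (2 powr t * C0 * (1/2) ^ k)" .
    qed auto
    also have "\<dots> = ennreal (\<Sum>k. 2 powr t * C0 * (1/2) ^ k)"
      using C0 by (intro suminf_ennreal2) (auto intro!: summable_mult summable_geometric)
    finally show ?thesis by (rule le_less_trans) simp
  qed
  moreover have "0 < t0" by (simp add: t0_def)
  ultimately show ?thesis by blast
qed

lemma doubling_tail:
  assumes "doubling \<nu> D"
  shows "\<exists>t0>0. \<forall>t\<ge>t0. (\<integral>\<^sup>+x. ennreal (E x powr (- t)) \<partial>\<nu>) < \<infinity>"
proof (rule integrable_tail)
  note D = doublingD[OF assms]
  show "sets \<nu> = sets M" "1 \<le> D" by fact+
  show "0 \<le> measure \<nu> (B x0 1)" by simp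
  fix k :: nat
  have "measure \<nu> (B x0 (2 ^ k * 1)) \<le> D ^ k * measure \<nu> (B x0 1)"
    using doubling_iterate[of "\<lambda>c r. measure \<nu> (B c r)" D x0 1 k] D(2,8) by simp
  then show "emeasure \<nu> (B x0 (2 ^ k)) \<le> ennreal (measure \<nu> (B x0 1) * D ^ k)"
    using D(7)[OF x0, of "2 ^ k"] by (simp add: ennreal_leI mult.commute)
qed

lemma doubling_bounds:
  assumes "doubling \<nu> D"
  shows "\<exists>m\<ge>0. \<forall>c\<in>space M. \<forall>r>0. \<bar>ln (measure \<nu> (B c r))\<bar> \<le> m * (ln (E c) + \<bar>ln r\<bar>)"
    and "\<exists>\<kappa>>0. \<forall>c\<in>space M. \<forall>r>0. \<not> local_ball c r \<longrightarrow> \<kappa> \<le> measure \<nu> (B c r)"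
proof -
  note D = doublingD[OF assms]
  have mono: "measure \<nu> (B c r) \<le> measure \<nu> (B c' r')"
    if "c \<in> space M" "0 < r" "c' \<in> space M" "0 < r'" "B c r \<subseteq> B c' r'" for c r c' r'
    using that D(9)[of c' r'] D(9)[of c r] D(5)[of c' r'] by (intro measure_mono_fmeasurable) (auto simp: fmeasurable_def)
  show "\<exists>m\<ge>0. \<forall>c\<in>space M. \<forall>r>0. \<bar>ln (measure \<nu> (B c r))\<bar> \<le> m * (ln (E c) + \<bar>ln r\<bar>)"
    by (rule ball_functional_bounds(1)[where D = D]) (auto intro: D(2,6,8) mono)
  show "\<exists>\<kappa>>0. \<forall>c\<in>space M. \<forall>r>0. \<not> local_ball c r \<longrightarrow> \<kappa> \<le> measure \<nu> (B c r)"
    by (rule ball_functional_bounds(2)[where D = D]) (auto intro: D(2,6,8) mono)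
qed

end

section \<open>Unweighted variable exponent bounds\<close>

lemma ennreal_finiteE:
  assumes "(X::ennreal) < \<infinity>"
  obtains r where "0 \<le> r" "X = ennreal r"
  using assms by (cases X rule: ennreal_cases) auto

lemma set_nn_integral_finite:
  assumes [measurable]: "A \<in> sets \<nu>" "G \<in> borel_measurable \<nu>" and A: "emeasure \<nu> A < \<infinity>"
    and le: "\<And>y. y \<in> A \<Longrightarrow> g y \<le> k + G y" and k: "0 \<le> k" and G: "\<And>y. y \<in> A \<Longrightarrow> 0 \<le> G y"
    and fin: "(\<integral>\<^sup>+y. ennreal (G y) \<partial>\<nu>) < \<infinity>"
  shows "(\<integral>\<^sup>+y\<in>A. ennreal (g y) \<partial>\<nu>) < \<infinity>"
proof -
  have "(\<integral>\<^sup>+y\<in>A. ennreal (g y) \<partial>\<nu>) \<le> (\<integral>\<^sup>+y. ennreal k * indicator A y + ennreal (G y) \<partial>\<nu>)"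
  proof (rule nn_integral_mono)
    fix y
    show "ennreal (g y) * indicator A y \<le> ennreal k * indicator A y + ennreal (G y)"
      using le[of y] k G[of y] by (cases "y \<in> A") (auto simp: ennreal_plus[symmetric] simp del: ennreal_plus intro!: ennreal_leI)
  qed
  also have "\<dots> = ennreal k * emeasure \<nu> A + (\<integral>\<^sup>+y. ennreal (G y) \<partial>\<nu>)"
    by (subst nn_integral_add) (auto simp: nn_integral_cmult_indicator)
  also have "\<dots> < \<infinity>" using A fin by (auto simp: ennreal_mult_less_top)
  finally show ?thesis .
qed

context quasi_metric_measurable
begin

text \<open>Logarithmic form of the standard fact that \<nu>(B) raised to minus the oscillation of
  \<open>P\<close> on B stays bounded. On a local ball |ln \<nu>(B)| is at most a multiple of ln
  E(c) + |ln r|, which the oscillation compensates; otherwise \<nu>(B) is bounded below.\<close>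

lemma log_holder_measure_osc:
  assumes dbl: "doubling \<nu> D" and lh: "log_holder P b b' Pinf C" and A: "1 \<le> A"
  shows "\<exists>K\<ge>0. \<forall>c\<in>space M. \<forall>r>0. \<forall>x\<in>B c r. \<forall>y\<in>B c r.
    \<bar>P x - P y\<bar> * ln (max 1 (A / measure \<nu> (B c r))) \<le> K"
proof -
  note D = doublingD[OF dbl] and L = log_holderD[OF lh]
  obtain m where m: "0 \<le> m" "\<And>c r. c \<in> space M \<Longrightarrow> 0 < r \<Longrightarrow> \<bar>ln (measure \<nu> (B c r))\<bar> \<le> m * (ln (E c) + \<bar>ln r\<bar>)"
    using doubling_bounds(1)[OF dbl] by blast
  obtain \<kappa> where \<kappa>: "0 < \<kappa>" "\<And>c r. c \<in> space M \<Longrightarrow> 0 < r \<Longrightarrow> \<not> local_ball c r \<Longrightarrow> \<kappa> \<le> measure \<nu> (B c r)"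
    using doubling_bounds(2)[OF dbl] by blast
  obtain K0 where K0: "0 \<le> K0" "\<And>c r x y. c \<in> space M \<Longrightarrow> 0 < r \<Longrightarrow> local_ball c r \<Longrightarrow> x \<in> B c r \<Longrightarrow> y \<in> B c r \<Longrightarrow>
     \<bar>P x - P y\<bar> * (ln (E c) + \<bar>ln r\<bar>) \<le> K0"
    using log_holder_local_osc[OF lh] by blast
  have lnA: "0 \<le> ln A" using A by simp
  have b': "1 < b'" using L(2-4) by linarith
  define K where "K = (ln A + m) * K0 + b' * ln (max 1 (A / \<kappa>))"
  have K1: "0 \<le> (ln A + m) * K0" using lnA m K0 by simp
  have K2: "0 \<le> b' * ln (max 1 (A / \<kappa>))" using b' by simp
  have "\<bar>P x - P y\<bar> * ln (max 1 (A / measure \<nu> (B c r))) \<le> K"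
    if c: "c \<in> space M" and r: "0 < r" and x: "x \<in> B c r" and y: "y \<in> B c r" for c r x y
  proof -
    define V where "V = measure \<nu> (B c r)"
    have V: "0 < V" unfolding V_def using D(6) c r by blast
    have X: "x \<in> space M" "y \<in> space M" using x y by (auto simp: ball_iff)
    show ?thesis
    proof (cases "local_ball c r")
      case True
      have "ln (max 1 (A / V)) \<le> ln A + \<bar>ln V\<bar>" using V A lnA by (auto simp: max_def ln_div)
      also have "\<dots> \<le> ln A * (ln (E c) + \<bar>ln r\<bar>) + m * (ln (E c) + \<bar>ln r\<bar>)"
      proof (rule add_mono)
        show "ln A \<le> ln A * (ln (E c) + \<bar>ln r\<bar>)"
          using mult_left_mono[of 1 "ln (E c) + \<bar>ln r\<bar>" "ln A"] ln_E[OF c] lnA by simp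
        show "\<bar>ln V\<bar> \<le> m * (ln (E c) + \<bar>ln r\<bar>)" unfolding V_def by (rule m(2)[OF c r])
      qed
      also have "\<dots> = (ln A + m) * (ln (E c) + \<bar>ln r\<bar>)" by (simp add: distrib_right)
      finally have "\<bar>P x - P y\<bar> * ln (max 1 (A / V)) \<le> \<bar>P x - P y\<bar> * ((ln A + m) * (ln (E c) + \<bar>ln r\<bar>))"
        by (intro mult_left_mono) auto
      also have "\<dots> = (ln A + m) * (\<bar>P x - P y\<bar> * (ln (E c) + \<bar>ln r\<bar>))" by simp
      also have "\<dots> \<le> (ln A + m) * K0" using K0(2)[OF c r True x y] lnA m(1) by (intro mult_left_mono) auto
      finally show ?thesis using K2 by (simp add: K_def V_def)
    next
      case False
      have "A / V \<le> A / \<kappa>" using \<kappa>(2)[OF c r False] \<kappa>(1) V A by (intro divide_left_mono) (auto simp: V_def)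
      then have "ln (max 1 (A / V)) \<le> ln (max 1 (A / \<kappa>))" by (subst ln_le_cancel_iff) auto
      moreover have "\<bar>P x - P y\<bar> \<le> b'" using L(2) L(6,7)[OF X(1)] L(6,7)[OF X(2)] by linarith
      ultimately have "\<bar>P x - P y\<bar> * ln (max 1 (A / V)) \<le> b' * ln (max 1 (A / \<kappa>))"
        using b' by (intro mult_mono) auto
      then show ?thesis using K1 by (simp add: K_def V_def)
    qed
  qed
  moreover have "0 \<le> K" unfolding K_def using K1 K2 by simp
  ultimately show ?thesis by blast
qed

text \<open>A Jensen inequality for the exponent P/b, up to tails. Dividing by b leaves room: the
  function averaged on the right has bounded norm in L^b with b > 1, where the constant exponent
  maximal theorem is available. The function is cut at height 1. The large part is treated with the
  least exponent on the ball, the small part with the limit exponent.\<close>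

lemma variable_average_bound:
  assumes dbl: "doubling \<nu> D" and lh: "log_holder P b b' Pinf C" and A: "1 \<le> A" and t: "0 < t"
    and tail: "(\<integral>\<^sup>+x. ennreal (E x powr (- t)) \<partial>\<nu>) < \<infinity>"
  shows "\<exists>K\<ge>0. \<forall>g c r x. g \<in> borel_measurable M \<longrightarrow> (\<forall>y\<in>space M. 0 \<le> g y) \<longrightarrow>
     (\<integral>\<^sup>+y. ennreal (g y powr P y) \<partial>\<nu>) \<le> ennreal A \<longrightarrow> c \<in> space M \<longrightarrow> 0 < r \<longrightarrow> x \<in> B c r \<longrightarrow>
     avg \<nu> (B c r) g powr (P x / b) \<le> K * (avg \<nu> (B c r) (\<lambda>y. g y powr (P y / b) + E y powr (- t)) + E x powr (- t))"
proof -
  note D = doublingD[OF dbl] and L = log_holderD[OF lh]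
  note [measurable_cong] = D(1) and [measurable] = L(1)
  obtain K1 where K1: "0 \<le> K1" "\<And>c r x y. c \<in> space M \<Longrightarrow> 0 < r \<Longrightarrow> x \<in> B c r \<Longrightarrow> y \<in> B c r \<Longrightarrow>
     \<bar>P x - P y\<bar> * ln (max 1 (A / measure \<nu> (B c r))) \<le> K1"
    using log_holder_measure_osc[OF dbl lh A] by blast
  define q where "q y = P y / b" for y
  define qi where "qi = Pinf / b"
  have b: "0 < b" "1 \<le> b" using L(2) by auto
  have q1: "1 \<le> q y" and qP: "q y \<le> P y" and qb': "q y \<le> b'" if "y \<in> space M" for y
  proof -
    show "1 \<le> q y" unfolding q_def using b L(6)[OF that] by (simp add: field_simps)
    show "q y \<le> P y" unfolding q_def using b L(2) L(6)[OF that] mult_left_mono[of 1 b "P y"] by (simp add: field_simps)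
    then show "q y \<le> b'" using L(7)[OF that] by simp
  qed
  have qi1: "1 \<le> qi" unfolding qi_def using b L(3) by (simp add: field_simps)
  have qdiff: "\<bar>q x - q y\<bar> \<le> \<bar>P x - P y\<bar>" for x y
    unfolding q_def diff_divide_distrib[symmetric] abs_divide using b mult_left_mono[of 1 b "\<bar>P x - P y\<bar>"] by (simp add: field_simps)
  have qosc: "\<bar>q y - qi\<bar> * ln (E y) \<le> C" if "y \<in> space M" for y
  proof -
    have "\<bar>q y - qi\<bar> \<le> \<bar>P y - Pinf\<bar>"
      unfolding q_def qi_def diff_divide_distrib[symmetric] abs_divide using b mult_left_mono[of 1 b "\<bar>P y - Pinf\<bar>"] by (simp add: field_simps)
    then have "\<bar>q y - qi\<bar> * ln (E y) \<le> \<bar>P y - Pinf\<bar> * ln (E y)" using ln_E[OF that] by (intro mult_right_mono) auto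
    then show ?thesis using L(8)[OF that] by simp
  qed
  \<comment> \<open>The cost of exchanging \<open>q y\<close> and the limit exponent
    \<open>qi\<close> for values at most 1, from \<open>powr_exponent_switch\<close> with threshold
    parameters equal to 1.\<close>
  define c1 where "c1 = exp (C * t)"
  have c1: "1 \<le> c1" unfolding c1_def using L(5) t by simp
  have sw1: "s powr qi \<le> c1 * s powr q y + E y powr (- t)" if "y \<in> space M" "0 \<le> s" "s \<le> 1" for s y
    using powr_exponent_switch[of 1 qi "q y" "ln (E y)" C s 1 1 t] that qi1 qosc[OF that(1)] ln_E[OF that(1)] t
    by (simp add: c1_def E_powr abs_minus_commute)
  have sw2: "s powr q y \<le> c1 * s powr qi + E y powr (- t)" if "y \<in> space M" "0 \<le> s" "s \<le> 1" for s y
    using powr_exponent_switch[of 1 "q y" qi "ln (E y)" C s 1 1 t] that q1[OF that(1)] qosc[OF that(1)] ln_E[OF that(1)] t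
    by (simp add: c1_def E_powr)
  define K where "K = 2 powr b' * (exp K1 + c1 * c1 + 1)"
  have K0: "0 \<le> K" unfolding K_def using c1 by (intro mult_nonneg_nonneg add_nonneg_nonneg) auto
  have "avg \<nu> (B c r) g powr q x \<le> K * (avg \<nu> (B c r) (\<lambda>y. g y powr q y + E y powr (- t)) + E x powr (- t))"
    if [measurable]: "g \<in> borel_measurable M" and g: "\<And>y. y \<in> space M \<Longrightarrow> 0 \<le> g y"
     and gA: "(\<integral>\<^sup>+y. ennreal (g y powr P y) \<partial>\<nu>) \<le> ennreal A"
     and c: "c \<in> space M" and r: "0 < r" and x: "x \<in> B c r" for g c r x
  proof -
    define S where "S = B c r"
    define V where "V = measure \<nu> S"
    note S = D(4,5,6,7,9)[OF c r, folded S_def]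
    have V: "0 < V" unfolding V_def by (rule S(3))
    have [measurable]: "S \<in> sets M" using S(5) D(1) by simp
    have SX: "y \<in> space M" if "y \<in> S" for y using that by (simp add: S_def ball_iff)
    have xX: "x \<in> space M" using x by (simp add: ball_iff)
    have [measurable]: "q \<in> borel_measurable M" unfolding q_def[abs_def] by measurable
    let ?h = "\<lambda>y. g y powr q y + E y powr (- t)"
    have gfin: "(\<integral>\<^sup>+y. ennreal (g y powr P y) \<partial>\<nu>) < \<infinity>" using gA by (rule le_less_trans) simp
    have hfin: "(\<integral>\<^sup>+y\<in>S. ennreal (?h y) \<partial>\<nu>) < \<infinity>"
    proof (rule set_nn_integral_finite[where k = 2 and G = "\<lambda>y. g y powr P y"])
      fix y assume "y \<in> S"
      then have y: "y \<in> space M" by (rule SX)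
      have "g y powr q y \<le> 1 + g y powr P y"
      proof (cases "g y \<le> 1")
        case True
        then have "g y powr q y \<le> 1" using g[OF y] q1[OF y] by (intro powr_le1) auto
        then show ?thesis by (smt (verit) powr_ge_zero)
      next
        case False
        then have "g y powr q y \<le> g y powr P y" using qP[OF y] by (intro powr_mono) auto
        then show ?thesis by simp
      qed
      then show "?h y \<le> 2 + g y powr P y" using E_powr_le1[OF y, of t] t by simp
    qed (use S gfin in auto)
    define H where "H = avg \<nu> S ?h"
    have Heq: "(\<integral>\<^sup>+y\<in>S. ennreal (?h y) \<partial>\<nu>) = ennreal (H * V)"
      unfolding H_def V_def by (rule avg_eq_integral) (use S hfin in auto)
    have H0: "0 \<le> H" by (simp add: H_def)
    let ?g1 = "\<lambda>y. if 1 \<le> g y then g y else 0"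
    let ?g2 = "\<lambda>y. if 1 \<le> g y then 0 else g y"
    have g1P: "?g1 y \<le> g y powr P y" if "y \<in> space M" for y
    proof (cases "1 \<le> g y")
      case True
      then have "g y powr 1 \<le> g y powr P y" using q1[OF that] qP[OF that] by (intro powr_mono) auto
      then show ?thesis using True by simp
    qed auto
    have g1fin: "(\<integral>\<^sup>+y\<in>S. ennreal (?g1 y) \<partial>\<nu>) < \<infinity>"
      by (rule set_nn_integral_finite[where k = 0 and G = "\<lambda>y. g y powr P y"]) (use S gfin g1P SX in auto)
    have g2fin: "(\<integral>\<^sup>+y\<in>S. ennreal (?g2 y) \<partial>\<nu>) < \<infinity>"
      by (rule set_nn_integral_finite[where k = 1 and G = "\<lambda>y. 0"]) (use S in auto)
    define a where "a = avg \<nu> S g"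
    define a1 where "a1 = avg \<nu> S ?g1"
    define a2 where "a2 = avg \<nu> S ?g2"
    have a0: "0 \<le> a" "0 \<le> a1" "0 \<le> a2" by (auto simp: a_def a1_def a2_def)
    have a1eq: "(\<integral>\<^sup>+y\<in>S. ennreal (?g1 y) \<partial>\<nu>) = ennreal (a1 * V)"
      unfolding a1_def V_def by (rule avg_eq_integral) (use S g1fin in auto)
    have a2eq: "(\<integral>\<^sup>+y\<in>S. ennreal (?g2 y) \<partial>\<nu>) = ennreal (a2 * V)"
      unfolding a2_def V_def by (rule avg_eq_integral) (use S g2fin in auto)
    have asum: "a \<le> a1 + a2"
      unfolding a_def
    proof (rule avg_le_bound)
      have "(\<integral>\<^sup>+y\<in>S. ennreal (g y) \<partial>\<nu>) = (\<integral>\<^sup>+y. ennreal (?g1 y) * indicator S y + ennreal (?g2 y) * indicator S y \<partial>\<nu>)"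
        by (intro nn_integral_cong) (auto simp: indicator_def)
      also have "\<dots> = ennreal (a1 * V) + ennreal (a2 * V)"
        unfolding a1eq[symmetric] a2eq[symmetric] by (rule nn_integral_add) auto
      also have "\<dots> = ennreal ((a1 + a2) * V)" using a0 V by (simp add: distrib_right)
      finally show "(\<integral>\<^sup>+y\<in>S. ennreal (g y) \<partial>\<nu>) \<le> ennreal ((a1 + a2) * measure \<nu> S)" by (simp add: V_def)
    qed (use S a0 in auto)
    have a1A: "a1 \<le> A / V"
      unfolding a1_def
    proof (rule avg_le_bound)
      have "(\<integral>\<^sup>+y\<in>S. ennreal (?g1 y) \<partial>\<nu>) \<le> (\<integral>\<^sup>+y. ennreal (g y powr P y) \<partial>\<nu>)"
      proof (rule nn_integral_mono)
        fix y assume "y \<in> space \<nu>"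
        then have "ennreal (?g1 y) \<le> ennreal (g y powr P y)" using g1P D(3) by (intro ennreal_leI) auto
        then show "ennreal (?g1 y) * indicator S y \<le> ennreal (g y powr P y)" by (auto simp: indicator_def)
      qed
      also have "\<dots> \<le> ennreal A" by (rule gA)
      finally show "(\<integral>\<^sup>+y\<in>S. ennreal (?g1 y) \<partial>\<nu>) \<le> ennreal (A / V * measure \<nu> S)"
        using V by (simp add: V_def)
    qed (use S V A in auto)
    \<comment> \<open>Since \<open>?g1\<close> is 0 or at least 1, its power \<open>qB\<close> is at
      most g^q(y) at every point of the ball. Going back from \<open>qB\<close> to
      \<open>q x\<close> is affordable because a1 \<le> A / V.\<close>
    define qB where "qB = Inf (q ` S)"
    have qB1: "1 \<le> qB" unfolding qB_def using x SX q1 by (intro cINF_greatest) (auto simp: S_def)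
    have qBle: "qB \<le> q y" if "y \<in> S" for y
      unfolding qB_def using that SX q1 by (intro cINF_lower bdd_belowI[of _ 1]) auto
    have xS: "x \<in> S" using x by (simp add: S_def)
    have qBosc: "(q x - qB) * ln (max 1 (A / V)) \<le> K1"
    proof (cases "ln (max 1 (A / V)) = 0")
      case True then show ?thesis using K1(1) by simp
    next
      case False
      then have l: "0 < ln (max 1 (A / V))" using ln_ge_zero[of "max 1 (A / V)"] by linarith
      have "q x - K1 / ln (max 1 (A / V)) \<le> qB"
        unfolding qB_def
      proof (rule cINF_greatest)
        fix y assume y: "y \<in> S"
        have "(q x - q y) * ln (max 1 (A / V)) \<le> \<bar>P x - P y\<bar> * ln (max 1 (A / V))"
          using qdiff[of x y] l by (intro mult_right_mono) auto
        also have "\<dots> \<le> K1" using K1(2)[OF c r x] y by (simp add: S_def V_def)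
        finally have "q x - q y \<le> K1 / ln (max 1 (A / V))" using l by (simp only: pos_le_divide_eq)
        then show "q x - K1 / ln (max 1 (A / V)) \<le> q y" by linarith
      qed (use xS in auto)
      then have "q x - qB \<le> K1 / ln (max 1 (A / V))" by linarith
      then show ?thesis using l by (simp only: pos_le_divide_eq)
    qed
    have "a1 powr q x \<le> exp K1 * a1 powr qB"
    proof (cases "a1 \<le> 1")
      case True
      then have "a1 powr q x \<le> a1 powr qB" using a0 qBle[OF xS] by (intro powr_mono') auto
      also have "\<dots> \<le> exp K1 * a1 powr qB" using K1(1) mult_right_mono[of 1 "exp K1" "a1 powr qB"] by simp
      finally show ?thesis .
    next
      case False
      have "ln a1 \<le> ln (max 1 (A / V))" using False a1A by (subst ln_le_cancel_iff) auto
      then have "\<bar>q x - qB\<bar> * \<bar>ln a1\<bar> \<le> (q x - qB) * ln (max 1 (A / V))"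
        using False qBle[OF xS] by (intro mult_mono) auto
      then show ?thesis using False qBosc by (intro powr_exponent_change) auto
    qed
    moreover have "a1 powr qB \<le> H"
    proof -
      have "ennreal (a1 powr qB * V) \<le> (\<integral>\<^sup>+y\<in>S. ennreal (?g1 y powr qB) \<partial>\<nu>)"
        unfolding V_def by (rule jensen_powr) (use S a1eq g a0 qB1 D(3) in \<open>auto simp: V_def\<close>)
      also have "\<dots> \<le> (\<integral>\<^sup>+y\<in>S. ennreal (?h y) \<partial>\<nu>)"
      proof (rule nn_integral_mono)
        fix y
        show "ennreal (?g1 y powr qB) * indicator S y \<le> ennreal (?h y) * indicator S y"
        proof (cases "y \<in> S")
          case True
          have "?g1 y powr qB \<le> ?h y"
          proof (cases "1 \<le> g y")
            case g1: True
            then have "g y powr qB \<le> g y powr q y" using qBle[OF True] by (intro powr_mono) auto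
            then show ?thesis using g1 by (simp add: add_increasing2)
          qed auto
          then have "ennreal (?g1 y powr qB) \<le> ennreal (?h y)" by (rule ennreal_leI)
          then show ?thesis using True by (simp only: indicator_simps mult_1_right)
        qed simp
      qed
      also note Heq
      finally show ?thesis using H0 V by (simp add: ennreal_le_iff)
    qed
    ultimately have 1: "a1 powr q x \<le> exp K1 * H"
      by (meson exp_ge_zero mult_left_mono order_trans)
    have a21: "a2 \<le> 1"
      unfolding a2_def
    proof (rule avg_le_bound)
      have "(\<integral>\<^sup>+y\<in>S. ennreal (?g2 y) \<partial>\<nu>) \<le> (\<integral>\<^sup>+y. indicator S y \<partial>\<nu>)"
        by (intro nn_integral_mono) (auto simp: indicator_def ennreal_le_1)
      then show "(\<integral>\<^sup>+y\<in>S. ennreal (?g2 y) \<partial>\<nu>) \<le> ennreal (1 * measure \<nu> S)" using S by simp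
    qed (use S in auto)
    \<comment> \<open>Jensen with the constant exponent \<open>qi\<close>; the error of switching
      from \<open>q y\<close> to \<open>qi\<close> is covered by the tail contained in
      \<open>?h\<close>.\<close>
    have 2: "a2 powr qi \<le> c1 * H"
    proof -
      have "ennreal (a2 powr qi * V) \<le> (\<integral>\<^sup>+y\<in>S. ennreal (?g2 y powr qi) \<partial>\<nu>)"
        unfolding V_def by (rule jensen_powr) (use S a2eq g a0 qi1 D(3) in \<open>auto simp: V_def\<close>)
      also have "\<dots> \<le> (\<integral>\<^sup>+y. ennreal c1 * (ennreal (?h y) * indicator S y) \<partial>\<nu>)"
      proof (rule nn_integral_mono)
        fix y
        show "ennreal (?g2 y powr qi) * indicator S y \<le> ennreal c1 * (ennreal (?h y) * indicator S y)"
        proof (cases "y \<in> S")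
          case True
          have "?g2 y powr qi \<le> c1 * ?h y"
          proof (cases "1 \<le> g y")
            case True then show ?thesis using c1 by simp
          next
            case False
            have "g y powr qi \<le> c1 * g y powr q y + E y powr (- t)"
              using sw1[OF SX[OF True], of "g y"] False g[OF SX[OF True]] by simp
            also have "\<dots> \<le> c1 * ?h y" using c1 mult_right_mono[of 1 c1 "E y powr (- t)"] by (simp add: distrib_left)
            finally show ?thesis using False by simp
          qed
          then have "ennreal (?g2 y powr qi) \<le> ennreal (c1 * ?h y)" by (rule ennreal_leI)
          also have "\<dots> = ennreal c1 * ennreal (?h y)" using c1 by (intro ennreal_mult) auto
          finally show ?thesis using True by (simp only: indicator_simps mult_1_right)
        qed simp
      qed
      also have "\<dots> = ennreal c1 * (\<integral>\<^sup>+y\<in>S. ennreal (?h y) \<partial>\<nu>)" by (rule nn_integral_cmult) measurable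
      also have "\<dots> = ennreal (c1 * (H * V))" unfolding Heq using c1 H0 V by (intro ennreal_mult[symmetric]) auto
      finally have "a2 powr qi * V \<le> c1 * (H * V)" by (subst (asm) ennreal_le_iff) (use c1 H0 V in auto)
      then show ?thesis using V by simp
    qed
    have 3: "a2 powr q x \<le> c1 * (c1 * H) + E x powr (- t)"
      using sw2[OF xX a0(3) a21] mult_left_mono[OF 2, of c1] c1 by linarith
    have "a powr q x \<le> (a1 + a2) powr q x" using asum a0 q1[OF xX] by (intro powr_mono2) auto
    also have "\<dots> \<le> 2 powr q x * (a1 powr q x + a2 powr q x)" using a0 q1[OF xX] by (intro powr_add_le) auto
    also have "\<dots> \<le> 2 powr b' * ((exp K1 + c1 * c1 + 1) * (H + E x powr (- t)))"
    proof (rule mult_mono)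
      show "2 powr q x \<le> 2 powr b'" using qb'[OF xX] by (intro powr_mono) auto
      have "0 \<le> (exp K1 + c1 * c1) * E x powr (- t)" using c1 by (intro mult_nonneg_nonneg add_nonneg_nonneg) auto
      then show "a1 powr q x + a2 powr q x \<le> (exp K1 + c1 * c1 + 1) * (H + E x powr (- t))"
        using 1 3 H0 by (simp add: algebra_simps)
    qed auto
    finally show ?thesis by (simp add: K_def H_def a_def S_def mult.assoc)
  qed
  then show ?thesis using K0 unfolding q_def by blast
qed

text \<open>The pointwise inequality of \<open>variable_average_bound\<close> is raised to the power
  b and \<open>strong_type\<close> is applied with exponent b to h = g^(P/b) + E^(-t), whose b-th
  power is integrable by the modular bound on g.\<close>

theorem variable_maximal_bound:
  assumes dbl: "doubling \<nu> D" and lh: "log_holder P b b' Pinf C"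
  shows "\<exists>K\<ge>0. \<forall>I g. family I \<longrightarrow> g \<in> borel_measurable M \<longrightarrow> (\<forall>y\<in>space M. 0 \<le> g y) \<longrightarrow>
     (\<integral>\<^sup>+y. ennreal (g y powr P y) \<partial>\<nu>) \<le> ennreal A \<longrightarrow>
     (\<integral>\<^sup>+y. ennreal (MF \<nu> I g y powr P y) \<partial>\<nu>) \<le> ennreal K"
proof -
  note D = doublingD[OF dbl] and L = log_holderD[OF lh]
  note [measurable_cong] = D(1) and [measurable] = L(1)
  define A' where "A' = max 1 A"
  have A': "1 \<le> A'" "ennreal A \<le> ennreal A'" by (auto simp: A'_def intro!: ennreal_leI)
  obtain t where t: "0 < t" and tail: "(\<integral>\<^sup>+x. ennreal (E x powr (- t)) \<partial>\<nu>) < \<infinity>"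
    using doubling_tail[OF dbl] by blast
  obtain T where T: "0 \<le> T" "(\<integral>\<^sup>+x. ennreal (E x powr (- t)) \<partial>\<nu>) = ennreal T" using tail by (rule ennreal_finiteE)
  obtain K where K: "0 \<le> K" "\<And>g c r x. g \<in> borel_measurable M \<Longrightarrow> (\<forall>y\<in>space M. 0 \<le> g y) \<Longrightarrow>
     (\<integral>\<^sup>+y. ennreal (g y powr P y) \<partial>\<nu>) \<le> ennreal A' \<Longrightarrow> c \<in> space M \<Longrightarrow> 0 < r \<Longrightarrow> x \<in> B c r \<Longrightarrow>
     avg \<nu> (B c r) g powr (P x / b) \<le> K * (avg \<nu> (B c r) (\<lambda>y. g y powr (P y / b) + E y powr (- t)) + E x powr (- t))"
    using variable_average_bound[OF dbl lh A'(1) t tail] by blast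
  obtain Cs where Cs: "0 \<le> Cs" "\<And>I g. family I \<Longrightarrow> g \<in> borel_measurable M \<Longrightarrow> (\<forall>x\<in>space M. 0 \<le> g x) \<Longrightarrow>
     (\<integral>\<^sup>+x. ennreal (MF \<nu> I g x powr b) \<partial>\<nu>) \<le> ennreal Cs * (\<integral>\<^sup>+x. ennreal (g x powr b) \<partial>\<nu>)"
    using strong_type[OF dbl L(2)] by blast
  define K2 where "K2 = K powr b * 2 powr b"
  have K2: "0 \<le> K2" by (simp add: K2_def)
  have b: "1 < b" by (rule L)
  \<comment> \<open>Makes the tail integrable to the power b as well.\<close>
  have tb: "E y powr (- t * b) \<le> E y powr (- t)" if "y \<in> space M" for y
    using E_ge1[OF that] b t by (intro powr_mono) auto
  have split: "(u + E y powr (- t)) powr b \<le> 2 powr b * (u powr b + E y powr (- t))" if "0 \<le> u" "y \<in> space M" for u y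
  proof -
    have "(u + E y powr (- t)) powr b \<le> 2 powr b * (u powr b + (E y powr (- t)) powr b)"
      using that b by (intro powr_add_le) auto
    also have "\<dots> \<le> 2 powr b * (u powr b + E y powr (- t))"
      using tb[OF that(2)] by (intro mult_left_mono add_left_mono) (auto simp: powr_powr)
    finally show ?thesis .
  qed
  define R where "R = K2 * (Cs * (2 powr b * (A' + T)) + T)"
  have R: "0 \<le> R" unfolding R_def using K2 Cs(1) A'(1) T(1) by simp
  have "(\<integral>\<^sup>+y. ennreal (MF \<nu> I g y powr P y) \<partial>\<nu>) \<le> ennreal R"
    if I: "family I" and [measurable]: "g \<in> borel_measurable M" and g: "\<forall>y\<in>space M. 0 \<le> g y"
      and gA: "(\<integral>\<^sup>+y. ennreal (g y powr P y) \<partial>\<nu>) \<le> ennreal A" for I g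
  proof -
    note [measurable] = MF_measurable[OF I]
    have gA': "(\<integral>\<^sup>+y. ennreal (g y powr P y) \<partial>\<nu>) \<le> ennreal A'" using gA A'(2) by (rule order_trans)
    define h where "h y = g y powr (P y / b) + E y powr (- t)" for y
    have [measurable]: "h \<in> borel_measurable M" unfolding h_def[abs_def] by measurable
    have h0: "\<forall>y\<in>space M. 0 \<le> h y" by (simp add: h_def)
    have pw: "MF \<nu> I g y powr P y \<le> K2 * (MF \<nu> I h y powr b + E y powr (- t))" if y: "y \<in> space M" for y
    proof -
      have "MF \<nu> I g y powr (P y / b) \<le> K * (MF \<nu> I h y + E y powr (- t))"
        using MF_cases[OF I, of \<nu> g y]
      proof
        assume "MF \<nu> I g y = 0"
        then show ?thesis using K(1) MF_nonneg[OF I, of \<nu> h y] by simp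
      next
        assume "\<exists>c r. (c, r) \<in> I \<and> y \<in> B c r \<and> MF \<nu> I g y = avg \<nu> (B c r) g"
        then obtain c r where cr: "(c, r) \<in> I" "y \<in> B c r" "MF \<nu> I g y = avg \<nu> (B c r) g" by blast
        then have "c \<in> space M" "0 < r" using I by (auto simp: family_def)
        then have "MF \<nu> I g y powr (P y / b) \<le> K * (avg \<nu> (B c r) h + E y powr (- t))"
          unfolding cr(3) h_def[abs_def] using cr g gA' by (intro K(2)) auto
        also have "\<dots> \<le> K * (MF \<nu> I h y + E y powr (- t))"
          using MF_ge[OF I cr(1,2)] K(1) by (intro mult_left_mono add_right_mono) auto
        finally show ?thesis .
      qed
      then have "(MF \<nu> I g y powr (P y / b)) powr b \<le> (K * (MF \<nu> I h y + E y powr (- t))) powr b"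
        using b by (intro powr_mono2) auto
      also have "\<dots> = K powr b * (MF \<nu> I h y + E y powr (- t)) powr b"
        by (rule powr_mult)
      also have "\<dots> \<le> K powr b * (2 powr b * (MF \<nu> I h y powr b + E y powr (- t)))"
        using split[OF MF_nonneg[OF I] y] by (intro mult_left_mono) auto
      finally show ?thesis using b by (simp add: powr_powr K2_def mult.assoc)
    qed
    have hb: "(\<integral>\<^sup>+y. ennreal (h y powr b) \<partial>\<nu>) \<le> ennreal (2 powr b * (A' + T))"
    proof -
      have "(\<integral>\<^sup>+y. ennreal (h y powr b) \<partial>\<nu>) \<le> (\<integral>\<^sup>+y. ennreal (2 powr b) * (ennreal (g y powr P y) + ennreal (E y powr (- t))) \<partial>\<nu>)"
      proof (rule nn_integral_mono)
        fix y assume "y \<in> space \<nu>"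
        then have y: "y \<in> space M" by (simp add: D(3))
        have "h y powr b \<le> 2 powr b * ((g y powr (P y / b)) powr b + E y powr (- t))"
          unfolding h_def using split[of "g y powr (P y / b)" y] y by simp
        then have "h y powr b \<le> 2 powr b * (g y powr P y + E y powr (- t))" using b by (simp add: powr_powr)
        then have "ennreal (h y powr b) \<le> ennreal (2 powr b * (g y powr P y + E y powr (- t)))" by (rule ennreal_leI)
        then show "ennreal (h y powr b) \<le> ennreal (2 powr b) * (ennreal (g y powr P y) + ennreal (E y powr (- t)))"
          by (simp add: ennreal_mult)
      qed
      also have "\<dots> = ennreal (2 powr b) * ((\<integral>\<^sup>+y. ennreal (g y powr P y) \<partial>\<nu>) + ennreal T)"
        unfolding T(2)[symmetric] by (subst nn_integral_cmult, simp, subst nn_integral_add) auto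
      also have "\<dots> \<le> ennreal (2 powr b) * (ennreal A' + ennreal T)" using gA' by (intro mult_left_mono add_right_mono) auto
      finally show ?thesis using A'(1) T(1) by (simp add: ennreal_mult)
    qed
    have "(\<integral>\<^sup>+y. ennreal (MF \<nu> I g y powr P y) \<partial>\<nu>)
      \<le> (\<integral>\<^sup>+y. ennreal K2 * (ennreal (MF \<nu> I h y powr b) + ennreal (E y powr (- t))) \<partial>\<nu>)"
    proof (rule nn_integral_mono)
      fix y assume "y \<in> space \<nu>"
      then have "ennreal (MF \<nu> I g y powr P y) \<le> ennreal (K2 * (MF \<nu> I h y powr b + E y powr (- t)))"
        using pw D(3) by (intro ennreal_leI) auto
      then show "ennreal (MF \<nu> I g y powr P y) \<le> ennreal K2 * (ennreal (MF \<nu> I h y powr b) + ennreal (E y powr (- t)))"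
        using K2 by (simp add: ennreal_mult)
    qed
    also have "\<dots> = ennreal K2 * ((\<integral>\<^sup>+y. ennreal (MF \<nu> I h y powr b) \<partial>\<nu>) + ennreal T)"
      unfolding T(2)[symmetric] by (subst nn_integral_cmult, simp, subst nn_integral_add) auto
    also have "\<dots> \<le> ennreal K2 * (ennreal Cs * ennreal (2 powr b * (A' + T)) + ennreal T)"
    proof (intro mult_left_mono add_right_mono)
      show "(\<integral>\<^sup>+y. ennreal (MF \<nu> I h y powr b) \<partial>\<nu>) \<le> ennreal Cs * ennreal (2 powr b * (A' + T))"
        using Cs(2)[OF I _ h0] mult_left_mono[OF hb, of "ennreal Cs"] by (meson \<open>h \<in> borel_measurable M\<close> order_trans zero_le)
    qed auto
    also have "\<dots> = ennreal R"
      unfolding R_def using K2 Cs(1) A'(1) T(1) by (simp add: ennreal_mult)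
    finally show ?thesis .
  qed
  then show ?thesis using R by blast
qed

end

section \<open>Weights\<close>

context quasi_metric_measurable
begin

definition wm :: "('a \<Rightarrow> real) \<Rightarrow> 'a measure" where
  "wm W = density M (\<lambda>x. ennreal (W x))"

lemma sets_wm [simp, measurable_cong]: "sets (wm W) = sets M"
  by (simp add: wm_def)

lemma space_wm [simp]: "space (wm W) = space M"
  by (simp add: wm_def)

lemma nn_integral_wm:
  assumes "W \<in> borel_measurable M" "f \<in> borel_measurable M"
  shows "(\<integral>\<^sup>+x. f x \<partial>wm W) = (\<integral>\<^sup>+x. ennreal (W x) * f x \<partial>M)"
  unfolding wm_def using assms by (intro nn_integral_density) auto

lemma emeasure_wm:
  assumes "W \<in> borel_measurable M" "A \<in> sets M"
  shows "emeasure (wm W) A = (\<integral>\<^sup>+x\<in>A. ennreal (W x) \<partial>M)"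
  unfolding wm_def using assms by (intro emeasure_density) auto

text \<open>Abstracts the properties of \<open>N c r = \<parallel>w \<chi>\<^sub>B\<parallel>\<close> for \<open>B = B c r\<close> and \<open>W = w\<^sup>P\<close> that the argument uses.
  The normalising constant \<open>\<Gamma>\<close> avoids having to show that the modular of a normalised function is exactly one.\<close>
definition ball_norm :: "('a \<Rightarrow> real) \<Rightarrow> ('a \<Rightarrow> real) \<Rightarrow> ('a \<Rightarrow> real \<Rightarrow> real) \<Rightarrow> real \<Rightarrow> real \<Rightarrow> bool" where
  "ball_norm W P N \<Gamma> D \<longleftrightarrow> 1 \<le> \<Gamma> \<and> 1 \<le> D \<and> W \<in> borel_measurable M \<and> (\<forall>y\<in>space M. 0 < W y) \<and>
    (\<forall>c\<in>space M. \<forall>r>0. 0 < N c r \<and>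
       ennreal (1 / \<Gamma>) \<le> (\<integral>\<^sup>+y\<in>B c r. ennreal (W y * N c r powr (- P y)) \<partial>M) \<and>
       (\<integral>\<^sup>+y\<in>B c r. ennreal (W y * N c r powr (- P y)) \<partial>M) \<le> ennreal \<Gamma> \<and> N c (2 * r) \<le> D * N c r) \<and>
    (\<forall>c\<in>space M. \<forall>r>0. \<forall>c'\<in>space M. \<forall>r'>0. B c r \<subseteq> B c' r' \<longrightarrow> N c r \<le> N c' r')"

lemma ball_normD:
  assumes "ball_norm W P N \<Gamma> D"
  shows "1 \<le> \<Gamma>" "1 \<le> D" "W \<in> borel_measurable M" "\<And>y. y \<in> space M \<Longrightarrow> 0 < W y"
    and "\<And>c r. c \<in> space M \<Longrightarrow> 0 < r \<Longrightarrow> 0 < N c r"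
    and "\<And>c r. c \<in> space M \<Longrightarrow> 0 < r \<Longrightarrow> ennreal (1 / \<Gamma>) \<le> (\<integral>\<^sup>+y\<in>B c r. ennreal (W y * N c r powr (- P y)) \<partial>M)"
    and "\<And>c r. c \<in> space M \<Longrightarrow> 0 < r \<Longrightarrow> (\<integral>\<^sup>+y\<in>B c r. ennreal (W y * N c r powr (- P y)) \<partial>M) \<le> ennreal \<Gamma>"
    and "\<And>c r. c \<in> space M \<Longrightarrow> 0 < r \<Longrightarrow> N c (2 * r) \<le> D * N c r"
    and "\<And>c r c' r'. c \<in> space M \<Longrightarrow> 0 < r \<Longrightarrow> c' \<in> space M \<Longrightarrow> 0 < r' \<Longrightarrow> B c r \<subseteq> B c' r' \<Longrightarrow> N c r \<le> N c' r'"
  using assms unfolding ball_norm_def by auto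

text \<open>On the ball, W is at most max(1,N)^b' times the normalised integrand W N^(-P).
  Positivity comes from the lower bound 1/\<Gamma>: a ball null for W d(mu) would make the
  normalised integral vanish.\<close>

lemma ball_norm_weight_finite:
  assumes N: "ball_norm W P N \<Gamma> D" and lh: "log_holder P b b' Pinf C" and c: "c \<in> space M" and r: "0 < r"
  shows "emeasure (wm W) (B c r) \<le> ennreal (max 1 (N c r) powr b' * \<Gamma>)"
    and "0 < emeasure (wm W) (B c r)"
proof -
  note Nd = ball_normD[OF N] and L = log_holderD[OF lh]
  note [measurable] = Nd(3) L(1) and Bm [measurable] = ball_sets[OF c r]
  define n where "n = N c r"
  have n: "0 < n" unfolding n_def using Nd(5) c r by blast
  have "emeasure (wm W) (B c r) = (\<integral>\<^sup>+y\<in>B c r. ennreal (W y) \<partial>M)"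
    by (intro emeasure_wm) auto
  also have "\<dots> \<le> (\<integral>\<^sup>+y. ennreal (max 1 n powr b') * (ennreal (W y * n powr (- P y)) * indicator (B c r) y) \<partial>M)"
  proof (rule nn_integral_mono)
    fix y assume y: "y \<in> space M"
    have "n powr P y \<le> max 1 n powr P y" using n L(2) L(6)[OF y] by (intro powr_mono2) auto
    also have "\<dots> \<le> max 1 n powr b'" using L(7)[OF y] by (intro powr_mono) auto
    finally have "1 \<le> max 1 n powr b' * n powr (- P y)" using n by (simp add: powr_minus field_simps)
    then have "W y * 1 \<le> W y * (max 1 n powr b' * n powr (- P y))" using Nd(4)[OF y] by (intro mult_left_mono) auto
    then have "ennreal (W y) \<le> ennreal (max 1 n powr b' * (W y * n powr (- P y)))"
      by (intro ennreal_leI) (simp add: mult_ac)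
    also have "\<dots> = ennreal (max 1 n powr b') * ennreal (W y * n powr (- P y))"
      using Nd(4)[OF y] by (intro ennreal_mult) auto
    finally show "ennreal (W y) * indicator (B c r) y \<le> ennreal (max 1 n powr b') * (ennreal (W y * n powr (- P y)) * indicator (B c r) y)"
      by (auto simp: indicator_def)
  qed
  also have "\<dots> = ennreal (max 1 n powr b') * (\<integral>\<^sup>+y\<in>B c r. ennreal (W y * n powr (- P y)) \<partial>M)"
    by (rule nn_integral_cmult) measurable
  also have "\<dots> \<le> ennreal (max 1 n powr b') * ennreal \<Gamma>"
    using Nd(7)[OF c r] by (intro mult_left_mono) (auto simp: n_def)
  also have "\<dots> = ennreal (max 1 n powr b' * \<Gamma>)" using Nd(1) by (intro ennreal_mult[symmetric]) auto
  finally show "emeasure (wm W) (B c r) \<le> ennreal (max 1 (N c r) powr b' * \<Gamma>)" by (simp add: n_def)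
  show "0 < emeasure (wm W) (B c r)"
  proof (rule ccontr)
    assume "\<not> ?thesis"
    then have "(\<integral>\<^sup>+y\<in>B c r. ennreal (W y) \<partial>M) = 0" using emeasure_wm[OF Nd(3) Bm] by simp
    then have "AE y in M. ennreal (W y) * indicator (B c r) y = 0" by (subst (asm) nn_integral_0_iff_AE) auto
    moreover have "AE y in M. y \<in> space M" by simp
    ultimately have "AE y in M. ennreal (W y * n powr (- P y)) * indicator (B c r) y = 0"
    proof eventually_elim
      case (elim y)
      then have "y \<notin> B c r" using Nd(4)[of y] by (auto simp: indicator_def split: if_splits)
      then show ?case by simp
    qed
    then have "(\<integral>\<^sup>+y\<in>B c r. ennreal (W y * n powr (- P y)) \<partial>M) = 0" by (subst nn_integral_0_iff_AE) auto
    then show False using Nd(6)[OF c r] Nd(1) by (simp add: n_def ennreal_eq_0_iff not_le)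
  qed
qed

lemma ball_norm_weight_measure:
  assumes N: "ball_norm W P N \<Gamma> D" and lh: "log_holder P b b' Pinf C" and c: "c \<in> space M" and r: "0 < r"
  shows "emeasure (wm W) (B c r) < \<infinity>" "0 < measure (wm W) (B c r)"
    "emeasure (wm W) (B c r) = ennreal (measure (wm W) (B c r))"
proof -
  show fin: "emeasure (wm W) (B c r) < \<infinity>"
    using ball_norm_weight_finite(1)[OF assms] by (rule le_less_trans) simp
  then show "0 < measure (wm W) (B c r)"
    using ball_norm_weight_finite(2)[OF assms] by (simp add: measure_def enn2real_positive_iff)
  show "emeasure (wm W) (B c r) = ennreal (measure (wm W) (B c r))" using fin by (simp add: emeasure_eq_ennreal_measure)
qed

text \<open>Doubling of \<open>N\<close> bounds N(x0, 2^k) by a multiple of D^k, so W(B) grows at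
  most like D^(b' k). This gives tails before W is known to be doubling.\<close>

lemma ball_norm_tail:
  assumes N: "ball_norm W P N \<Gamma> D" and lh: "log_holder P b b' Pinf C"
  shows "\<exists>t0>0. \<forall>t\<ge>t0. (\<integral>\<^sup>+x. ennreal (E x powr (- t)) \<partial>wm W) < \<infinity>"
proof (rule integrable_tail)
  note Nd = ball_normD[OF N] and L = log_holderD[OF lh]
  define n1 where "n1 = max 1 (N x0 1)"
  have b': "0 < b'" using L(2-4) by linarith
  show "1 \<le> D powr b'" using Nd(2) b' by (simp add: ge_one_powr_ge_zero)
  show "0 \<le> n1 powr b' * \<Gamma>" using Nd(1) by simp
  fix k :: nat
  have Dk: "1 \<le> D ^ k" using Nd(2) by simp
  have "N x0 (2 ^ k * 1) \<le> D ^ k * N x0 1"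
    using doubling_iterate[of N D x0 1 k] Nd(2,8) by simp
  also have "\<dots> \<le> D ^ k * n1" using Nd(2) by (intro mult_left_mono) (auto simp: n1_def)
  finally have 1: "N x0 (2 ^ k) \<le> D ^ k * n1" by simp
  have "1 * 1 \<le> D ^ k * n1" using Dk by (intro mult_mono) (auto simp: n1_def)
  then have "max 1 (N x0 (2 ^ k)) \<le> D ^ k * n1" using 1 by simp
  then have "max 1 (N x0 (2 ^ k)) powr b' \<le> (D ^ k * n1) powr b'" using b' by (intro powr_mono2) auto
  also have "\<dots> = (D powr b') ^ k * n1 powr b'"
    using Nd(2) by (simp add: powr_mult n1_def powr_realpow[symmetric] powr_powr powr_power mult.commute)
  finally have "max 1 (N x0 (2 ^ k)) powr b' * \<Gamma> \<le> n1 powr b' * \<Gamma> * (D powr b') ^ k"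
    using Nd(1) mult_right_mono[of _ _ \<Gamma>] by (fastforce simp: mult_ac)
  then show "emeasure (wm W) (B x0 (2 ^ k)) \<le> ennreal (n1 powr b' * \<Gamma> * (D powr b') ^ k)"
    using ball_norm_weight_finite(1)[OF N lh x0, of "2 ^ k"] by (auto intro: order_trans ennreal_leI)
qed simp

lemma ball_norm_bounds:
  assumes N: "ball_norm W P N \<Gamma> D"
  shows "\<exists>m\<ge>0. \<forall>c\<in>space M. \<forall>r>0. \<bar>ln (N c r)\<bar> \<le> m * (ln (E c) + \<bar>ln r\<bar>)"
    and "\<exists>\<kappa>>0. \<forall>c\<in>space M. \<forall>r>0. \<not> local_ball c r \<longrightarrow> \<kappa> \<le> N c r"
proof -
  note Nd = ball_normD[OF N]
  show "\<exists>m\<ge>0. \<forall>c\<in>space M. \<forall>r>0. \<bar>ln (N c r)\<bar> \<le> m * (ln (E c) + \<bar>ln r\<bar>)"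
    by (rule ball_functional_bounds(1)[where D = D]) (auto intro: Nd(2,5,8,9))
  show "\<exists>\<kappa>>0. \<forall>c\<in>space M. \<forall>r>0. \<not> local_ball c r \<longrightarrow> \<kappa> \<le> N c r"
    by (rule ball_functional_bounds(2)[where D = D]) (auto intro: Nd(2,5,8,9))
qed

text \<open>Integrates a pointwise change of exponent with error \<open>z\<close>. The error is
  integrated over the whole space, which makes its contribution independent of the ball.\<close>

lemma weighted_set_integral_le:
  assumes [measurable]: "S \<in> sets M" "W \<in> borel_measurable M" "u \<in> borel_measurable M" "v \<in> borel_measurable M"
    and S: "S \<subseteq> space M"
    and W: "\<And>y. y \<in> S \<Longrightarrow> 0 < W y" and le: "\<And>y. y \<in> S \<Longrightarrow> u y \<le> k * v y + z y" and k: "0 \<le> k"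
    and v: "\<And>y. y \<in> S \<Longrightarrow> 0 \<le> v y" and z: "\<And>y. y \<in> S \<Longrightarrow> 0 \<le> z y" and [measurable]: "z \<in> borel_measurable M"
  shows "(\<integral>\<^sup>+y\<in>S. ennreal (W y * u y) \<partial>M) \<le> ennreal k * (\<integral>\<^sup>+y\<in>S. ennreal (W y * v y) \<partial>M) + (\<integral>\<^sup>+y. ennreal (z y) \<partial>wm W)"
proof -
  have "(\<integral>\<^sup>+y\<in>S. ennreal (W y * u y) \<partial>M)
     \<le> (\<integral>\<^sup>+y. ennreal k * (ennreal (W y * v y) * indicator S y) + ennreal (W y) * ennreal (z y) \<partial>M)"
  proof (rule nn_integral_mono)
    fix y
    show "ennreal (W y * u y) * indicator S y \<le> ennreal k * (ennreal (W y * v y) * indicator S y) + ennreal (W y) * ennreal (z y)"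
    proof (cases "y \<in> S")
      case True
      have "W y * u y \<le> W y * (k * v y + z y)" using W[OF True] le[OF True] by (intro mult_left_mono) auto
      then have "ennreal (W y * u y) \<le> ennreal (k * (W y * v y) + W y * z y)"
        by (intro ennreal_leI) (simp add: algebra_simps)
      also have "\<dots> = ennreal (k * (W y * v y)) + ennreal (W y * z y)"
        using k W[OF True] v[OF True] z[OF True] by (intro ennreal_plus) auto
      also have "ennreal (k * (W y * v y)) = ennreal k * ennreal (W y * v y)"
        using k W[OF True] v[OF True] by (intro ennreal_mult) auto
      also have "ennreal (W y * z y) = ennreal (W y) * ennreal (z y)"
        using W[OF True] z[OF True] by (intro ennreal_mult) auto
      finally show ?thesis using True by simp
    qed simp
  qed
  also have "\<dots> = ennreal k * (\<integral>\<^sup>+y\<in>S. ennreal (W y * v y) \<partial>M) + (\<integral>\<^sup>+y. ennreal (z y) \<partial>wm W)"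
    by (subst nn_integral_add, simp, simp, subst nn_integral_cmult, simp, subst nn_integral_wm) auto
  finally show ?thesis .
qed

section \<open>Comparison of W(B) with powers of the norm, and doubling of W\<close>

text \<open>Since |ln N| \<le> m (ln E(c) + |ln r|), the oscillation of \<open>P\<close> on a local
  ball is small enough to replace P(y) by P(x) inside the normalised integral at bounded cost;
  N^(-P(x)) then factors out.\<close>

lemma ball_norm_equiv_local:
  assumes N: "ball_norm W P N \<Gamma> D" and lh: "log_holder P b b' Pinf C"
  shows "\<exists>K\<ge>1. \<forall>c\<in>space M. \<forall>r>0. \<forall>x\<in>B c r. local_ball c r \<longrightarrow>
     N c r powr P x \<le> K * measure (wm W) (B c r) \<and> measure (wm W) (B c r) \<le> K * N c r powr P x"
proof -
  note Nd = ball_normD[OF N] and L = log_holderD[OF lh]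
  note [measurable] = Nd(3) L(1)
  obtain m where m: "0 \<le> m" "\<And>c r. c \<in> space M \<Longrightarrow> 0 < r \<Longrightarrow> \<bar>ln (N c r)\<bar> \<le> m * (ln (E c) + \<bar>ln r\<bar>)"
    using ball_norm_bounds(1)[OF N] by blast
  obtain K0 where K0: "0 \<le> K0" "\<And>c r x y. c \<in> space M \<Longrightarrow> 0 < r \<Longrightarrow> local_ball c r \<Longrightarrow> x \<in> B c r \<Longrightarrow> y \<in> B c r \<Longrightarrow>
     \<bar>P x - P y\<bar> * (ln (E c) + \<bar>ln r\<bar>) \<le> K0"
    using log_holder_local_osc[OF lh] by blast
  define k where "k = exp (m * K0)"
  have k1: "1 \<le> k" unfolding k_def using m(1) K0(1) by simp
  have "N c r powr P x \<le> (k * \<Gamma>) * measure (wm W) (B c r) \<and> measure (wm W) (B c r) \<le> (k * \<Gamma>) * N c r powr P x"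
    if c: "c \<in> space M" and r: "0 < r" and x: "x \<in> B c r" and l: "local_ball c r" for c r x
  proof -
    define n where "n = N c r"
    have n: "0 < n" unfolding n_def using Nd(5) c r by blast
    define V where "V = measure (wm W) (B c r)"
    note wB = ball_norm_weight_measure[OF N lh c r, folded V_def]
    have Bm [measurable]: "B c r \<in> sets M" by (rule ball_sets[OF c r])
    have osc: "\<bar>P x - P y\<bar> * \<bar>ln n\<bar> \<le> m * K0" if y: "y \<in> B c r" for y
    proof -
      have "\<bar>P x - P y\<bar> * \<bar>ln n\<bar> \<le> \<bar>P x - P y\<bar> * (m * (ln (E c) + \<bar>ln r\<bar>))"
        unfolding n_def by (intro mult_left_mono m(2) c r) auto
      also have "\<dots> = m * (\<bar>P x - P y\<bar> * (ln (E c) + \<bar>ln r\<bar>))" by simp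
      also have "\<dots> \<le> m * K0" by (intro mult_left_mono K0(2) c r l x y m(1))
      finally show ?thesis .
    qed
    have nx: "n powr (- P x) \<le> k * n powr (- P y)" and ny: "n powr (- P y) \<le> k * n powr (- P x)" if "y \<in> B c r" for y
      using osc[OF that] n by (auto simp: k_def abs_minus_commute intro!: powr_exponent_change)
    have I: "(\<integral>\<^sup>+y\<in>B c r. ennreal (W y * n powr (- P x)) \<partial>M) = ennreal (n powr (- P x) * V)"
    proof -
      have "(\<integral>\<^sup>+y\<in>B c r. ennreal (W y * n powr (- P x)) \<partial>M)
        = (\<integral>\<^sup>+y. ennreal (n powr (- P x)) * (ennreal (W y) * indicator (B c r) y) \<partial>M)"
        using Nd(4) by (intro nn_integral_cong) (auto simp: ennreal_mult ennreal_mult' mult_ac less_imp_le)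
      also have "\<dots> = ennreal (n powr (- P x)) * (\<integral>\<^sup>+y\<in>B c r. ennreal (W y) \<partial>M)" by (rule nn_integral_cmult) measurable
      also have "\<dots> = ennreal (n powr (- P x)) * ennreal V" using emeasure_wm[OF Nd(3) Bm] wB(3) by simp
      finally show ?thesis using wB(2) by (simp add: ennreal_mult)
    qed
    have sub: "B c r \<subseteq> space M" by (auto simp: ball_iff)
    have "ennreal (n powr (- P x) * V) \<le> ennreal k * (\<integral>\<^sup>+y\<in>B c r. ennreal (W y * n powr (- P y)) \<partial>M) + (\<integral>\<^sup>+y. ennreal 0 \<partial>wm W)"
      unfolding I[symmetric] using nx Nd(4) sub k1 by (intro weighted_set_integral_le) auto
    also have "\<dots> \<le> ennreal k * ennreal \<Gamma>" using Nd(7)[OF c r] by (simp add: n_def mult_left_mono)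
    also have "\<dots> = ennreal (k * \<Gamma>)" using k1 Nd(1) by (intro ennreal_mult[symmetric]) auto
    finally have 1: "n powr (- P x) * V \<le> k * \<Gamma>" using k1 Nd(1) by (subst (asm) ennreal_le_iff) auto
    have "ennreal (1 / \<Gamma>) \<le> (\<integral>\<^sup>+y\<in>B c r. ennreal (W y * n powr (- P y)) \<partial>M)" using Nd(6)[OF c r] by (simp add: n_def)
    also have "\<dots> \<le> ennreal k * (\<integral>\<^sup>+y\<in>B c r. ennreal (W y * n powr (- P x)) \<partial>M) + (\<integral>\<^sup>+y. ennreal 0 \<partial>wm W)"
      using ny Nd(4) sub k1 by (intro weighted_set_integral_le) auto
    also have "\<dots> = ennreal (k * (n powr (- P x) * V))" unfolding I using k1 wB(2) by (simp add: ennreal_mult)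
    finally have 2: "1 / \<Gamma> \<le> k * (n powr (- P x) * V)" using k1 wB(2) by (subst (asm) ennreal_le_iff) auto
    have np: "0 < n powr P x" using n by simp
    have "V \<le> k * \<Gamma> * n powr P x" using 1 np by (simp add: powr_minus field_simps)
    moreover have "n powr P x \<le> k * \<Gamma> * V" using 2 np Nd(1) by (simp add: powr_minus field_simps)
    ultimately show ?thesis by (simp add: n_def V_def)
  qed
  moreover have "1 \<le> k * \<Gamma>" using mult_mono[of 1 k 1 \<Gamma>] k1 Nd(1) by simp
  ultimately show ?thesis by blast
qed

text \<open>For N \<ge> \<kappa> the base 1/N is bounded, so \<open>powr_exponent_switch\<close>
  exchanges P(y) for the limit exponent in both directions, with errors given by tails against
  W.\<close>

lemma ball_norm_equiv_global:
  assumes N: "ball_norm W P N \<Gamma> D" and lh: "log_holder P b b' Pinf C" and \<kappa>: "0 < \<kappa>"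
  shows "\<exists>K\<ge>1. \<forall>c\<in>space M. \<forall>r>0. \<kappa> \<le> N c r \<longrightarrow>
     N c r powr Pinf \<le> K * measure (wm W) (B c r) \<and> measure (wm W) (B c r) \<le> K * N c r powr Pinf"
proof -
  note Nd = ball_normD[OF N] and L = log_holderD[OF lh]
  note [measurable] = Nd(3) L(1)
  obtain t where t: "0 < t" and tail: "(\<integral>\<^sup>+x. ennreal (E x powr (- t)) \<partial>wm W) < \<infinity>"
    using ball_norm_tail[OF N lh] by blast
  obtain T where T: "0 \<le> T" "(\<integral>\<^sup>+x. ennreal (E x powr (- t)) \<partial>wm W) = ennreal T" using tail by (rule ennreal_finiteE)
  \<comment> \<open>Chosen so that the tail error \<delta> T is at most half of the lower bound
    1/\<Gamma> of the normalised integral and can be absorbed.\<close>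
  define \<delta> where "\<delta> = 1 / (2 * \<Gamma> * (1 + T))"
  have den: "1 \<le> 2 * \<Gamma> * (1 + T)" using mult_mono[of 1 "2 * \<Gamma>" 1 "1 + T"] Nd(1) T(1) by simp
  have \<delta>: "0 < \<delta>" "\<delta> \<le> 1" unfolding \<delta>_def using den by auto
  have "\<delta> * T \<le> \<delta> * (1 + T)" using \<delta> by (intro mult_left_mono) auto
  also have "\<dots> = 1 / (2 * \<Gamma>)" unfolding \<delta>_def using T(1) by simp
  finally have \<delta>T: "\<delta> * T \<le> 1 / (2 * \<Gamma>)" .
  define S where "S = max 1 (1 / \<kappa>)"
  define k where "k = exp (C * ((t + ln (1/\<delta>)) / b + ln S))"
  have b: "0 < b" using L(2) by simp
  have k1: "1 \<le> k" unfolding k_def using L(5) t \<delta> b by (simp add: S_def)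
  have sw: "s powr P y \<le> k * s powr Pinf + \<delta> * E y powr (- t)" "s powr Pinf \<le> k * s powr P y + \<delta> * E y powr (- t)"
    if y: "y \<in> space M" and s: "0 \<le> s" "s \<le> S" for s y
  proof -
    have S1: "1 \<le> S" by (simp add: S_def)
    show "s powr P y \<le> k * s powr Pinf + \<delta> * E y powr (- t)"
      unfolding k_def E_powr[OF y]
      by (rule powr_exponent_switch[OF b L(6)[OF y] L(8)[OF y] ln_E[OF y] s S1 \<delta> t])
    show "s powr Pinf \<le> k * s powr P y + \<delta> * E y powr (- t)"
      unfolding k_def E_powr[OF y]
      by (rule powr_exponent_switch[OF b L(3) _ ln_E[OF y] s S1 \<delta> t]) (use L(8)[OF y] in \<open>simp add: abs_minus_commute\<close>)
  qed
  have zint: "(\<integral>\<^sup>+y. ennreal (\<delta> * E y powr (- t)) \<partial>wm W) = ennreal (\<delta> * T)"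
  proof -
    have "(\<integral>\<^sup>+y. ennreal (\<delta> * E y powr (- t)) \<partial>wm W) = (\<integral>\<^sup>+y. ennreal \<delta> * ennreal (E y powr (- t)) \<partial>wm W)"
      using \<delta> by (simp add: ennreal_mult)
    also have "\<dots> = ennreal \<delta> * ennreal T" unfolding T(2)[symmetric] by (rule nn_integral_cmult) measurable
    finally show ?thesis using \<delta> T(1) by (simp add: ennreal_mult)
  qed
  define K where "K = max (k * \<Gamma> + T) (2 * \<Gamma> * k)"
  have "N c r powr Pinf \<le> K * measure (wm W) (B c r) \<and> measure (wm W) (B c r) \<le> K * N c r powr Pinf"
    if c: "c \<in> space M" and r: "0 < r" and ge: "\<kappa> \<le> N c r" for c r
  proof -
    define n where "n = N c r"
    have n: "0 < n" unfolding n_def using Nd(5) c r by blast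
    define V where "V = measure (wm W) (B c r)"
    note wB = ball_norm_weight_measure[OF N lh c r, folded V_def]
    have Bm [measurable]: "B c r \<in> sets M" by (rule ball_sets[OF c r])
    define s where "s = 1 / n"
    have s: "0 < s" "s \<le> S" using n ge \<kappa> by (auto simp: s_def S_def n_def frac_le le_max_iff_disj)
    have ns: "n powr (- u) = s powr u" for u using n by (simp add: s_def powr_minus powr_divide field_simps)
    have I: "(\<integral>\<^sup>+y\<in>B c r. ennreal (W y * s powr Pinf) \<partial>M) = ennreal (s powr Pinf * V)"
    proof -
      have "(\<integral>\<^sup>+y\<in>B c r. ennreal (W y * s powr Pinf) \<partial>M)
        = (\<integral>\<^sup>+y. ennreal (s powr Pinf) * (ennreal (W y) * indicator (B c r) y) \<partial>M)"
        using Nd(4) by (intro nn_integral_cong) (auto simp: ennreal_mult ennreal_mult' mult_ac less_imp_le)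
      also have "\<dots> = ennreal (s powr Pinf) * (\<integral>\<^sup>+y\<in>B c r. ennreal (W y) \<partial>M)" by (rule nn_integral_cmult) measurable
      also have "\<dots> = ennreal (s powr Pinf) * ennreal V" using emeasure_wm[OF Nd(3) Bm] wB(3) by simp
      finally show ?thesis using wB(2) by (simp add: ennreal_mult)
    qed
    have sub: "B c r \<subseteq> space M" by (auto simp: ball_iff)
    have up: "(\<integral>\<^sup>+y\<in>B c r. ennreal (W y * s powr P y) \<partial>M) \<le> ennreal \<Gamma>"
      and lo: "ennreal (1 / \<Gamma>) \<le> (\<integral>\<^sup>+y\<in>B c r. ennreal (W y * s powr P y) \<partial>M)"
      using Nd(6,7)[OF c r] by (simp_all add: n_def[symmetric] ns)
    have "ennreal (s powr Pinf * V) \<le> ennreal k * (\<integral>\<^sup>+y\<in>B c r. ennreal (W y * s powr P y) \<partial>M) + (\<integral>\<^sup>+y. ennreal (\<delta> * E y powr (- t)) \<partial>wm W)"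
      unfolding I[symmetric] using sw(2)[OF _ _ s(2)] s(1) Nd(4) sub k1 \<delta> by (intro weighted_set_integral_le) auto
    also have "\<dots> \<le> ennreal k * ennreal \<Gamma> + ennreal (\<delta> * T)" unfolding zint using up by (intro add_right_mono mult_left_mono) auto
    also have "\<dots> = ennreal (k * \<Gamma> + \<delta> * T)" using k1 Nd(1) \<delta> T(1) by (simp add: ennreal_mult)
    finally have "s powr Pinf * V \<le> k * \<Gamma> + \<delta> * T" by (subst (asm) ennreal_le_iff) (use k1 Nd(1) \<delta> T(1) in auto)
    moreover have "\<delta> * T \<le> T" using \<delta> T(1) by (simp add: mult_left_le_one_le)
    ultimately have 1: "s powr Pinf * V \<le> K" by (simp add: K_def)
    have "ennreal (1 / \<Gamma>) \<le> (\<integral>\<^sup>+y\<in>B c r. ennreal (W y * s powr P y) \<partial>M)" by (rule lo)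
    also have "\<dots> \<le> ennreal k * (\<integral>\<^sup>+y\<in>B c r. ennreal (W y * s powr Pinf) \<partial>M) + (\<integral>\<^sup>+y. ennreal (\<delta> * E y powr (- t)) \<partial>wm W)"
      using sw(1)[OF _ _ s(2)] s(1) Nd(4) sub k1 \<delta> by (intro weighted_set_integral_le) auto
    also have "\<dots> = ennreal (k * (s powr Pinf * V) + \<delta> * T)" unfolding I zint using k1 wB(2) \<delta> T(1) by (simp add: ennreal_mult)
    finally have "1 / \<Gamma> \<le> k * (s powr Pinf * V) + \<delta> * T" by (subst (asm) ennreal_le_iff) (use k1 wB(2) \<delta> T(1) in auto)
    then have "1 / \<Gamma> \<le> k * (s powr Pinf * V) + 1 / (2 * \<Gamma>)" using \<delta>T by linarith
    then have 2: "1 \<le> 2 * \<Gamma> * k * (s powr Pinf * V)" using Nd(1) by (simp add: field_simps)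
    have "1 \<le> K * (s powr Pinf * V)"
    proof -
      have "2 * \<Gamma> * k * (s powr Pinf * V) \<le> K * (s powr Pinf * V)" using wB(2) by (intro mult_right_mono) (auto simp: K_def)
      then show ?thesis using 2 by linarith
    qed
    moreover have "s powr Pinf = inverse (n powr Pinf)" "0 < n powr Pinf" using n ns[of Pinf] by (auto simp: powr_minus)
    ultimately show ?thesis using 1 unfolding n_def[symmetric] V_def[symmetric] by (simp add: field_simps)
  qed
  moreover have "1 \<le> K"
  proof -
    have "1 \<le> k * \<Gamma>" using mult_mono[of 1 k 1 \<Gamma>] k1 Nd(1) by simp
    then show ?thesis using T(1) by (simp add: K_def le_max_iff_disj)
  qed
  ultimately show ?thesis by blast
qed

text \<open>Doubling passes from \<open>N\<close> to W because W(B) is comparable with a power of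
  N(B), with one and the same exponent for a ball and its double: P(c) if the double is local, the
  limit exponent otherwise.\<close>

lemma ball_norm_doubling:
  assumes N: "ball_norm W P N \<Gamma> D" and lh: "log_holder P b b' Pinf C"
  shows "\<exists>D'. doubling (wm W) D'"
proof -
  note Nd = ball_normD[OF N] and L = log_holderD[OF lh]
  obtain \<kappa> where \<kappa>: "0 < \<kappa>" "\<And>c r. c \<in> space M \<Longrightarrow> 0 < r \<Longrightarrow> \<not> local_ball c r \<Longrightarrow> \<kappa> \<le> N c r"
    using ball_norm_bounds(2)[OF N] by blast
  obtain K1 where K1: "1 \<le> K1" "\<And>c r x. c \<in> space M \<Longrightarrow> 0 < r \<Longrightarrow> x \<in> B c r \<Longrightarrow> local_ball c r \<Longrightarrow>
     N c r powr P x \<le> K1 * measure (wm W) (B c r) \<and> measure (wm W) (B c r) \<le> K1 * N c r powr P x"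
    using ball_norm_equiv_local[OF N lh] by blast
  \<comment> \<open>If the doubled ball is not local, \<kappa> bounds its norm from below, but for
    the ball itself only \<kappa>/D follows. The comparison is needed for both.\<close>
  have "0 < \<kappa> / D" using \<kappa>(1) Nd(2) by simp
  then obtain K2 where K2: "1 \<le> K2" "\<And>c r. c \<in> space M \<Longrightarrow> 0 < r \<Longrightarrow> \<kappa> / D \<le> N c r \<Longrightarrow>
     N c r powr Pinf \<le> K2 * measure (wm W) (B c r) \<and> measure (wm W) (B c r) \<le> K2 * N c r powr Pinf"
    using ball_norm_equiv_global[OF N lh] by blast
  have b': "0 \<le> b'" using L(2-4) by linarith
  have step: "V2 \<le> (K * D powr b' * K) * V"
    if "V2 \<le> K * n2 powr s" "n powr s \<le> K * V" "n2 \<le> D * n" "0 < n" "0 < n2" "0 \<le> s" "s \<le> b'" "1 \<le> K" for V2 V n n2 s K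
  proof -
    have "n2 powr s \<le> (D * n) powr s" using that by (intro powr_mono2) auto
    also have "\<dots> = D powr s * n powr s" by (rule powr_mult)
    also have "\<dots> \<le> D powr b' * (K * V)" using that Nd(2) by (intro mult_mono powr_mono) auto
    finally have "K * n2 powr s \<le> K * (D powr b' * (K * V))" using that by (intro mult_left_mono) auto
    then show ?thesis using that(1) by (simp add: mult_ac)
  qed
  define D' where "D' = max (K1 * D powr b' * K1) (K2 * D powr b' * K2)"
  have Db: "1 \<le> D powr b'" using Nd(2) b' by (simp add: ge_one_powr_ge_zero)
  have "1 \<le> K1 * D powr b' * K1" using mult_mono[of 1 "K1 * D powr b'" 1 K1] mult_mono[of 1 K1 1 "D powr b'"] K1(1) Db by simp
  then have "1 \<le> D'" by (simp add: D'_def le_max_iff_disj)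
  moreover have "measure (wm W) (B c (2 * r)) \<le> D' * measure (wm W) (B c r)" if c: "c \<in> space M" and r: "0 < r" for c r
  proof -
    have r2: "0 < 2 * r" using r by simp
    note n = Nd(5)[OF c r] Nd(5)[OF c r2] Nd(8)[OF c r]
    have V: "0 \<le> measure (wm W) (B c r)" by simp
    show ?thesis
    proof (cases "local_ball c (2 * r)")
      case True
      then have l: "local_ball c r" using A0 r unfolding local_ball_def by (smt (verit) mult_left_mono)
      have "measure (wm W) (B c (2 * r)) \<le> (K1 * D powr b' * K1) * measure (wm W) (B c r)"
        by (rule step[where n = "N c r" and ?n2.0 = "N c (2 * r)" and s = "P c"])
          (use K1(1) K1(2)[OF c r _ l, of c] K1(2)[OF c r2 _ True, of c] n L(2) L(6,7)[OF c] c r in auto)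
      also have "\<dots> \<le> D' * measure (wm W) (B c r)" using V by (intro mult_right_mono) (auto simp: D'_def)
      finally show ?thesis .
    next
      case False
      have 2: "\<kappa> \<le> N c (2 * r)" by (rule \<kappa>(2)[OF c r2 False])
      then have 1: "\<kappa> / D \<le> N c r" using n(3) Nd(2) by (simp add: divide_le_eq mult.commute)
      have "\<kappa> / D \<le> \<kappa> / 1" using \<kappa>(1) Nd(2) by (intro divide_left_mono) auto
      then have 3: "\<kappa> / D \<le> N c (2 * r)" using 2 by simp
      have "measure (wm W) (B c (2 * r)) \<le> (K2 * D powr b' * K2) * measure (wm W) (B c r)"
        by (rule step[where n = "N c r" and ?n2.0 = "N c (2 * r)" and s = "Pinf"])
          (use K2(1) K2(2)[OF c r 1] K2(2)[OF c r2 3] n L(2,3,4) in auto)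
      also have "\<dots> \<le> D' * measure (wm W) (B c r)" using V by (intro mult_right_mono) (auto simp: D'_def)
      finally show ?thesis .
    qed
  qed
  ultimately have "doubling (wm W) D'"
    unfolding doubling_def using ball_norm_weight_measure[OF N lh] ball_norm_weight_finite(2)[OF N lh] by auto
  then show ?thesis by blast
qed

end

section \<open>The pointwise estimate\<close>

text \<open>The constant-exponent core of the pointwise estimate. \<open>F\<close>, \<open>a\<close>, \<open>h\<close> are the averages of \<open>f\<close>, \<open>f / \<sigma>\<close>
  and \<open>\<Phi> / W\<close> with respect to \<open>\<mu>\<close>, \<open>\<sigma>\<close> and \<open>W\<close>.\<close>
lemma muckenhoupt_chain:
  fixes F a h \<sigma>B WB V n n' s k K Kn :: real
  assumes s: "1 < s" and F: "0 \<le> F" "F \<le> a * \<sigma>B / V" and a: "0 \<le> a" and h: "a powr (s - 1) \<le> k * h * WB / V"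
    and W: "WB \<le> K * n powr s" and \<sigma>: "\<sigma>B \<le> K * n' powr (s / (s - 1))" and A: "n * n' \<le> Kn * V"
    and pos: "0 \<le> h" "0 \<le> WB" "0 \<le> \<sigma>B" "0 < V" "0 < n" "0 < n'" "0 \<le> k" "1 \<le> K" "0 \<le> Kn"
  shows "F powr (s - 1) \<le> k * K * K powr (s - 1) * Kn powr s * h"
proof -
  have "F powr (s - 1) \<le> (a * (\<sigma>B / V)) powr (s - 1)" using F s by (intro powr_mono2) auto
  also have "\<dots> = a powr (s - 1) * (\<sigma>B / V) powr (s - 1)" by (rule powr_mult)
  also have "\<dots> \<le> (k * h * WB / V) * (\<sigma>B / V) powr (s - 1)" using h by (intro mult_right_mono) auto
  also have "\<dots> \<le> (k * h * (K * n powr s) / V) * ((K * n' powr (s / (s - 1))) / V) powr (s - 1)"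
    using pos W \<sigma> s by (intro mult_mono powr_mono2 divide_right_mono mult_left_mono) auto
  also have "((K * n' powr (s / (s - 1))) / V) powr (s - 1) = K powr (s - 1) * n' powr s / V powr (s - 1)"
    using s by (simp add: powr_divide powr_mult powr_powr)
  also have "(k * h * (K * n powr s) / V) * (K powr (s - 1) * n' powr s / V powr (s - 1))
     = k * K * K powr (s - 1) * h * ((n powr s * n' powr s) / (V * V powr (s - 1)))"
    by (simp add: field_simps)
  also have "V * V powr (s - 1) = V powr s" using powr_mult_base[of V "s - 1"] pos by simp
  also have "(n powr s * n' powr s) / V powr s = (n * n' / V) powr s"
    by (simp add: powr_mult powr_divide)
  also have "k * K * K powr (s - 1) * h * (n * n' / V) powr s \<le> k * K * K powr (s - 1) * h * Kn powr s"
  proof (intro mult_left_mono powr_mono2)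
    show "n * n' / V \<le> Kn" using A pos by (simp add: field_simps)
  qed (use pos s in auto)
  finally show ?thesis by (simp add: mult_ac)
qed

context quasi_metric_measurable
begin

lemma ball_mean_bounds:
  assumes dbl: "doubling \<nu> D" and c: "c \<in> space M" and r: "0 < r" and [measurable]: "g \<in> borel_measurable M" "P \<in> borel_measurable M"
    and g: "\<And>y. y \<in> space M \<Longrightarrow> 0 \<le> g y" and P: "\<And>y. y \<in> space M \<Longrightarrow> 1 \<le> P y" and A: "0 \<le> A"
    and gA: "(\<integral>\<^sup>+y. ennreal (g y powr P y) \<partial>\<nu>) \<le> ennreal A"
  shows "(\<integral>\<^sup>+y\<in>B c r. ennreal (g y) \<partial>\<nu>) < \<infinity>" "avg \<nu> (B c r) g \<le> 1 + A / measure \<nu> (B c r)"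
proof -
  note D = doublingD[OF dbl]
  note [measurable_cong] = D(1)
  note S = D(4,5,6,7,9)[OF c r]
  have [measurable]: "B c r \<in> sets M" by (rule ball_sets[OF c r])
  have le: "g y \<le> 1 + g y powr P y" if "y \<in> B c r" for y
    using that by (intro le_one_plus_powr g P) (auto simp: ball_iff)
  show "(\<integral>\<^sup>+y\<in>B c r. ennreal (g y) \<partial>\<nu>) < \<infinity>"
    by (rule set_nn_integral_finite[where k = 1 and G = "\<lambda>y. g y powr P y"])
      (use S le gA in \<open>auto intro: le_less_trans\<close>)
  show "avg \<nu> (B c r) g \<le> 1 + A / measure \<nu> (B c r)"
  proof (rule avg_le_bound)
    have "(\<integral>\<^sup>+y\<in>B c r. ennreal (g y) \<partial>\<nu>) \<le> (\<integral>\<^sup>+y. indicator (B c r) y + ennreal (g y powr P y) \<partial>\<nu>)"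
    proof (rule nn_integral_mono)
      fix y
      have "ennreal (g y) \<le> 1 + ennreal (g y powr P y)" if "y \<in> B c r"
        using ennreal_leI[OF le[OF that]] by simp
      then show "ennreal (g y) * indicator (B c r) y \<le> indicator (B c r) y + ennreal (g y powr P y)"
        by (auto simp: indicator_def)
    qed
    also have "\<dots> = emeasure \<nu> (B c r) + (\<integral>\<^sup>+y. ennreal (g y powr P y) \<partial>\<nu>)"
      by (subst nn_integral_add) auto
    also have "\<dots> \<le> ennreal (measure \<nu> (B c r)) + ennreal A" using S gA by (intro add_mono) auto
    also have "\<dots> = ennreal ((1 + A / measure \<nu> (B c r)) * measure \<nu> (B c r))"
      using S A by (simp add: distrib_right)
    finally show "(\<integral>\<^sup>+y\<in>B c r. ennreal (g y) \<partial>\<nu>) \<le> ennreal ((1 + A / measure \<nu> (B c r)) * measure \<nu> (B c r))" .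
  qed (use S A in auto)
qed

end

text \<open>Here \<open>W\<close> stands for w^p and \<sigma> for w^(-p'), linked directly by
  \<open>\<sigma>W\<close>; \<open>N\<close> and \<open>N'\<close> stand for the norms of w chi_B
  and w^(-1) chi_B, and the last assumption is the Muckenhoupt condition. The setting is symmetric
  enough for every result on \<open>ball_norm\<close> to be applied to both halves.\<close>

locale muckenhoupt_pair = quasi_metric_measurable +
  fixes p W \<sigma> :: "'a \<Rightarrow> real" and N N' :: "'a \<Rightarrow> real \<Rightarrow> real" and p' pinf pinf' b b' \<beta> \<beta>' C C' \<Gamma> \<Gamma>' D D' D0 Kn :: _
  defines "p' \<equiv> \<lambda>y. p y / (p y - 1)" and "pinf' \<equiv> pinf / (pinf - 1)"
  assumes dbl: "doubling M D0" and lh: "log_holder p b b' pinf C" and lh': "log_holder p' \<beta> \<beta>' pinf' C'"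
    and Nn: "ball_norm W p N \<Gamma> D" and Nn': "ball_norm \<sigma> p' N' \<Gamma>' D'"
    and \<sigma>W: "\<And>y. y \<in> space M \<Longrightarrow> \<sigma> y = W y powr (- 1 / (p y - 1))"
    and Kn: "1 \<le> Kn" "\<And>c r. c \<in> space M \<Longrightarrow> 0 < r \<Longrightarrow> N c r * N' c r \<le> Kn * measure M (B c r)"
begin

lemmas L = log_holderD[OF lh] and L' = log_holderD[OF lh'] and W = ball_normD[OF Nn] and S = ball_normD[OF Nn']
lemmas [measurable] = L(1) L'(1) W(3) S(3)

lemma p_gt1: "y \<in> space M \<Longrightarrow> 1 < p y" and pinf_gt1: "1 < pinf"
  using L(2,3) L(6)[of y] by linarith+

lemma \<sigma>_powr:
  assumes "y \<in> space M"
  shows "\<sigma> y powr (1 - p y) = W y"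
proof -
  have "- 1 / (p y - 1) * (1 - p y) = 1" using p_gt1[OF assms] by (simp add: field_simps)
  then show ?thesis using \<sigma>W[OF assms] W(4)[OF assms] by (simp only: powr_powr powr_one less_imp_le)
qed

lemma W_powr: "y \<in> space M \<Longrightarrow> W y powr (1 - p' y) = \<sigma> y"
  using \<sigma>W[of y] p_gt1[of y] by (simp add: p'_def field_simps)

lemma p_conj: "y \<in> space M \<Longrightarrow> (p y - 1) * p' y = p y"
  using p_gt1[of y] by (simp add: p'_def)

text \<open>Applied with g = f / \<sigma> + E^(-t), \<Phi> = G^(p-1) + E^(-t) and h = H(x). On the
  ball the varying exponent of \<open>a\<close> is frozen, to p(x) if the ball is local and to the
  limit exponent otherwise; then \<open>muckenhoupt_chain\<close> gives F^(s-1) \<le> R h for that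
  exponent s, and raising to the conjugate of s gives the claim. In the second case the exponent
  must finally be changed back to p(x), which produces the term E(x)^(-t).\<close>

lemma ball_estimate:
  assumes A: "1 \<le> A" and t: "0 < t"
  shows "\<exists>K\<ge>0. \<forall>g f \<Phi> c r x h. g \<in> borel_measurable M \<longrightarrow> f \<in> borel_measurable M \<longrightarrow> \<Phi> \<in> borel_measurable M \<longrightarrow> c \<in> space M \<longrightarrow> 0 < r \<longrightarrow> x \<in> B c r \<longrightarrow>
     (\<forall>y\<in>space M. E y powr (- t) \<le> g y \<and> 0 \<le> f y \<and> f y \<le> g y * \<sigma> y) \<longrightarrow>
     (\<integral>\<^sup>+y. ennreal (g y powr p y) \<partial>wm \<sigma>) \<le> ennreal A \<longrightarrow>
     (\<forall>y\<in>B c r. avg (wm \<sigma>) (B c r) g powr (p y - 1) + E y powr (- t) \<le> \<Phi> y) \<longrightarrow>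
     (\<integral>\<^sup>+y\<in>B c r. ennreal (\<Phi> y / W y) \<partial>wm W) < \<infinity> \<longrightarrow>
     avg (wm W) (B c r) (\<lambda>y. \<Phi> y / W y) \<le> h \<longrightarrow>
     (\<integral>\<^sup>+y\<in>B c r. ennreal (f y) \<partial>M) < \<infinity> \<and>
     avg M (B c r) f powr p x \<le> K * (h powr p' x + E x powr (- t))"
proof -
  note D0 = doublingD[OF dbl]
  obtain D\<sigma> where d\<sigma>: "doubling (wm \<sigma>) D\<sigma>" using ball_norm_doubling[OF Nn' lh'] by blast
  note D\<sigma> = doublingD[OF d\<sigma>]
  obtain m where m: "0 \<le> m" "\<And>c r. c \<in> space M \<Longrightarrow> 0 < r \<Longrightarrow> \<bar>ln (measure (wm \<sigma>) (B c r))\<bar> \<le> m * (ln (E c) + \<bar>ln r\<bar>)"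
    using doubling_bounds(1)[OF d\<sigma>] by blast
  obtain \<kappa>1 where \<kappa>1: "0 < \<kappa>1" "\<And>c r. c \<in> space M \<Longrightarrow> 0 < r \<Longrightarrow> \<not> local_ball c r \<Longrightarrow> \<kappa>1 \<le> measure (wm \<sigma>) (B c r)"
    using doubling_bounds(2)[OF d\<sigma>] by blast
  obtain \<kappa>2 where \<kappa>2: "0 < \<kappa>2" "\<And>c r. c \<in> space M \<Longrightarrow> 0 < r \<Longrightarrow> \<not> local_ball c r \<Longrightarrow> \<kappa>2 \<le> N c r"
    using ball_norm_bounds(2)[OF Nn] by blast
  obtain \<kappa>3 where \<kappa>3: "0 < \<kappa>3" "\<And>c r. c \<in> space M \<Longrightarrow> 0 < r \<Longrightarrow> \<not> local_ball c r \<Longrightarrow> \<kappa>3 \<le> N' c r"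
    using ball_norm_bounds(2)[OF Nn'] by blast
  obtain K0 where K0: "0 \<le> K0" "\<And>c r x y. c \<in> space M \<Longrightarrow> 0 < r \<Longrightarrow> local_ball c r \<Longrightarrow> x \<in> B c r \<Longrightarrow> y \<in> B c r \<Longrightarrow>
     \<bar>p x - p y\<bar> * (ln (E c) + \<bar>ln r\<bar>) \<le> K0"
    using log_holder_local_osc[OF lh] by blast
  obtain K1 where K1: "1 \<le> K1" "\<And>c r x. c \<in> space M \<Longrightarrow> 0 < r \<Longrightarrow> x \<in> B c r \<Longrightarrow> local_ball c r \<Longrightarrow>
     measure (wm W) (B c r) \<le> K1 * N c r powr p x"
    using ball_norm_equiv_local[OF Nn lh] by blast
  obtain K2 where K2: "1 \<le> K2" "\<And>c r x. c \<in> space M \<Longrightarrow> 0 < r \<Longrightarrow> x \<in> B c r \<Longrightarrow> local_ball c r \<Longrightarrow>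
     measure (wm \<sigma>) (B c r) \<le> K2 * N' c r powr p' x"
    using ball_norm_equiv_local[OF Nn' lh'] by blast
  obtain K3 where K3: "1 \<le> K3" "\<And>c r. c \<in> space M \<Longrightarrow> 0 < r \<Longrightarrow> \<kappa>2 \<le> N c r \<Longrightarrow>
     measure (wm W) (B c r) \<le> K3 * N c r powr pinf"
    using ball_norm_equiv_global[OF Nn lh \<kappa>2(1)] by blast
  obtain K4 where K4: "1 \<le> K4" "\<And>c r. c \<in> space M \<Longrightarrow> 0 < r \<Longrightarrow> \<kappa>3 \<le> N' c r \<Longrightarrow>
     measure (wm \<sigma>) (B c r) \<le> K4 * N' c r powr pinf'"
    using ball_norm_equiv_global[OF Nn' lh' \<kappa>3(1)] by blast
  define K where "K = max (max K1 K2) (max K3 K4)"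
  have K: "1 \<le> K" "K1 \<le> K" "K2 \<le> K" "K3 \<le> K" "K4 \<le> K" using K1(1) by (auto simp: K_def le_max_iff_disj)
  have b': "1 < b'" "0 \<le> b'" using L(2-4) by linarith+
  have b: "0 < b - 1" "0 < b" using L(2) by auto
  have \<beta>': "0 \<le> \<beta>'" using L'(2-4) by linarith
  have ln2A: "0 \<le> ln (2 * A0)" using A0 by simp
  \<comment> \<open>Will give |ln a| \<le> ka (ln E(c) + |ln r|) on local balls: the first summand
    from g \<ge> E^(-t), the others from a \<le> 1 + A / \<sigma>(B).\<close>
  define ka where "ka = t * (ln (2 * A0) + 1) + ln 2 + ln A + m"
  have ka0: "0 \<le> ka" unfolding ka_def using t ln2A A m(1) by simp
  define k1 where "k1 = exp (ka * K0)"
  define Sa where "Sa = 1 + A / \<kappa>1"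
  have Sa: "1 \<le> Sa" unfolding Sa_def using A \<kappa>1 by simp
  define k2 where "k2 = exp (C * (t / (b - 1) + ln Sa))"
  define kk where "kk = max k1 k2"
  have kk: "1 \<le> k1" "1 \<le> k2" "1 \<le> kk" "k1 \<le> kk" "k2 \<le> kk"
    using ka0 K0(1) L(5) t b Sa by (auto simp: k1_def k2_def kk_def le_max_iff_disj)
  \<comment> \<open>The constant of \<open>muckenhoupt_chain\<close>, made independent of the
    exponent s \<le> b' by enlarging both powers.\<close>
  define R where "R = kk * K * K powr b' * Kn powr b'"
  have R1: "1 \<le> R"
  proof -
    have "1 \<le> K powr b'" "1 \<le> Kn powr b'" using K(1) Kn(1) b' by (auto intro: ge_one_powr_ge_zero)
    moreover have "1 \<le> u * v" if "1 \<le> u" "1 \<le> v" for u v :: real using mult_mono[of 1 u 1 v] that by simp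
    ultimately show ?thesis unfolding R_def using K(1) kk(3) by blast
  qed
  have chain: "F powr (s - 1) \<le> R * h"
    if "1 < s" "s \<le> b'" "0 \<le> F" "F \<le> a * \<sigma>B / V" "0 \<le> a" "a powr (s - 1) \<le> kk * h * WB / V"
      "WB \<le> K * n powr s" "\<sigma>B \<le> K * n' powr (s / (s - 1))" "n * n' \<le> Kn * V"
      "0 \<le> h" "0 \<le> WB" "0 \<le> \<sigma>B" "0 < V" "0 < n" "0 < n'" for F a h \<sigma>B WB V n n' s :: real
  proof -
    have "F powr (s - 1) \<le> kk * K * K powr (s - 1) * Kn powr s * h"
      by (rule muckenhoupt_chain[OF that(1,3,4,5,6,7,8,9)]) (use that kk K Kn in auto)
    also have "\<dots> \<le> R * h"
      unfolding R_def using that kk K Kn by (intro mult_right_mono mult_mono powr_mono mult_nonneg_nonneg) auto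
    finally show ?thesis .
  qed
  \<comment> \<open>Upper bound for averages of f over balls that are not local; see the Hoelder
    argument for \<open>FSF\<close>.\<close>
  define SF where "SF = max 1 (Kn * (A + \<Gamma>') / \<kappa>2)"
  have SF: "1 \<le> SF" by (simp add: SF_def)
  define k3 where "k3 = exp (C * (t / b + ln SF))"
  define k4 where "k4 = exp (C' * (t / \<beta>))"
  have \<beta>: "0 < \<beta>" using L'(2) by simp
  have k34: "1 \<le> k3" "1 \<le> k4" using L(5) L'(5) t b \<beta> SF by (auto simp: k3_def k4_def)
  define Kf where "Kf = max (R powr \<beta>') (max (SF powr b') (k3 * R powr \<beta>' * k4 + 1))"
  have Kf0: "0 \<le> Kf" by (simp add: Kf_def le_max_iff_disj)
  have "(\<integral>\<^sup>+y\<in>B c r. ennreal (f y) \<partial>M) < \<infinity> \<and> avg M (B c r) f powr p x \<le> Kf * (h powr p' x + E x powr (- t))"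
    if gm: "g \<in> borel_measurable M" and fm: "f \<in> borel_measurable M" and \<Phi>m: "\<Phi> \<in> borel_measurable M"
     and c: "c \<in> space M" and r: "0 < r" and x: "x \<in> B c r"
     and fg: "\<forall>y\<in>space M. E y powr (- t) \<le> g y \<and> 0 \<le> f y \<and> f y \<le> g y * \<sigma> y"
     and gA: "(\<integral>\<^sup>+y. ennreal (g y powr p y) \<partial>wm \<sigma>) \<le> ennreal A"
     and \<Phi>: "\<forall>y\<in>B c r. avg (wm \<sigma>) (B c r) g powr (p y - 1) + E y powr (- t) \<le> \<Phi> y"
     and \<Phi>fin: "(\<integral>\<^sup>+y\<in>B c r. ennreal (\<Phi> y / W y) \<partial>wm W) < \<infinity>"
     and hge: "avg (wm W) (B c r) (\<lambda>y. \<Phi> y / W y) \<le> h" for g f \<Phi> c r x h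
  proof -
    note [measurable] = gm fm \<Phi>m
    have Bm [measurable]: "B c r \<in> sets M" by (rule ball_sets[OF c r])
    have BX: "y \<in> space M" if "y \<in> B c r" for y using that by (simp add: ball_iff)
    have xX: "x \<in> space M" by (rule BX[OF x])
    have g0: "0 \<le> g y" if "y \<in> space M" for y using fg that powr_ge_zero order_trans by blast
    have \<Phi>0: "0 \<le> \<Phi> y" if "y \<in> B c r" for y using \<Phi> that powr_ge_zero[of _ "p y - 1"] powr_ge_zero[of "E y" "-t"] by (meson add_nonneg_nonneg order_trans)
    define a where "a = avg (wm \<sigma>) (B c r) g"
    have a0: "0 \<le> a" by (simp add: a_def)
    define V where "V = measure M (B c r)"
    note V = D0(4,5,6,7)[OF c r, folded V_def]
    define WB where "WB = measure (wm W) (B c r)"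
    note WB = ball_norm_weight_finite(2)[OF Nn lh c r] ball_norm_weight_measure[OF Nn lh c r, folded WB_def]
    define \<sigma>B where "\<sigma>B = measure (wm \<sigma>) (B c r)"
    note \<sigma>B = ball_norm_weight_finite(2)[OF Nn' lh' c r] ball_norm_weight_measure[OF Nn' lh' c r, folded \<sigma>B_def]
    define n where "n = N c r"
    define n' where "n' = N' c r"
    have n: "0 < n" "0 < n'" unfolding n_def n'_def using W(5)[OF c r] S(5)[OF c r] by auto
    have nn: "n * n' \<le> Kn * V" unfolding n_def n'_def V_def by (rule Kn(2)[OF c r])
    have p1: "1 \<le> p y" if "y \<in> space M" for y using p_gt1[OF that] by simp
    note gb = ball_mean_bounds[OF d\<sigma> c r gm L(1) g0 p1 _ gA, folded a_def \<sigma>B_def]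
    have gfin: "(\<integral>\<^sup>+y\<in>B c r. ennreal (g y) \<partial>wm \<sigma>) < \<infinity>" and a_le: "a \<le> 1 + A / \<sigma>B" using gb A by auto
    have geq: "(\<integral>\<^sup>+y\<in>B c r. ennreal (g y) \<partial>wm \<sigma>) = ennreal (a * \<sigma>B)"
      unfolding a_def \<sigma>B_def by (rule avg_eq_integral) (use \<sigma>B gfin in auto)
    have gsig: "(\<integral>\<^sup>+y\<in>B c r. ennreal (g y * \<sigma> y) \<partial>M) = ennreal (a * \<sigma>B)"
    proof -
      have "(\<integral>\<^sup>+y\<in>B c r. ennreal (g y * \<sigma> y) \<partial>M) = (\<integral>\<^sup>+y. ennreal (\<sigma> y) * (ennreal (g y) * indicator (B c r) y) \<partial>M)"
        using g0 S(4) by (intro nn_integral_cong) (auto simp: ennreal_mult mult_ac less_imp_le indicator_def)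
      also have "\<dots> = (\<integral>\<^sup>+y\<in>B c r. ennreal (g y) \<partial>wm \<sigma>)" by (rule nn_integral_wm[symmetric]) measurable
      finally show ?thesis using geq by simp
    qed
    have fle: "(\<integral>\<^sup>+y\<in>B c r. ennreal (f y) \<partial>M) \<le> (\<integral>\<^sup>+y\<in>B c r. ennreal (g y * \<sigma> y) \<partial>M)"
      using fg by (intro nn_integral_mono mult_right_mono ennreal_leI) auto
    have ffin: "(\<integral>\<^sup>+y\<in>B c r. ennreal (f y) \<partial>M) < \<infinity>" using fle unfolding gsig by (rule le_less_trans) simp
    define F where "F = avg M (B c r) f"
    have F0: "0 \<le> F" by (simp add: F_def)
    have FaB: "F \<le> a * \<sigma>B / V"
      unfolding F_def
      by (rule avg_le_bound) (use fle V a0 \<sigma>B in \<open>auto simp: gsig V_def[symmetric]\<close>)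
    define h0 where "h0 = avg (wm W) (B c r) (\<lambda>y. \<Phi> y / W y)"
    have h00: "0 \<le> h0" by (simp add: h0_def)
    have "h0 \<le> h" using hge by (simp add: h0_def)
    then have hh: "0 \<le> h" "h0 \<le> h" using h00 by auto
    \<comment> \<open>The density W cancels against the quotient \<Phi> / W, so a constant lower
      bound for \<Phi> on the ball becomes a lower bound for the W-average
      \<open>h0\<close>.\<close>
    have hI: "\<theta> * V \<le> h0 * WB" if th: "0 \<le> \<theta>" "\<And>y. y \<in> B c r \<Longrightarrow> \<theta> \<le> \<Phi> y" for \<theta>
    proof -
      have "ennreal (\<theta> * V) = (\<integral>\<^sup>+y\<in>B c r. ennreal \<theta> \<partial>M)"
        using V th by (simp add: nn_integral_cmult_indicator ennreal_mult)
      also have "\<dots> \<le> (\<integral>\<^sup>+y. ennreal (W y) * (ennreal (\<Phi> y / W y) * indicator (B c r) y) \<partial>M)"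
      proof (rule nn_integral_mono)
        fix y assume y: "y \<in> space M"
        have "ennreal \<theta> \<le> ennreal (W y) * ennreal (\<Phi> y / W y)" if yB: "y \<in> B c r"
        proof -
          have "ennreal \<theta> \<le> ennreal (W y * (\<Phi> y / W y))" using th(2)[OF yB] W(4)[OF y] by (intro ennreal_leI) simp
          also have "\<dots> = ennreal (W y) * ennreal (\<Phi> y / W y)" using W(4)[OF y] \<Phi>0[OF yB] by (intro ennreal_mult) auto
          finally show ?thesis .
        qed
        then show "ennreal \<theta> * indicator (B c r) y \<le> ennreal (W y) * (ennreal (\<Phi> y / W y) * indicator (B c r) y)"
          by (auto simp: indicator_def)
      qed
      also have "\<dots> = (\<integral>\<^sup>+y\<in>B c r. ennreal (\<Phi> y / W y) \<partial>wm W)" by (rule nn_integral_wm[symmetric]) measurable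
      also have "\<dots> = ennreal (h0 * WB)" unfolding h0_def WB_def by (rule avg_eq_integral) (use WB \<Phi>fin in auto)
      finally show ?thesis by (subst (asm) ennreal_le_iff) (use h00 WB in auto)
    qed
    have "F powr p x \<le> Kf * (h powr p' x + E x powr (- t))"
    proof (cases "local_ball c r")
      case True
      define \<Lambda> where "\<Lambda> = ln (E c) + \<bar>ln r\<bar>"
      have \<Lambda>: "1 \<le> \<Lambda>" "ln (E c) \<le> \<Lambda>" using ln_E[OF c] by (auto simp: \<Lambda>_def)
      have Ec: "0 < E c" using E_ge1[OF c] by simp
      \<comment> \<open>The purpose of the tail in g: the average \<open>a\<close> cannot be smaller
        than a power of E(c), hence |ln a| is controlled from both sides.\<close>
      have alo: "(2 * A0 * E c) powr (- t) \<le> a"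
        unfolding a_def
      proof (rule avg_ge_const)
        fix y assume y: "y \<in> B c r"
        have "(2 * A0 * E c) powr (- t) \<le> E y powr (- t)"
          using E_local(2)[OF c r True y] E_ge1[OF BX[OF y]] t by (intro powr_mono2') auto
        then show "(2 * A0 * E c) powr (- t) \<le> g y" using fg BX[OF y] by force
      qed (use \<sigma>B gfin in auto)
      have "0 < (2 * A0 * E c) powr (- t)" using A0 Ec by simp
      then have a_pos: "0 < a" using alo by linarith
      have "ln ((2 * A0 * E c) powr (- t)) \<le> ln a" using alo A0 Ec a_pos by (subst ln_le_cancel_iff) auto
      moreover have "ln ((2 * A0 * E c) powr (- t)) = - t * (ln (2 * A0) + ln (E c))"
        using A0 Ec by (simp add: ln_powr ln_mult)
      ultimately have "- t * (ln (2 * A0) + ln (E c)) \<le> ln a" by (simp only:)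
      then have lnlo: "- ln a \<le> t * (ln (2 * A0) + ln (E c))" unfolding mult_minus_left by linarith
      have "ln (2 * A0) \<le> ln (2 * A0) * \<Lambda>" using mult_left_mono[OF \<Lambda>(1) ln2A] by simp
      then have "t * (ln (2 * A0) + ln (E c)) \<le> t * ((ln (2 * A0) + 1) * \<Lambda>)"
        using t \<Lambda> by (intro mult_left_mono) (auto simp: distrib_right)
      then have 1: "- ln a \<le> t * (ln (2 * A0) + 1) * \<Lambda>" using lnlo by simp
      have "a \<le> 2 * max 1 (A / \<sigma>B)" using a_le by linarith
      then have "ln a \<le> ln (2 * max 1 (A / \<sigma>B))" using a_pos by (subst ln_le_cancel_iff) auto
      also have "\<dots> = ln 2 + ln (max 1 (A / \<sigma>B))" by (subst ln_mult) auto
      also have "ln (max 1 (A / \<sigma>B)) \<le> ln A + \<bar>ln \<sigma>B\<bar>" using A \<sigma>B(3) ln_ge_zero[OF A] by (auto simp: max_def ln_div)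
      also have "\<bar>ln \<sigma>B\<bar> \<le> m * \<Lambda>" unfolding \<sigma>B_def \<Lambda>_def by (rule m(2)[OF c r])
      finally have "ln a \<le> ln 2 + ln A + m * \<Lambda>" by simp
      moreover have "ln 2 + ln A \<le> (ln 2 + ln A) * \<Lambda>" using mult_left_mono[OF \<Lambda>(1), of "ln 2 + ln A"] A by simp
      ultimately have 2: "ln a \<le> (ln 2 + ln A + m) * \<Lambda>" by (simp add: distrib_right)
      have "0 \<le> t * (ln (2 * A0) + 1) * \<Lambda>" "0 \<le> (ln 2 + ln A + m) * \<Lambda>" using t ln2A \<Lambda> A m(1) by auto
      then have lna: "\<bar>ln a\<bar> \<le> ka * \<Lambda>" using 1 2 unfolding ka_def distrib_right abs_le_iff by linarith
      have osc: "a powr (p x - 1) \<le> k1 * a powr (p y - 1)" if y: "y \<in> B c r" for y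
        unfolding k1_def
      proof (rule powr_exponent_change[OF a_pos])
        have "\<bar>p x - 1 - (p y - 1)\<bar> * \<bar>ln a\<bar> \<le> \<bar>p x - p y\<bar> * (ka * \<Lambda>)" using lna by (intro mult_mono) auto
        also have "\<dots> = ka * (\<bar>p x - p y\<bar> * \<Lambda>)" by simp
        also have "\<dots> \<le> ka * K0" unfolding \<Lambda>_def by (intro mult_left_mono K0(2) c r True x y ka0)
        finally show "\<bar>p x - 1 - (p y - 1)\<bar> * \<bar>ln a\<bar> \<le> ka * K0" .
      qed
      have "a powr (p x - 1) / k1 * V \<le> h0 * WB"
      proof (rule hI)
        fix y assume y: "y \<in> B c r"
        have "a powr (p x - 1) / k1 \<le> a powr (p y - 1)" using osc[OF y] kk(1) by (simp add: field_simps)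
        also have "\<dots> \<le> \<Phi> y" using bspec[OF \<Phi> y] powr_ge_zero[of "E y" "-t"] unfolding a_def by linarith
        finally show "a powr (p x - 1) / k1 \<le> \<Phi> y" .
      qed (use kk(1) in auto)
      then have "a powr (p x - 1) \<le> k1 * h0 * WB / V" using kk(1) V(3) by (simp add: field_simps)
      also have "\<dots> \<le> kk * h * WB / V" using kk hh h00 WB V by (intro divide_right_mono mult_mono) auto
      finally have ah: "a powr (p x - 1) \<le> kk * h * WB / V" .
      have "F powr (p x - 1) \<le> R * h"
      proof (rule chain[OF p_gt1[OF xX] L(7)[OF xX] F0 FaB a0 ah _ _ nn hh(1)])
        show "WB \<le> K * n powr p x"
          using K1(2)[OF c r x True] mult_right_mono[OF K(2), of "n powr p x"] by (simp add: WB_def n_def)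
        show "\<sigma>B \<le> K * n' powr (p x / (p x - 1))"
          using K2(2)[OF c r x True] mult_right_mono[OF K(3), of "n' powr p' x"] by (simp add: \<sigma>B_def n'_def p'_def)
      qed (use WB \<sigma>B V n in auto)
      then have "(F powr (p x - 1)) powr p' x \<le> (R * h) powr p' x" using L'(2) L'(6)[OF xX] by (intro powr_mono2) auto
      then have "F powr p x \<le> R powr p' x * h powr p' x" using p_conj[OF xX] by (simp add: powr_powr powr_mult)
      also have "\<dots> \<le> Kf * (h powr p' x + E x powr (- t))"
      proof (rule mult_mono)
        have "R powr p' x \<le> R powr \<beta>'" using R1 L'(7)[OF xX] by (intro powr_mono) auto
        then show "R powr p' x \<le> Kf" by (simp add: Kf_def le_max_iff_disj)
      qed (use Kf0 in auto)
      finally show ?thesis .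
    next
      case False
      note s1 = \<kappa>1(2)[OF c r False, folded \<sigma>B_def] and nl = \<kappa>2(2)[OF c r False, folded n_def] and nl' = \<kappa>3(2)[OF c r False, folded n'_def]
      have "A / \<sigma>B \<le> A / \<kappa>1" using s1 \<kappa>1(1) A by (intro divide_left_mono) auto
      then have aSa: "a \<le> Sa" using a_le by (simp add: Sa_def)
      have "a powr (pinf - 1) / k2 * V \<le> h0 * WB"
      proof (rule hI)
        fix y assume y: "y \<in> B c r"
        have "a powr (pinf - 1) \<le> k2 * a powr (p y - 1) + E y powr (- t)"
          using powr_exponent_switch[of "b - 1" "pinf - 1" "p y - 1" "ln (E y)" C a Sa 1 t]
            b L(3) L(8)[OF BX[OF y]] ln_E[OF BX[OF y]] a0 aSa Sa t
          by (simp add: k2_def E_powr[OF BX[OF y]] abs_minus_commute)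
        \<comment> \<open>The error of the exponent switch is absorbed by the tail that was built
          into \<Phi>.\<close>
        also have "\<dots> \<le> k2 * (a powr (p y - 1) + E y powr (- t))"
          using mult_right_mono[OF kk(2), of "E y powr (- t)"] by (simp add: distrib_left)
        also have "\<dots> \<le> k2 * \<Phi> y" using \<Phi> y kk(2) unfolding a_def by (intro mult_left_mono) auto
        finally show "a powr (pinf - 1) / k2 \<le> \<Phi> y" using kk(2) by (simp add: field_simps)
      qed (use kk(2) in auto)
      then have "a powr (pinf - 1) \<le> k2 * h0 * WB / V" using kk(2) V(3) by (simp add: field_simps)
      also have "\<dots> \<le> kk * h * WB / V" using kk hh h00 WB V by (intro divide_right_mono mult_mono) auto
      finally have ah: "a powr (pinf - 1) \<le> kk * h * WB / V" .
      have Fh: "F powr (pinf - 1) \<le> R * h"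
      proof (rule chain[OF pinf_gt1 L(4) F0 FaB a0 ah _ _ nn hh(1)])
        show "WB \<le> K * n powr pinf"
          using K3(2)[OF c r nl[unfolded n_def]] mult_right_mono[OF K(4), of "n powr pinf"] by (simp add: WB_def n_def)
        show "\<sigma>B \<le> K * n' powr (pinf / (pinf - 1))"
          using K4(2)[OF c r nl'[unfolded n'_def]] mult_right_mono[OF K(5), of "n' powr pinf'"] by (simp add: \<sigma>B_def n'_def pinf'_def)
      qed (use WB \<sigma>B V n in auto)
      \<comment> \<open>Hoelder in modular form: Young's inequality for g \<sigma>^(1/p) and
        \<sigma>^(1/p') / N' bounds the integral of g \<sigma> over the ball by N' (A + \<Gamma>').
        Then N N' \<le> Kn mu(B) and N \<ge> \<kappa>2 bound F.\<close>
      have FSF: "F \<le> SF"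
      proof -
        have "(\<integral>\<^sup>+y\<in>B c r. ennreal (g y * \<sigma> y) \<partial>M)
          \<le> (\<integral>\<^sup>+y. ennreal n' * (ennreal (\<sigma> y) * ennreal (g y powr p y) + ennreal (\<sigma> y * n' powr (- p' y)) * indicator (B c r) y) \<partial>M)"
        proof (rule nn_integral_mono)
          fix y assume y: "y \<in> space M"
          have s: "0 < \<sigma> y" by (rule S(4)[OF y])
          have py: "1 < p y" by (rule p_gt1[OF y])
          have "(g y * \<sigma> y powr (1 / p y)) * (\<sigma> y powr (1 / p' y) / n')
            \<le> (g y * \<sigma> y powr (1 / p y)) powr p y + (\<sigma> y powr (1 / p' y) / n') powr p' y"
            using g0[OF y] n by (intro young_unit py) (auto simp: p'_def)
          also have "(g y * \<sigma> y powr (1 / p y)) powr p y = \<sigma> y * g y powr p y"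
            using py s by (simp add: powr_mult powr_powr)
          also have "(\<sigma> y powr (1 / p' y) / n') powr p' y = \<sigma> y * n' powr (- p' y)"
          proof -
            have "(\<sigma> y powr (1 / p' y) / n') powr p' y = \<sigma> y / n' powr p' y"
              using L'(2) L'(6)[OF y] s by (simp add: powr_divide powr_powr)
            then show ?thesis by (simp add: powr_minus divide_inverse)
          qed
          also have "(g y * \<sigma> y powr (1 / p y)) * (\<sigma> y powr (1 / p' y) / n') = g y * \<sigma> y / n'"
          proof -
            have "1 / p y + 1 / p' y = 1" using py by (simp add: p'_def field_simps)
            then have "\<sigma> y powr (1 / p y) * \<sigma> y powr (1 / p' y) = \<sigma> y" using s by (simp add: powr_add[symmetric])
            then show ?thesis by (simp add: mult.assoc)
          qed
          finally have "g y * \<sigma> y \<le> n' * (\<sigma> y * g y powr p y + \<sigma> y * n' powr (- p' y))"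
            using n(2) by (simp add: field_simps)
          then have "ennreal (g y * \<sigma> y) \<le> ennreal (n' * (\<sigma> y * g y powr p y + \<sigma> y * n' powr (- p' y)))" by (rule ennreal_leI)
          also have "\<dots> = ennreal n' * (ennreal (\<sigma> y) * ennreal (g y powr p y) + ennreal (\<sigma> y * n' powr (- p' y)))"
            using n s by (simp add: ennreal_mult[symmetric] ennreal_plus[symmetric] del: ennreal_plus)
          finally show "ennreal (g y * \<sigma> y) * indicator (B c r) y
             \<le> ennreal n' * (ennreal (\<sigma> y) * ennreal (g y powr p y) + ennreal (\<sigma> y * n' powr (- p' y)) * indicator (B c r) y)"
            by (auto simp: indicator_def)
        qed
        also have "\<dots> = ennreal n' * ((\<integral>\<^sup>+y. ennreal (g y powr p y) \<partial>wm \<sigma>) + (\<integral>\<^sup>+y\<in>B c r. ennreal (\<sigma> y * n' powr (- p' y)) \<partial>M))"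
          by (subst nn_integral_cmult, simp, subst nn_integral_add, simp, simp, subst nn_integral_wm) auto
        also have "\<dots> \<le> ennreal n' * (ennreal A + ennreal \<Gamma>')"
          using gA S(7)[OF c r] by (intro mult_left_mono add_mono) (auto simp: n'_def)
        also have "\<dots> = ennreal (n' * (A + \<Gamma>'))" using n A S(1) by (simp add: ennreal_mult)
        finally have "a * \<sigma>B \<le> n' * (A + \<Gamma>')" unfolding gsig by (subst (asm) ennreal_le_iff) (use n A S(1) in auto)
        then have "F \<le> n' * (A + \<Gamma>') / V" using FaB V by (meson divide_right_mono less_imp_le order_trans)
        also have "\<dots> \<le> Kn * (A + \<Gamma>') / n"
        proof -
          have "n * n' * (A + \<Gamma>') \<le> Kn * V * (A + \<Gamma>')" using nn A S(1) by (intro mult_right_mono) auto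
          then show ?thesis using V(3) n by (simp add: field_simps)
        qed
        also have "\<dots> \<le> Kn * (A + \<Gamma>') / \<kappa>2" using nl \<kappa>2(1) Kn(1) A S(1) by (intro divide_left_mono) auto
        finally show ?thesis by (simp add: SF_def le_max_iff_disj)
      qed
      \<comment> \<open>Changing the exponent of h requires an upper bound on h. If h > 1, then
        h^p'(x) \<ge> 1 and the crude bound F \<le> SF already suffices.\<close>
      show ?thesis
      proof (cases "h \<le> 1")
        case False
        have "F powr p x \<le> SF powr p x" using FSF F0 p_gt1[OF xX] by (intro powr_mono2) auto
        also have "\<dots> \<le> SF powr b'" using SF L(7)[OF xX] by (intro powr_mono) auto
        also have "\<dots> \<le> Kf * 1" by (simp add: Kf_def le_max_iff_disj)
        also have "\<dots> \<le> Kf * (h powr p' x + E x powr (- t))"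
        proof (rule mult_left_mono[OF _ Kf0])
          have "1 \<le> h powr p' x" using False L'(2) L'(6)[OF xX] by (intro ge_one_powr_ge_zero) auto
          then show "1 \<le> h powr p' x + E x powr (- t)" by (simp add: add_increasing2)
        qed
        finally show ?thesis .
      next
        case True
        have "F powr p x \<le> k3 * F powr pinf + E x powr (- t)"
          using powr_exponent_switch[OF b(2) L(6)[OF xX] L(8)[OF xX] ln_E[OF xX] F0 FSF SF, of 1 t] t
          by (simp add: k3_def E_powr[OF xX])
        moreover have "F powr pinf \<le> R powr \<beta>' * (k4 * h powr p' x + E x powr (- t))"
        proof -
          have pc: "(pinf - 1) * pinf' = pinf" using pinf_gt1 by (simp add: pinf'_def)
          have "(F powr (pinf - 1)) powr pinf' \<le> (R * h) powr pinf'" using Fh L'(2,3) by (intro powr_mono2) auto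
          then have "F powr pinf \<le> R powr pinf' * h powr pinf'" by (simp add: powr_powr powr_mult pc)
          also have "\<dots> \<le> R powr \<beta>' * (k4 * h powr p' x + E x powr (- t))"
          proof (rule mult_mono)
            show "R powr pinf' \<le> R powr \<beta>'" using R1 L'(4) by (intro powr_mono) auto
            show "h powr pinf' \<le> k4 * h powr p' x + E x powr (- t)"
              using powr_exponent_switch[OF \<beta> L'(3) _ ln_E[OF xX] hh(1) True, of "p' x" C' 1 t] L'(8)[OF xX] t
              by (simp add: k4_def E_powr[OF xX] abs_minus_commute)
          qed auto
          finally show ?thesis .
        qed
        ultimately have "F powr p x \<le> k3 * (R powr \<beta>' * (k4 * h powr p' x + E x powr (- t))) + E x powr (- t)"
          using k34(1) by (meson add_right_mono mult_left_mono order_trans zero_le_one)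
        also have "\<dots> \<le> (k3 * R powr \<beta>' * k4 + 1) * (h powr p' x + E x powr (- t))"
        proof -
          define u where "u = k3 * R powr \<beta>'"
          have u: "0 \<le> u" using k34 by (simp add: u_def)
          have "u * E x powr (- t) \<le> u * k4 * E x powr (- t)"
            using mult_left_mono[OF k34(2) u] by (intro mult_right_mono) auto
          then show ?thesis unfolding u_def[symmetric] mult.assoc[symmetric] by (simp add: algebra_simps add_increasing)
        qed
        also have "\<dots> \<le> Kf * (h powr p' x + E x powr (- t))" by (intro mult_right_mono) (auto simp: Kf_def)
        finally show ?thesis .
      qed
    qed
    then show ?thesis using ffin by (simp add: F_def)
  qed
  then show ?thesis using Kf0 by blast
qed

text \<open>Finiteness of the integrals is part of the conclusion because \<open>avg\<close> turns
  an infinite integral into 0: a bound for \<open>MF\<close> alone would say nothing about such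
  balls.\<close>

theorem weighted_maximal_bound:
  "\<exists>K\<ge>0. \<forall>I f. family I \<longrightarrow> f \<in> borel_measurable M \<longrightarrow> (\<forall>y\<in>space M. 0 \<le> f y) \<longrightarrow>
     (\<integral>\<^sup>+y. ennreal (f y powr p y) \<partial>wm W) \<le> 1 \<longrightarrow>
     (\<forall>(c,r)\<in>I. (\<integral>\<^sup>+y\<in>B c r. ennreal (f y) \<partial>M) < \<infinity>) \<and>
     (\<integral>\<^sup>+y. ennreal (MF M I f y powr p y) \<partial>wm W) \<le> ennreal K"
proof -
  obtain D\<sigma> where d\<sigma>: "doubling (wm \<sigma>) D\<sigma>" using ball_norm_doubling[OF Nn' lh'] by blast
  obtain DW where dW: "doubling (wm W) DW" using ball_norm_doubling[OF Nn lh] by blast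
  obtain t1 where t1: "0 < t1" "\<And>t. t1 \<le> t \<Longrightarrow> (\<integral>\<^sup>+x. ennreal (E x powr (- t)) \<partial>wm \<sigma>) < \<infinity>"
    using doubling_tail[OF d\<sigma>] by blast
  obtain t2 where t2: "0 < t2" "\<And>t. t2 \<le> t \<Longrightarrow> (\<integral>\<^sup>+x. ennreal (E x powr (- t)) \<partial>wm W) < \<infinity>"
    using doubling_tail[OF dW] by blast
  define t where "t = max t1 t2"
  have t: "0 < t" using t1(1) by (simp add: t_def less_max_iff_disj)
  have f1: "(\<integral>\<^sup>+x. ennreal (E x powr (- t)) \<partial>wm \<sigma>) < \<infinity>" by (rule t1(2)) (simp add: t_def)
  have f2: "(\<integral>\<^sup>+x. ennreal (E x powr (- t)) \<partial>wm W) < \<infinity>" by (rule t2(2)) (simp add: t_def)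
  obtain T\<sigma> where T\<sigma>: "0 \<le> T\<sigma>" "(\<integral>\<^sup>+x. ennreal (E x powr (- t)) \<partial>wm \<sigma>) = ennreal T\<sigma>" using f1 by (rule ennreal_finiteE)
  obtain TW where TW: "0 \<le> TW" "(\<integral>\<^sup>+x. ennreal (E x powr (- t)) \<partial>wm W) = ennreal TW" using f2 by (rule ennreal_finiteE)
  have b': "0 \<le> b'" using L(2-4) by linarith
  have \<beta>': "0 \<le> \<beta>'" using L'(2-4) by linarith
  \<comment> \<open>The modular of f / \<sigma> + E^(-t) in L^p(\<sigma>): at most 1 from f,
    T\<sigma> from the tail, and 2^b' from splitting the power of a sum. \<open>A2\<close> arises in
    the same way for \<Phi> / W in L^p'(W).\<close>
  define A where "A = 2 powr b' * (1 + T\<sigma>)"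
  have A: "1 \<le> A"
    unfolding A_def using mult_mono[of 1 "2 powr b'" 1 "1 + T\<sigma>"] T\<sigma>(1) ge_one_powr_ge_zero[OF _ b', of 2] by simp
  obtain K\<sigma> where K\<sigma>: "0 \<le> K\<sigma>" "\<And>I g. family I \<Longrightarrow> g \<in> borel_measurable M \<Longrightarrow> (\<forall>y\<in>space M. 0 \<le> g y) \<Longrightarrow>
     (\<integral>\<^sup>+y. ennreal (g y powr p y) \<partial>wm \<sigma>) \<le> ennreal A \<Longrightarrow>
     (\<integral>\<^sup>+y. ennreal (MF (wm \<sigma>) I g y powr p y) \<partial>wm \<sigma>) \<le> ennreal K\<sigma>"
    using variable_maximal_bound[OF d\<sigma> lh, of A] by blast
  define A2 where "A2 = 2 powr \<beta>' * (K\<sigma> + T\<sigma>)"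
  have A2: "0 \<le> A2" unfolding A2_def using K\<sigma>(1) T\<sigma>(1) by simp
  obtain KW where KW: "0 \<le> KW" "\<And>I g. family I \<Longrightarrow> g \<in> borel_measurable M \<Longrightarrow> (\<forall>y\<in>space M. 0 \<le> g y) \<Longrightarrow>
     (\<integral>\<^sup>+y. ennreal (g y powr p' y) \<partial>wm W) \<le> ennreal A2 \<Longrightarrow>
     (\<integral>\<^sup>+y. ennreal (MF (wm W) I g y powr p' y) \<partial>wm W) \<le> ennreal KW"
    using variable_maximal_bound[OF dW lh', of A2] by blast
  obtain Kb where Kb: "0 \<le> Kb" "\<And>g f \<Phi> c r x h. g \<in> borel_measurable M \<Longrightarrow> f \<in> borel_measurable M \<Longrightarrow> \<Phi> \<in> borel_measurable M \<Longrightarrow> c \<in> space M \<Longrightarrow> 0 < r \<Longrightarrow> x \<in> B c r \<Longrightarrow>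
     (\<forall>y\<in>space M. E y powr (- t) \<le> g y \<and> 0 \<le> f y \<and> f y \<le> g y * \<sigma> y) \<Longrightarrow>
     (\<integral>\<^sup>+y. ennreal (g y powr p y) \<partial>wm \<sigma>) \<le> ennreal A \<Longrightarrow>
     (\<forall>y\<in>B c r. avg (wm \<sigma>) (B c r) g powr (p y - 1) + E y powr (- t) \<le> \<Phi> y) \<Longrightarrow>
     (\<integral>\<^sup>+y\<in>B c r. ennreal (\<Phi> y / W y) \<partial>wm W) < \<infinity> \<Longrightarrow>
     avg (wm W) (B c r) (\<lambda>y. \<Phi> y / W y) \<le> h \<Longrightarrow>
     (\<integral>\<^sup>+y\<in>B c r. ennreal (f y) \<partial>M) < \<infinity> \<and>
     avg M (B c r) f powr p x \<le> Kb * (h powr p' x + E x powr (- t))"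
    using ball_estimate[OF A t] by blast
  define K where "K = Kb * (KW + TW)"
  have K: "0 \<le> K" unfolding K_def using Kb(1) KW(1) TW(1) by simp
  have "(\<forall>(c,r)\<in>I. (\<integral>\<^sup>+y\<in>B c r. ennreal (f y) \<partial>M) < \<infinity>) \<and>
     (\<integral>\<^sup>+y. ennreal (MF M I f y powr p y) \<partial>wm W) \<le> ennreal K"
    if I: "family I" and [measurable]: "f \<in> borel_measurable M" and f0: "\<forall>y\<in>space M. 0 \<le> f y"
      and f1: "(\<integral>\<^sup>+y. ennreal (f y powr p y) \<partial>wm W) \<le> 1" for I f
  proof -
    define g where "g y = f y / \<sigma> y + E y powr (- t)" for y
    have gm [measurable]: "g \<in> borel_measurable M" unfolding g_def[abs_def] by measurable
    have g0: "\<forall>y\<in>space M. 0 \<le> g y" unfolding g_def using f0 S(4) by (auto simp: less_imp_le)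
    have gA: "(\<integral>\<^sup>+y. ennreal (g y powr p y) \<partial>wm \<sigma>) \<le> ennreal A"
    proof -
      have "(\<integral>\<^sup>+y. ennreal (g y powr p y) \<partial>wm \<sigma>) = (\<integral>\<^sup>+y. ennreal (\<sigma> y) * ennreal (g y powr p y) \<partial>M)"
        by (rule nn_integral_wm) measurable
      also have "\<dots> \<le> (\<integral>\<^sup>+y. ennreal (2 powr b') * (ennreal (W y) * ennreal (f y powr p y) + ennreal (\<sigma> y) * ennreal (E y powr (- t))) \<partial>M)"
      proof (rule nn_integral_mono)
        fix y assume y: "y \<in> space M"
        have s: "0 < \<sigma> y" and py: "1 < p y" using S(4)[OF y] p_gt1[OF y] by auto
        have fy: "0 \<le> f y" using f0 y by blast
        have "g y powr p y \<le> 2 powr p y * ((f y / \<sigma> y) powr p y + (E y powr (- t)) powr p y)"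
          unfolding g_def using fy s py by (intro powr_add_le) auto
        also have "\<dots> \<le> 2 powr b' * ((f y / \<sigma> y) powr p y + E y powr (- t))"
        proof (intro mult_mono add_left_mono)
          show "2 powr p y \<le> 2 powr b'" using L(7)[OF y] by (intro powr_mono) auto
          show "(E y powr (- t)) powr p y \<le> E y powr (- t)"
            unfolding powr_powr using E_ge1[OF y] py t by (intro powr_mono) auto
        qed auto
        finally have "\<sigma> y * g y powr p y \<le> \<sigma> y * (2 powr b' * ((f y / \<sigma> y) powr p y + E y powr (- t)))"
          using s by (intro mult_left_mono) auto
        also have "\<dots> = 2 powr b' * (\<sigma> y * (f y / \<sigma> y) powr p y + \<sigma> y * E y powr (- t))" by (simp add: algebra_simps)
        \<comment> \<open>This is \<sigma>^(1-p) = W: division by \<sigma> carries the modular over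
          W to the modular over \<sigma>.\<close>
        also have "\<sigma> y * (f y / \<sigma> y) powr p y = W y * f y powr p y"
          using s \<sigma>_powr[OF y] by (simp add: powr_divide powr_diff field_simps)
        finally have "ennreal (\<sigma> y * g y powr p y) \<le> ennreal (2 powr b' * (W y * f y powr p y + \<sigma> y * E y powr (- t)))"
          by (rule ennreal_leI)
        then show "ennreal (\<sigma> y) * ennreal (g y powr p y)
           \<le> ennreal (2 powr b') * (ennreal (W y) * ennreal (f y powr p y) + ennreal (\<sigma> y) * ennreal (E y powr (- t)))"
          using s W(4)[OF y] by (simp add: ennreal_mult)
      qed
      also have "\<dots> = ennreal (2 powr b') * ((\<integral>\<^sup>+y. ennreal (f y powr p y) \<partial>wm W) + ennreal T\<sigma>)"
        unfolding T\<sigma>(2)[symmetric] by (subst nn_integral_cmult, simp, subst nn_integral_add, simp, simp, (subst nn_integral_wm, simp, simp)+) simp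
      also have "\<dots> \<le> ennreal (2 powr b') * (1 + ennreal T\<sigma>)" using f1 by (intro mult_left_mono add_right_mono) auto
      also have "\<dots> = ennreal A" unfolding A_def using T\<sigma>(1) by (simp add: ennreal_mult)
      finally show ?thesis .
    qed
    define G where "G = MF (wm \<sigma>) I g"
    have [measurable]: "G \<in> borel_measurable M" unfolding G_def by (rule MF_measurable[OF I])
    have G0: "0 \<le> G y" for y unfolding G_def by (rule MF_nonneg[OF I])
    have GK: "(\<integral>\<^sup>+y. ennreal (G y powr p y) \<partial>wm \<sigma>) \<le> ennreal K\<sigma>" unfolding G_def by (rule K\<sigma>(2)[OF I gm g0 gA])
    define \<Phi> where "\<Phi> y = G y powr (p y - 1) + E y powr (- t)" for y
    have \<Phi>m [measurable]: "\<Phi> \<in> borel_measurable M" unfolding \<Phi>_def[abs_def] by measurable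
    define \<phi> where "\<phi> y = \<Phi> y / W y" for y
    have \<phi>m [measurable]: "\<phi> \<in> borel_measurable M" unfolding \<phi>_def[abs_def] by measurable
    have \<phi>0: "\<forall>y\<in>space M. 0 \<le> \<phi> y" unfolding \<phi>_def \<Phi>_def using W(4) by (auto simp: less_imp_le)
    have \<phi>A: "(\<integral>\<^sup>+y. ennreal (\<phi> y powr p' y) \<partial>wm W) \<le> ennreal A2"
    proof -
      have "(\<integral>\<^sup>+y. ennreal (\<phi> y powr p' y) \<partial>wm W) = (\<integral>\<^sup>+y. ennreal (W y) * ennreal (\<phi> y powr p' y) \<partial>M)"
        by (rule nn_integral_wm) measurable
      also have "\<dots> \<le> (\<integral>\<^sup>+y. ennreal (2 powr \<beta>') * (ennreal (\<sigma> y) * ennreal (G y powr p y) + ennreal (\<sigma> y) * ennreal (E y powr (- t))) \<partial>M)"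
      proof (rule nn_integral_mono)
        fix y assume y: "y \<in> space M"
        have s: "0 < \<sigma> y" and w: "0 < W y" and p'y: "1 < p' y" using S(4)[OF y] W(4)[OF y] L'(2) L'(6)[OF y] by auto
        have "\<Phi> y powr p' y \<le> 2 powr p' y * ((G y powr (p y - 1)) powr p' y + (E y powr (- t)) powr p' y)"
          unfolding \<Phi>_def using p'y by (intro powr_add_le) auto
        also have "\<dots> \<le> 2 powr \<beta>' * (G y powr p y + E y powr (- t))"
        proof (intro mult_mono add_mono)
          show "2 powr p' y \<le> 2 powr \<beta>'" using L'(7)[OF y] by (intro powr_mono) auto
          show "(E y powr (- t)) powr p' y \<le> E y powr (- t)"
            unfolding powr_powr using E_ge1[OF y] p'y t by (intro powr_mono) auto
          show "(G y powr (p y - 1)) powr p' y \<le> G y powr p y" unfolding powr_powr p_conj[OF y] by simp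
        qed auto
        finally have 1: "\<sigma> y * \<Phi> y powr p' y \<le> \<sigma> y * (2 powr \<beta>' * (G y powr p y + E y powr (- t)))"
          using s by (intro mult_left_mono) auto
        \<comment> \<open>The dual identity W^(1-p') = \<sigma>. Together with (p-1) p' = p it turns
          the modular of G^(p-1) / W into that of G over \<sigma>.\<close>
        have "W y * \<phi> y powr p' y = \<sigma> y * \<Phi> y powr p' y"
          unfolding \<phi>_def W_powr[OF y, symmetric] using w by (simp add: powr_divide powr_diff)
        also note 1
        also have "\<sigma> y * (2 powr \<beta>' * (G y powr p y + E y powr (- t))) = 2 powr \<beta>' * (\<sigma> y * G y powr p y + \<sigma> y * E y powr (- t))"
          by (simp add: algebra_simps)
        finally have "ennreal (W y * \<phi> y powr p' y) \<le> ennreal (2 powr \<beta>' * (\<sigma> y * G y powr p y + \<sigma> y * E y powr (- t)))"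
          by (rule ennreal_leI)
        then show "ennreal (W y) * ennreal (\<phi> y powr p' y)
           \<le> ennreal (2 powr \<beta>') * (ennreal (\<sigma> y) * ennreal (G y powr p y) + ennreal (\<sigma> y) * ennreal (E y powr (- t)))"
          using s w by (simp add: ennreal_mult)
      qed
      also have "\<dots> = ennreal (2 powr \<beta>') * ((\<integral>\<^sup>+y. ennreal (G y powr p y) \<partial>wm \<sigma>) + ennreal T\<sigma>)"
        unfolding T\<sigma>(2)[symmetric] by (subst nn_integral_cmult, simp, subst nn_integral_add, simp, simp, (subst nn_integral_wm, simp, simp)+) simp
      also have "\<dots> \<le> ennreal (2 powr \<beta>') * (ennreal K\<sigma> + ennreal T\<sigma>)" using GK by (intro mult_left_mono add_right_mono) auto
      also have "\<dots> = ennreal A2" unfolding A2_def using K\<sigma>(1) T\<sigma>(1) by (simp add: ennreal_mult)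
      finally show ?thesis .
    qed
    define H where "H = MF (wm W) I \<phi>"
    have [measurable]: "H \<in> borel_measurable M" unfolding H_def by (rule MF_measurable[OF I])
    have HK: "(\<integral>\<^sup>+y. ennreal (H y powr p' y) \<partial>wm W) \<le> ennreal KW" unfolding H_def by (rule KW(2)[OF I \<phi>m \<phi>0 \<phi>A])
    \<comment> \<open>The average over a ball of the family is at most the maximal function at every
      point of that ball; this is used for \<open>G\<close> on the whole ball and for
      \<open>H\<close> at x.\<close>
    have est: "(\<integral>\<^sup>+y\<in>B c r. ennreal (f y) \<partial>M) < \<infinity> \<and> avg M (B c r) f powr p x \<le> Kb * (H x powr p' x + E x powr (- t))"
      if cr: "(c,r) \<in> I" and x: "x \<in> B c r" for c r x
    proof -
      have c: "c \<in> space M" and r: "0 < r" using cr I by (auto simp: family_def)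
      show ?thesis
      proof (rule Kb(2)[of g f \<Phi> c r x "H x"])
        show "\<forall>y\<in>space M. E y powr - t \<le> g y \<and> 0 \<le> f y \<and> f y \<le> g y * \<sigma> y"
        proof (intro ballI conjI)
          fix y assume y: "y \<in> space M"
          have s: "0 < \<sigma> y" by (rule S(4)[OF y])
          show "0 \<le> f y" using f0 y by blast
          then show "E y powr - t \<le> g y" using s by (simp add: g_def)
          show "f y \<le> g y * \<sigma> y" using s by (simp add: g_def distrib_right)
        qed
        show "\<forall>y\<in>B c r. avg (wm \<sigma>) (B c r) g powr (p y - 1) + E y powr - t \<le> \<Phi> y"
        proof
          fix y assume y: "y \<in> B c r"
          then have "1 < p y" using p_gt1 by (simp add: ball_iff)
          then show "avg (wm \<sigma>) (B c r) g powr (p y - 1) + E y powr - t \<le> \<Phi> y"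
            unfolding \<Phi>_def G_def using MF_ge[OF I cr y] by (intro add_right_mono powr_mono2) auto
        qed
        show "(\<integral>\<^sup>+y\<in>B c r. ennreal (\<Phi> y / W y) \<partial>wm W) < \<infinity>"
          unfolding \<phi>_def[symmetric]
        proof (rule ball_mean_bounds(1)[OF dW c r \<phi>m L'(1) _ _ A2 \<phi>A])
          show "0 \<le> \<phi> y" "1 \<le> p' y" if "y \<in> space M" for y using \<phi>0 that L'(2) L'(6)[OF that] by auto
        qed
        show "avg (wm W) (B c r) (\<lambda>y. \<Phi> y / W y) \<le> H x"
          unfolding \<phi>_def[symmetric] H_def by (rule MF_ge[OF I cr x])
      qed (use c r x gA in auto)
    qed
    have pw: "MF M I f x powr p x \<le> Kb * (H x powr p' x + E x powr (- t))" if "x \<in> space M" for x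
      using MF_cases[OF I, of M f x] est Kb(1) by auto
    note [measurable] = MF_measurable[OF I]
    have "(\<integral>\<^sup>+y. ennreal (MF M I f y powr p y) \<partial>wm W) \<le> (\<integral>\<^sup>+y. ennreal Kb * (ennreal (H y powr p' y) + ennreal (E y powr (- t))) \<partial>wm W)"
    proof (rule nn_integral_mono)
      fix y assume "y \<in> space (wm W)"
      then have "ennreal (MF M I f y powr p y) \<le> ennreal (Kb * (H y powr p' y + E y powr (- t)))" using pw by (intro ennreal_leI) auto
      then show "ennreal (MF M I f y powr p y) \<le> ennreal Kb * (ennreal (H y powr p' y) + ennreal (E y powr (- t)))"
        using Kb(1) by (simp add: ennreal_mult)
    qed
    also have "\<dots> = ennreal Kb * ((\<integral>\<^sup>+y. ennreal (H y powr p' y) \<partial>wm W) + ennreal TW)"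
      unfolding TW(2)[symmetric] by (subst nn_integral_cmult, simp, subst nn_integral_add) auto
    also have "\<dots> \<le> ennreal Kb * (ennreal KW + ennreal TW)" using HK by (intro mult_left_mono add_right_mono) auto
    also have "\<dots> = ennreal K" unfolding K_def using Kb(1) KW(1) TW(1) by (simp add: ennreal_mult)
    finally have bound: "(\<integral>\<^sup>+y. ennreal (MF M I f y powr p y) \<partial>wm W) \<le> ennreal K" .
    have "\<forall>(c,r)\<in>I. (\<integral>\<^sup>+y\<in>B c r. ennreal (f y) \<partial>M) < \<infinity>"
    proof clarify
      fix c r assume cr: "(c,r) \<in> I"
      then have "c \<in> space M" "0 < r" using I by (auto simp: family_def)
      then show "(\<integral>\<^sup>+y\<in>B c r. ennreal (f y) \<partial>M) < \<infinity>" using est[OF cr ball_center] by blast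
    qed
    then show ?thesis using bound by blast
  qed
  then show ?thesis using K by blast
qed

end

section \<open>Passage to all balls\<close>

lemma epow_ennreal: "0 \<le> u \<Longrightarrow> epow (ennreal u) r = ennreal (u powr r)"
  by (simp add: epow_def)

lemma epow_mono:
  assumes "a \<le> b" "0 \<le> r"
  shows "epow a r \<le> epow b r"
proof (cases "b = \<infinity>")
  case False
  then have "b < \<infinity>" by (simp add: less_top)
  moreover have "a < \<infinity>" using assms(1) \<open>b < \<infinity>\<close> by (rule le_less_trans)
  ultimately obtain u v where "0 \<le> u" "a = ennreal u" "0 \<le> v" "b = ennreal v" by (meson ennreal_finiteE)
  then show ?thesis using assms by (auto simp: epow_ennreal intro!: ennreal_leI powr_mono2)
qed (simp add: epow_def)

context quasi_metric_measurable
begin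

section \<open>Finite nets and a countable dominating family of balls\<close>

text \<open>A \<rho>-separated set of maximal cardinality is a net. Cardinalities are bounded by
  packing: disjoint small balls about its points each carry a fixed fraction of the measure of one
  large ball.\<close>

lemma finite_net:
  assumes dbl: "doubling M D" and \<rho>: "0 < \<rho>" and R: "0 < R"
  shows "\<exists>S. finite S \<and> S \<subseteq> B x0 R \<and> (\<forall>x\<in>B x0 R. \<exists>s\<in>S. d s x < \<rho>)"
proof -
  note Dd = doublingD[OF dbl]
  define sep where "sep T \<longleftrightarrow> finite T \<and> T \<subseteq> B x0 R \<and> (\<forall>s\<in>T. \<forall>s'\<in>T. s \<noteq> s' \<longrightarrow> \<rho> \<le> d s s')" for T
  define R1 where "R1 = A0 * (R + \<rho>)"
  \<comment> \<open>Half the separation divided by A0, so that \<epsilon>-balls about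
    \<rho>-separated points are disjoint in a quasi-metric.\<close>
  define \<epsilon> where "\<epsilon> = \<rho> / (2 * A0)"
  have \<epsilon>: "0 < \<epsilon>" "\<epsilon> \<le> \<rho>" using \<rho> A0 by (auto simp: \<epsilon>_def field_simps)
  have R1: "0 < R1" unfolding R1_def using A0 R \<rho> by simp
  obtain k :: nat where k: "A0 * (R + R1) / \<epsilon> < 2 ^ k" using real_arch_pow[of 2] by auto
  define V where "V = measure M (B x0 R1)"
  have V: "0 < V" unfolding V_def by (rule Dd(6)[OF x0 R1])
  have card_le: "real (card T) \<le> D ^ k" if T: "sep T" for T
  proof -
    have TX: "s \<in> space M" "d x0 s < R" if "s \<in> T" for s using that T by (auto simp: sep_def ball_iff)
    have lower: "V / D ^ k \<le> measure M (B s \<epsilon>)" if s: "s \<in> T" for s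
    proof -
      have "B x0 R1 \<subseteq> B s (2 ^ k * \<epsilon>)"
      proof (rule ball_subset[OF TX(1)[OF s] x0])
        have "A0 * (d s x0 + R1) \<le> A0 * (R + R1)" using TX[OF s] A0 d_sym[of s x0] by (intro mult_left_mono) auto
        also have "\<dots> \<le> 2 ^ k * \<epsilon>" using k \<epsilon> by (simp add: field_simps)
        finally show "A0 * (d s x0 + R1) \<le> 2 ^ k * \<epsilon>" .
      qed
      moreover have "0 < 2 ^ k * \<epsilon>" using \<epsilon> by simp
      ultimately have "V \<le> measure M (B s (2 ^ k * \<epsilon>))" unfolding V_def
        using Dd(5,9)[OF TX(1)[OF s]] Dd(9)[OF x0 R1] by (intro measure_mono_fmeasurable) (auto simp: fmeasurable_def)
      also have "\<dots> \<le> D ^ k * measure M (B s \<epsilon>)"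
        using doubling_iterate[of "\<lambda>c r. measure M (B c r)" D s \<epsilon> k] Dd(2,8) TX(1)[OF s] \<epsilon> by simp
      finally show ?thesis using Dd(2) by (simp add: field_simps)
    qed
    have disj: "disjoint_family_on (\<lambda>s. B s \<epsilon>) T"
    proof (unfold disjoint_family_on_def, intro ballI impI)
      fix s s' assume s: "s \<in> T" "s' \<in> T" "s \<noteq> s'"
      show "B s \<epsilon> \<inter> B s' \<epsilon> = {}"
      proof (rule ccontr)
        assume "\<not> ?thesis"
        then obtain y where y: "y \<in> space M" "d s y < \<epsilon>" "d s' y < \<epsilon>" by (auto simp: ball_iff)
        have "d s s' \<le> A0 * (d s y + d y s')" by (rule d_tri) (use TX s y in auto)
        also have "\<dots> < A0 * (\<epsilon> + \<epsilon>)" using y TX[OF s(2)] A0 d_sym[of y s'] by (intro mult_strict_left_mono) auto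
        also have "\<dots> = \<rho>" using A0 by (simp add: \<epsilon>_def)
        finally have "d s s' < \<rho>" .
        moreover have "\<rho> \<le> d s s'" using T s unfolding sep_def by blast
        ultimately show False by linarith
      qed
    qed
    have sub: "B s \<epsilon> \<subseteq> B x0 R1" if s: "s \<in> T" for s
      by (rule ball_subset[OF x0 TX(1)[OF s]], unfold R1_def, rule mult_left_mono) (use TX[OF s] \<epsilon> A0 in auto)
    have "real (card T) * (V / D ^ k) \<le> (\<Sum>s\<in>T. measure M (B s \<epsilon>))"
      using sum_bounded_below[of T "V / D ^ k" "\<lambda>s. measure M (B s \<epsilon>)"] lower by simp
    also have "\<dots> = measure M (\<Union>s\<in>T. B s \<epsilon>)"
    proof (rule measure_finite_Union[symmetric])
      show "finite T" using T by (simp add: sep_def)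
      show "(\<lambda>s. B s \<epsilon>) ` T \<subseteq> sets M" using TX ball_sets \<epsilon> by auto
      show "emeasure M (B s \<epsilon>) \<noteq> \<infinity>" if "s \<in> T" for s using Dd(5)[OF TX(1)[OF that] \<epsilon>(1)] by simp
    qed (rule disj)
    also have "\<dots> \<le> V" unfolding V_def
    proof (rule measure_mono_fmeasurable)
      show "(\<Union>s\<in>T. B s \<epsilon>) \<subseteq> B x0 R1" using sub by blast
      show "(\<Union>s\<in>T. B s \<epsilon>) \<in> sets M" using T TX ball_sets \<epsilon> by (intro sets.finite_UN) (auto simp: sep_def)
      show "B x0 R1 \<in> fmeasurable M" using Dd(5,9)[OF x0 R1] by (auto simp: fmeasurable_def)
    qed
    finally show ?thesis using V Dd(2) by (simp add: field_simps)
  qed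
  obtain N :: nat where N: "D ^ k < real N" using reals_Archimedean2 by blast
  have "\<exists>T. sep T \<and> (\<forall>T'. sep T' \<longrightarrow> card T' \<le> card T)"
  proof (rule ex_has_greatest_nat)
    show "sep {}" by (simp add: sep_def)
    show "\<forall>T. sep T \<longrightarrow> card T < N"
    proof (intro allI impI)
      fix T assume "sep T"
      then have "real (card T) < real N" using card_le N by (meson le_less_trans)
      then show "card T < N" by simp
    qed
  qed
  then obtain T where T: "sep T" "\<And>T'. sep T' \<Longrightarrow> card T' \<le> card T" by blast
  have "\<exists>s\<in>T. d s x < \<rho>" if x: "x \<in> B x0 R" for x
  proof (rule ccontr)
    assume "\<not> ?thesis"
    then have far: "\<rho> \<le> d s x" if "s \<in> T" for s using that by force
    have xX: "x \<in> space M" using x by (simp add: ball_iff)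
    have TX: "s \<in> space M" if "s \<in> T" for s using that T(1) by (auto simp: sep_def ball_iff)
    have "x \<notin> T" using far[of x] d_zero[OF xX xX] \<rho> by auto
    moreover have "sep (insert x T)"
      using T(1) x far d_sym[OF xX TX] unfolding sep_def by auto
    ultimately show False using T(2)[of "insert x T"] T(1) by (simp add: sep_def)
  qed
  then show ?thesis using T(1) by (auto simp: sep_def)
qed

text \<open>Centres from a countable dense set and rational radii strictly between 2 A0 r and 3 A0
  r. The lower limit makes the new ball contain the given one once its centre is within r, the upper
  limit keeps it inside a fixed dilate.\<close>

lemma countable_dominating_balls:
  assumes dbl: "doubling M D"
  shows "\<exists>J K. countable J \<and> J \<noteq> {} \<and> J \<subseteq> space M \<times> {0<..} \<and> 1 \<le> K \<and>
    (\<forall>c\<in>space M. \<forall>r>0. \<exists>(c',r')\<in>J. B c r \<subseteq> B c' r' \<and> measure M (B c' r') \<le> K * measure M (B c r))"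
proof -
  note Dd = doublingD[OF dbl]
  have "\<forall>k n::nat. \<exists>S. finite S \<and> S \<subseteq> B x0 (real n + 1) \<and> (\<forall>x\<in>B x0 (real n + 1). \<exists>s\<in>S. d s x < 1 / (real k + 1))"
    by (intro allI finite_net[OF dbl]) auto
  then obtain S where S: "\<And>k n. finite (S k n)" "\<And>k n. S k n \<subseteq> B x0 (real n + 1)"
    "\<And>k n x. x \<in> B x0 (real n + 1) \<Longrightarrow> \<exists>s\<in>S k n. d s x < 1 / (real k + 1)" by metis
  define Q where "Q = (\<Union>k n. S k n)"
  have Q: "countable Q" unfolding Q_def by (intro countable_UN countableI_type countable_finite[OF S(1)])
  have QX: "Q \<subseteq> space M" using S(2) unfolding Q_def qball_def by blast
  define J where "J = Q \<times> (\<rat> \<inter> {0::real<..})"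
  have J: "countable J" unfolding J_def using Q countable_rat by (intro countable_SIGMA countable_Int1) auto
  obtain k :: nat where k: "A0 * (1 + 3 * A0) < 2 ^ k" using real_arch_pow[of 2] by auto
  have dom: "\<exists>(c',r')\<in>J. B c r \<subseteq> B c' r' \<and> measure M (B c' r') \<le> D ^ k * measure M (B c r)"
    if c: "c \<in> space M" and r: "0 < r" for c r
  proof -
    obtain n :: nat where "d x0 c < real n" using reals_Archimedean2 by blast
    then have "c \<in> B x0 (real n + 1)" using c by (simp add: ball_iff)
    moreover obtain j :: nat where j: "1 / (real j + 1) < r" using reals_Archimedean[OF r] by (auto simp: inverse_eq_divide add.commute)
    ultimately obtain s where s: "s \<in> S j n" "d s c < r" using S(3)[of c n j] by fastforce
    have sQ: "s \<in> Q" "s \<in> space M" using s QX by (auto simp: Q_def)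
    have "2 * A0 * r < 3 * A0 * r" using r A0 by simp
    then obtain q where q: "q \<in> \<rat>" "2 * A0 * r < q" "q < 3 * A0 * r" using Rats_dense_in_real by blast
    have q0: "0 < q" using q r A0 by (smt (verit) mult_pos_pos)
    have "(s, q) \<in> J" using sQ q q0 by (simp add: J_def)
    moreover have "B c r \<subseteq> B s q"
    proof (rule ball_subset[OF sQ(2) c])
      have "A0 * (d s c + r) \<le> A0 * (r + r)" using s A0 by (intro mult_left_mono) auto
      then show "A0 * (d s c + r) \<le> q" using q by simp
    qed
    moreover have "measure M (B s q) \<le> D ^ k * measure M (B c r)"
    proof -
      have "B s q \<subseteq> B c (2 ^ k * r)"
      proof (rule ball_subset[OF c sQ(2)])
        have "A0 * (d c s + q) \<le> A0 * (r + 3 * A0 * r)" using s q A0 d_sym[OF c sQ(2)] by (intro mult_left_mono) auto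
        also have "\<dots> = A0 * (1 + 3 * A0) * r" by (simp add: algebra_simps)
        also have "\<dots> \<le> 2 ^ k * r" using k r by (intro mult_right_mono) auto
        finally show "A0 * (d c s + q) \<le> 2 ^ k * r" .
      qed
      moreover have "0 < 2 ^ k * r" using r by simp
      ultimately have "measure M (B s q) \<le> measure M (B c (2 ^ k * r))"
        using Dd(5,9)[OF c] Dd(9)[OF sQ(2) q0] by (intro measure_mono_fmeasurable) (auto simp: fmeasurable_def)
      also have "\<dots> \<le> D ^ k * measure M (B c r)"
        using doubling_iterate[of "\<lambda>c r. measure M (B c r)" D c r k] Dd(2,8) c r by simp
      finally show ?thesis .
    qed
    ultimately show ?thesis by blast
  qed
  moreover have "J \<noteq> {}" using dom[OF x0, of 1] by auto
  moreover have "J \<subseteq> space M \<times> {0<..}" using QX by (auto simp: J_def)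
  moreover have "1 \<le> D ^ k" using Dd(2) by simp
  ultimately show ?thesis using J by blast
qed

lemma MF_subset:
  assumes "family I" "family I'" "I \<subseteq> I'"
  shows "MF \<nu> I g x \<le> MF \<nu> I' g x"
  unfolding MF_def using assms by (intro Max_mono) (auto simp: family_def)

lemma maxf_le:
  assumes dbl: "doubling M D" and K: "1 \<le> K" and z: "0 \<le> z"
    and dom: "\<And>c r. c \<in> space M \<Longrightarrow> 0 < r \<Longrightarrow> \<exists>(c',r')\<in>J. B c r \<subseteq> B c' r' \<and> measure M (B c' r') \<le> K * measure M (B c r)"
    and J: "J \<subseteq> space M \<times> {0<..}" and fin: "\<And>c r. (c,r) \<in> J \<Longrightarrow> (\<integral>\<^sup>+y\<in>B c r. ennreal \<bar>f y\<bar> \<partial>M) < \<infinity>"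
    and bound: "\<And>c r. (c,r) \<in> J \<Longrightarrow> x \<in> B c r \<Longrightarrow> avg M (B c r) (\<lambda>y. \<bar>f y\<bar>) \<le> z"
  shows "maxf d M f x \<le> ennreal (K * z)"
  unfolding maxf_def
proof (rule SUP_least)
  fix A assume "A \<in> {A \<in> qballs (space M) d. x \<in> A}"
  then obtain c r where A: "A = B c r" "c \<in> space M" "0 < r" "x \<in> B c r" by (auto simp: qballs_def)
  note Dd = doublingD[OF dbl]
  obtain c' r' where cr: "(c',r') \<in> J" "B c r \<subseteq> B c' r'" "measure M (B c' r') \<le> K * measure M (B c r)" using dom A by blast
  have c': "c' \<in> space M" "0 < r'" using cr J by auto
  have V: "0 < measure M (B c r)" "emeasure M (B c r) = ennreal (measure M (B c r))" using Dd(6,7) A by auto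
  have "(\<integral>\<^sup>+y\<in>A. ennreal \<bar>f y\<bar> \<partial>M) \<le> (\<integral>\<^sup>+y\<in>B c' r'. ennreal \<bar>f y\<bar> \<partial>M)"
    unfolding A by (intro nn_integral_mono) (use cr in \<open>auto simp: indicator_def\<close>)
  also have "\<dots> = ennreal (avg M (B c' r') (\<lambda>y. \<bar>f y\<bar>) * measure M (B c' r'))"
    by (rule avg_eq_integral) (use Dd(4,5) c' fin cr in auto)
  also have "\<dots> \<le> ennreal (z * (K * measure M (B c r)))"
    using bound[OF cr(1)] cr A z by (intro ennreal_leI mult_mono) auto
  also have "\<dots> = ennreal (K * z) * emeasure M A" unfolding A V(2) using K z by (subst ennreal_mult[symmetric]) (auto simp: mult_ac)
  finally show "(\<integral>\<^sup>+y\<in>A. ennreal \<bar>f y\<bar> \<partial>M) / emeasure M A \<le> ennreal (K * z)"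
    using V A by (intro divide_le_posI_ennreal) (auto simp: mult.commute)
qed

end

context muckenhoupt_pair
begin

text \<open>Finite subfamilies \<open>I n\<close> exhaust the countable family, and the bounds for
  them are uniform, so monotone convergence applies to the measurable integrands. Enlarging an
  arbitrary ball to a member of the family costs \<open>Kc\<close>, hence Kc^b' in the
  modular.\<close>

theorem maxf_modular_bound:
  assumes w: "\<And>x. x \<in> space M \<Longrightarrow> 0 < w x" "\<And>x. x \<in> space M \<Longrightarrow> W x = w x powr p x"
  shows "\<exists>K\<ge>1. \<forall>f\<in>borel_measurable M. (\<integral>\<^sup>+x. ennreal ((\<bar>f x\<bar> * w x) powr p x) \<partial>M) \<le> 1 \<longrightarrow>
     (\<exists>U\<in>borel_measurable M. (\<forall>x\<in>space M. epow (maxf d M f x * ennreal (w x)) (p x) \<le> U x) \<and> (\<integral>\<^sup>+x. U x \<partial>M) \<le> ennreal K)"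
proof -
  obtain K0 where K0: "0 \<le> K0" "\<And>I f. family I \<Longrightarrow> f \<in> borel_measurable M \<Longrightarrow> (\<forall>y\<in>space M. 0 \<le> f y) \<Longrightarrow>
     (\<integral>\<^sup>+y. ennreal (f y powr p y) \<partial>wm W) \<le> 1 \<Longrightarrow>
     (\<forall>(c,r)\<in>I. (\<integral>\<^sup>+y\<in>B c r. ennreal (f y) \<partial>M) < \<infinity>) \<and>
     (\<integral>\<^sup>+y. ennreal (MF M I f y powr p y) \<partial>wm W) \<le> ennreal K0"
    using weighted_maximal_bound by blast
  obtain J Kc where J: "countable J" "J \<noteq> {}" "J \<subseteq> space M \<times> {0<..}" and Kc: "1 \<le> Kc"
    and dom: "\<And>c r. c \<in> space M \<Longrightarrow> 0 < r \<Longrightarrow> \<exists>(c',r')\<in>J. B c r \<subseteq> B c' r' \<and> measure M (B c' r') \<le> Kc * measure M (B c r)"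
    using countable_dominating_balls[OF dbl] by blast
  define I where "I n = from_nat_into J ` {..n}" for n :: nat
  have IJ: "I n \<subseteq> J" for n unfolding I_def using from_nat_into[OF J(2)] by auto
  have fam: "family (I n)" for n using IJ[of n] J(3) by (auto simp: family_def I_def)
  have JI: "\<exists>n. i \<in> I n" if "i \<in> J" for i
    using from_nat_into_surj[OF J(1) that] by (auto simp: I_def)
  have b': "0 \<le> b'" using L(2-4) by linarith
  define K where "K = max 1 (Kc powr b' * K0)"
  have "\<exists>U\<in>borel_measurable M. (\<forall>x\<in>space M. epow (maxf d M f x * ennreal (w x)) (p x) \<le> U x) \<and> (\<integral>\<^sup>+x. U x \<partial>M) \<le> ennreal K"
    if [measurable]: "f \<in> borel_measurable M" and f1: "(\<integral>\<^sup>+x. ennreal ((\<bar>f x\<bar> * w x) powr p x) \<partial>M) \<le> 1" for f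
  proof -
    let ?f = "\<lambda>y. \<bar>f y\<bar>"
    have "(\<integral>\<^sup>+y. ennreal (?f y powr p y) \<partial>wm W) = (\<integral>\<^sup>+y. ennreal (W y) * ennreal (?f y powr p y) \<partial>M)"
      by (rule nn_integral_wm) measurable
    also have "\<dots> = (\<integral>\<^sup>+x. ennreal ((\<bar>f x\<bar> * w x) powr p x) \<partial>M)"
      using w by (intro nn_integral_cong) (simp add: powr_mult ennreal_mult mult.commute)
    finally have fW: "(\<integral>\<^sup>+y. ennreal (?f y powr p y) \<partial>wm W) \<le> 1" using f1 by simp
    have fin: "(\<integral>\<^sup>+y\<in>B c r. ennreal \<bar>f y\<bar> \<partial>M) < \<infinity>" if cr: "(c,r) \<in> J" for c r
    proof -
      obtain n where "(c,r) \<in> I n" using JI[OF cr] by blast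
      then show ?thesis using K0(2)[OF fam[of n], of ?f] fW by auto
    qed
    define u where "u n x = MF M (I n) ?f x" for n x
    have um [measurable]: "u n \<in> borel_measurable M" for n unfolding u_def[abs_def] by (rule MF_measurable[OF fam])
    have u0: "0 \<le> u n x" for n x unfolding u_def by (rule MF_nonneg[OF fam])
    have umono: "u m x \<le> u n x" if "m \<le> n" for m n x
      unfolding u_def by (rule MF_subset[OF fam fam]) (use that in \<open>auto simp: I_def\<close>)
    \<comment> \<open>A measurable limit that dominates the possibly non-measurable function, up to
      the factor Kc^b'.\<close>
    define U where "U x = (SUP n. ennreal (W x) * ennreal (u n x powr p x))" for x
    have "(\<integral>\<^sup>+x. U x \<partial>M) = (SUP n. (\<integral>\<^sup>+x. ennreal (W x) * ennreal (u n x powr p x) \<partial>M))"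
      unfolding U_def
    proof (rule nn_integral_monotone_convergence_SUP_AE)
      fix n
      show "AE x in M. ennreal (W x) * ennreal (u n x powr p x) \<le> ennreal (W x) * ennreal (u (Suc n) x powr p x)"
      proof (rule AE_I2)
        fix x assume "x \<in> space M"
        then have "1 < p x" by (rule p_gt1)
        then show "ennreal (W x) * ennreal (u n x powr p x) \<le> ennreal (W x) * ennreal (u (Suc n) x powr p x)"
          using umono[of n "Suc n" x] u0 by (intro mult_left_mono ennreal_leI powr_mono2) auto
      qed
    qed measurable
    also have "\<dots> \<le> ennreal K0"
    proof (rule SUP_least)
      fix n
      have "(\<integral>\<^sup>+x. ennreal (W x) * ennreal (u n x powr p x) \<partial>M) = (\<integral>\<^sup>+x. ennreal (u n x powr p x) \<partial>wm W)"
        by (rule nn_integral_wm[symmetric]) measurable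
      also have "\<dots> \<le> ennreal K0" unfolding u_def using K0(2)[OF fam[of n], of ?f] fW by auto
      finally show "(\<integral>\<^sup>+x. ennreal (W x) * ennreal (u n x powr p x) \<partial>M) \<le> ennreal K0" .
    qed
    finally have UK: "(\<integral>\<^sup>+x. U x \<partial>M) \<le> ennreal K0" .
    have Um [measurable]: "U \<in> borel_measurable M" unfolding U_def[abs_def] by measurable
    have pw: "epow (maxf d M f x * ennreal (w x)) (p x) \<le> ennreal (Kc powr b') * U x" if x: "x \<in> space M" for x
    proof (cases "U x = \<infinity>")
      case True
      then show ?thesis using Kc by (simp add: ennreal_mult_top)
    next
      case False
      then have "U x < \<infinity>" by (simp add: less_top)
      then obtain v where v: "0 \<le> v" "U x = ennreal v" by (rule ennreal_finiteE)
      have px: "1 < p x" by (rule p_gt1[OF x])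
      have wx: "0 < w x" by (rule w(1)[OF x])
      \<comment> \<open>Solving W(x) z^p(x) = v for z: where \<open>U\<close> is finite, this bounds
        all averages over balls of the family through x.\<close>
      define z where "z = v powr (1 / p x) / w x"
      have z0: "0 \<le> z" using wx by (simp add: z_def)
      have uz: "u n x \<le> z" for n
      proof -
        have "ennreal (W x) * ennreal (u n x powr p x) \<le> U x" unfolding U_def by (rule SUP_upper) simp
        then have "ennreal (W x * u n x powr p x) \<le> ennreal v" using W(4)[OF x] by (simp add: v ennreal_mult)
        then have "(w x * u n x) powr p x \<le> v" using v(1) w(2)[OF x] by (simp add: powr_mult)
        then have "((w x * u n x) powr p x) powr (1 / p x) \<le> v powr (1 / p x)" using px by (intro powr_mono2) auto
        then have "w x * u n x \<le> v powr (1 / p x)" using px wx u0 by (simp add: powr_powr)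
        then show ?thesis using wx by (simp add: z_def field_simps)
      qed
      have "maxf d M f x \<le> ennreal (Kc * z)"
      proof (rule maxf_le[OF dbl Kc z0 dom J(3) fin])
        fix c r assume cr: "(c,r) \<in> J" "x \<in> B c r"
        then obtain n where "(c,r) \<in> I n" using JI by blast
        then have "avg M (B c r) ?f \<le> u n x" unfolding u_def by (intro MF_ge fam cr)
        then show "avg M (B c r) ?f \<le> z" using uz[of n] by simp
      qed
      then have "maxf d M f x * ennreal (w x) \<le> ennreal (Kc * z) * ennreal (w x)" by (rule mult_right_mono) simp
      also have "\<dots> = ennreal (Kc * v powr (1 / p x))"
        using wx Kc z0 by (subst ennreal_mult[symmetric]) (auto simp: z_def)
      finally have "epow (maxf d M f x * ennreal (w x)) (p x) \<le> epow (ennreal (Kc * v powr (1 / p x))) (p x)"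
        using px by (intro epow_mono) auto
      also have "\<dots> = ennreal (Kc powr p x * v)"
        using Kc v px by (subst epow_ennreal) (auto simp: powr_mult powr_powr)
      also have "\<dots> \<le> ennreal (Kc powr b' * v)"
        using Kc v L(7)[OF x] by (intro ennreal_leI mult_right_mono powr_mono) auto
      also have "\<dots> = ennreal (Kc powr b') * U x" using v by (simp add: ennreal_mult)
      finally show ?thesis .
    qed
    have "(\<integral>\<^sup>+x. ennreal (Kc powr b') * U x \<partial>M) = ennreal (Kc powr b') * (\<integral>\<^sup>+x. U x \<partial>M)" by (rule nn_integral_cmult) measurable
    also have "\<dots> \<le> ennreal (Kc powr b') * ennreal K0" by (intro mult_left_mono UK) simp
    also have "\<dots> = ennreal (Kc powr b' * K0)" using K0(1) by (intro ennreal_mult[symmetric]) auto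
    also have "\<dots> \<le> ennreal K" by (intro ennreal_leI) (simp add: K_def)
    finally have "(\<integral>\<^sup>+x. ennreal (Kc powr b') * U x \<partial>M) \<le> ennreal K" .
    then show ?thesis using pw by (intro bexI[of _ "\<lambda>x. ennreal (Kc powr b') * U x"]) auto
  qed
  moreover have "1 \<le> K" by (simp add: K_def)
  ultimately show ?thesis by blast
qed

end

section \<open>Luxemburg norms\<close>

lemma homogeneous_space_quasi_metric:
  assumes "homogeneous_space d M" and x0: "x0 \<in> space M"
  shows "\<exists>A0 D. quasi_metric_measurable M d A0 x0 \<and> quasi_metric_measurable.doubling M d M D"
proof -
  let ?X = "space M"
  have qm: "quasi_metric ?X d" and sM: "sets M = sigma_sets ?X (qballs ?X d \<union> {U. qopen ?X d U})"
    using assms by (auto simp: homogeneous_space_def)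
  obtain D where D: "1 \<le> D" "\<And>x r. x \<in> ?X \<Longrightarrow> 0 < r \<Longrightarrow> 0 < emeasure M (qball ?X d x (2 * r)) \<and>
        emeasure M (qball ?X d x (2 * r)) \<le> ennreal D * emeasure M (qball ?X d x r) \<and> emeasure M (qball ?X d x r) < \<infinity>"
  proof -
    have "\<exists>D\<ge>1. \<forall>x\<in>?X. \<forall>r>0. 0 < emeasure M (qball ?X d x (2 * r)) \<and>
        emeasure M (qball ?X d x (2 * r)) \<le> ennreal D * emeasure M (qball ?X d x r) \<and> emeasure M (qball ?X d x r) < \<infinity>"
      using assms(1) unfolding homogeneous_space_def by (elim conjE)
    then show thesis using that by blast
  qed
  have "\<exists>A0\<ge>1. \<forall>x\<in>?X. \<forall>y\<in>?X. \<forall>z\<in>?X. d x y \<le> A0 * (d x z + d z y)"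
    using qm unfolding quasi_metric_def by (elim conjE)
  then obtain A0 where A0: "1 \<le> A0" "\<forall>x\<in>?X. \<forall>y\<in>?X. \<forall>z\<in>?X. d x y \<le> A0 * (d x z + d z y)"
    by blast
  interpret quasi_metric_measurable M d A0 x0
  proof
    show "qball ?X d c r \<in> sets M" if "c \<in> ?X" "0 < r" for c r
      unfolding sM using that by (intro sigma_sets.Basic) (auto simp: qballs_def)
  qed (use A0 x0 qm in \<open>auto simp: quasi_metric_def\<close>)
  have "doubling M D"
    unfolding doubling_def
  proof (intro conjI ballI allI impI)
    fix c and r :: real assume c: "c \<in> ?X" and r: "0 < r"
    \<comment> \<open>The definition asserts positivity for doubled radii only, hence the detour
      through r/2.\<close>
    have "0 < emeasure M (B c (2 * (r / 2)))" using D(2)[OF c half_gt_zero[OF r]] by blast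
    then show "0 < emeasure M (B c r)" by simp
    show fin: "emeasure M (B c r) < \<infinity>" using D(2)[OF c r] by blast
    have fin2: "emeasure M (B c (2 * r)) < \<infinity>" using D(2)[OF c, of "2 * r"] r by simp
    have "ennreal (measure M (B c (2 * r))) = emeasure M (B c (2 * r))"
      using fin2 by (simp add: emeasure_eq_ennreal_measure)
    also have "\<dots> \<le> ennreal D * emeasure M (B c r)" using D(2)[OF c r] by blast
    also have "\<dots> = ennreal (D * measure M (B c r))"
      using fin D(1) by (simp add: emeasure_eq_ennreal_measure ennreal_mult)
    finally show "measure M (B c (2 * r)) \<le> D * measure M (B c r)"
      by (subst (asm) ennreal_le_iff) (use D(1) in auto)
  qed (use D in auto)
  then show ?thesis using quasi_metric_measurable_axioms by blast
qed

context quasi_metric_measurable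
begin

text \<open>The map u / (u - 1) is decreasing and Lipschitz with constant 1/(b-1)^2 on [b,
  \<infinity>), so both log-Hoelder conditions are inherited and the bounds are exchanged.\<close>

lemma log_holder_conj:
  assumes "log_holder P b b' Pinf C"
  shows "log_holder (\<lambda>y. P y / (P y - 1)) (b' / (b' - 1)) (b / (b - 1)) (Pinf / (Pinf - 1)) (C / (b - 1)\<^sup>2)"
proof -
  note L = log_holderD[OF assms]
  have b: "1 < b" by (rule L)
  have anti: "v / (v - 1) \<le> u / (u - 1)" if "1 < u" "u \<le> v" for u v :: real
    using that by (simp add: field_simps)
  have diff: "\<bar>u / (u - 1) - v / (v - 1)\<bar> \<le> \<bar>u - v\<bar> / (b - 1)\<^sup>2" if "b \<le> u" "b \<le> v" for u v
  proof -
    have "u / (u - 1) - v / (v - 1) = (v - u) / ((u - 1) * (v - 1))" using that b by (simp add: field_simps)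
    then have "\<bar>u / (u - 1) - v / (v - 1)\<bar> = \<bar>u - v\<bar> / ((u - 1) * (v - 1))" using that b by (simp add: abs_mult abs_minus_commute)
    also have "\<dots> \<le> \<bar>u - v\<bar> / (b - 1)\<^sup>2"
      using that b unfolding power2_eq_square by (intro divide_left_mono mult_mono mult_pos_pos) auto
    finally show ?thesis .
  qed
  have scale: "\<bar>u / (u - 1) - v / (v - 1)\<bar> * z \<le> C / (b - 1)\<^sup>2" if "b \<le> u" "b \<le> v" "\<bar>u - v\<bar> * z \<le> C" "0 \<le> z" for u v z
  proof -
    have "\<bar>u / (u - 1) - v / (v - 1)\<bar> * z \<le> \<bar>u - v\<bar> / (b - 1)\<^sup>2 * z" using diff that by (intro mult_right_mono) auto
    also have "\<dots> = \<bar>u - v\<bar> * z / (b - 1)\<^sup>2" by simp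
    also have "\<dots> \<le> C / (b - 1)\<^sup>2" using that by (intro divide_right_mono) auto
    finally show ?thesis .
  qed
  have [measurable]: "P \<in> borel_measurable M" by (rule L)
  show ?thesis
    unfolding log_holder_def
  proof (intro conjI ballI impI)
    show "1 < b' / (b' - 1)" using b L(3,4) by (simp add: field_simps)
    show "b' / (b' - 1) \<le> Pinf / (Pinf - 1)" "Pinf / (Pinf - 1) \<le> b / (b - 1)" using b L(3,4) by (auto intro!: anti)
    fix x assume x: "x \<in> space M"
    show "b' / (b' - 1) \<le> P x / (P x - 1)" "P x / (P x - 1) \<le> b / (b - 1)" using b L(6,7)[OF x] by (auto intro!: anti)
    show "\<bar>P x / (P x - 1) - Pinf / (Pinf - 1)\<bar> * ln (E x) \<le> C / (b - 1)\<^sup>2"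
      using L(3,6,8) x ln_E[OF x] by (intro scale) auto
    fix y assume y: "y \<in> space M" and "0 < d x y" "d x y < 1/2"
    then show "\<bar>P x / (P x - 1) - P y / (P y - 1)\<bar> * (- ln (d x y)) \<le> C / (b - 1)\<^sup>2"
      using L(6) L(10)[OF x y] x y by (intro scale) auto
  qed measurable
qed

end

text \<open>Essential bounds on p become bounds at every point: every ball has positive measure, so
  points where the bounds hold lie arbitrarily near, and local log-Hoelder continuity carries the
  bounds over. Finiteness of p at every point follows from its finite distance to the limit
  exponent.\<close>

lemma log_holder_exponent:
  assumes hs: "homogeneous_space d M" and ex: "exponent M p" and lh: "LH d (space M) p"
    and inf: "1 < ess_inf_exp M p" and sup: "ess_sup_exp M p < \<infinity>"
  shows "\<exists>A0 x0 D P b b' Pinf C. quasi_metric_measurable M d A0 x0 \<and> quasi_metric_measurable.doubling M d M D \<and>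
    quasi_metric_measurable.log_holder M d x0 P b b' Pinf C \<and> (\<forall>x\<in>space M. p x = ereal (P x))"
proof -
  obtain x0 Cinf pinf where x0: "x0 \<in> space M"
    and Li: "\<And>x. x \<in> space M \<Longrightarrow> \<bar>p x - ereal pinf\<bar> < ereal (Cinf / ln (exp 1 + d x x0))"
    using lh unfolding LH_def LHinf_def by blast
  obtain C0 where L0: "\<And>x y. x \<in> space M \<Longrightarrow> y \<in> space M \<Longrightarrow> 0 < d x y \<Longrightarrow> d x y < 1/2 \<Longrightarrow>
      \<bar>p x - p y\<bar> < ereal (- C0 / ln (d x y))"
    using lh unfolding LH_def LH0_def by blast
  obtain A0 D where loc: "quasi_metric_measurable M d A0 x0" and dbl: "quasi_metric_measurable.doubling M d M D"
    using homogeneous_space_quasi_metric[OF hs x0] by blast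
  interpret quasi_metric_measurable M d A0 x0 by fact
  note Dd = doublingD[OF dbl]
  define P where "P x = real_of_ereal (p x)" for x
  have pP: "p x = ereal (P x)" if x: "x \<in> space M" for x
    using Li[OF x] by (cases "p x") (auto simp: P_def)
  have Pm [measurable]: "P \<in> borel_measurable M" using ex unfolding exponent_def P_def[abs_def] by (intro borel_measurable_real_of_ereal) auto
  have Li': "\<bar>P x - pinf\<bar> < Cinf / ln (E x)" if x: "x \<in> space M" for x
    using Li[OF x] by (simp add: pP[OF x] E_def)
  have L0': "\<bar>P x - P y\<bar> < - C0 / ln (d x y)" if "x \<in> space M" "y \<in> space M" "0 < d x y" "d x y < 1/2" for x y
    using L0[OF that] by (simp add: pP that)
  obtain c where c: "1 < c" "AE x in M. c \<le> p x" using inf unfolding ess_inf_exp_def less_Sup_iff by blast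
  obtain b where b: "1 < ereal b" "ereal b < c" using ereal_dense2[OF c(1)] by blast
  obtain c' where c': "c' < \<infinity>" "AE x in M. p x \<le> c'" using sup unfolding ess_sup_exp_def Inf_less_iff by blast
  obtain b' where b': "c' < ereal b'" using ereal_dense2[OF c'(1)] by blast
  have AEb: "AE x in M. b \<le> P x \<and> P x \<le> b'"
    using c(2) c'(2) AE_space
  proof eventually_elim
    case (elim x)
    then have "ereal b < ereal (P x)" "ereal (P x) < ereal b'"
      using less_le_trans[OF b(2), of "p x"] le_less_trans[OF _ b', of "p x"] pP[of x] by auto
    then show ?case by simp
  qed
  have approx: "\<exists>y\<in>space M. b \<le> P y \<and> P y \<le> b' \<and> \<bar>P x - P y\<bar> < \<delta>" if x: "x \<in> space M" and \<delta>: "0 < \<delta>" for x \<delta>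
  proof -
    \<comment> \<open>Makes |C0| / (- ln d(x,y)) at most \<delta> whenever 0 < d(x,y) < r; the value
      1/4 keeps r inside the range of the local condition.\<close>
    define r where "r = min (1/4) (exp (- (\<bar>C0\<bar> / \<delta>)))"
    have r: "0 < r" "r < 1/2" by (auto simp: r_def)
    have "\<exists>y\<in>B x r. b \<le> P y \<and> P y \<le> b'"
    proof (rule ccontr)
      assume "\<not> ?thesis"
      then have none: "\<not> (b \<le> P y \<and> P y \<le> b')" if "y \<in> B x r" for y using that by blast
      have "AE y in M. y \<notin> B x r" using AEb by eventually_elim (use none in blast)
      moreover have "(AE y in M. y \<notin> B x r) \<longleftrightarrow> emeasure M (B x r) = 0"
        by (rule AE_iff_measurable[OF ball_sets[OF x r(1)]]) (auto simp: ball_iff)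
      ultimately have "emeasure M (B x r) = 0" by (rule iffD1[rotated])
      then show False using Dd(4)[OF x r(1)] by simp
    qed
    then obtain y where y: "y \<in> space M" "d x y < r" "b \<le> P y" "P y \<le> b'" by (auto simp: ball_iff)
    have "\<bar>P x - P y\<bar> < \<delta>"
    proof (cases "x = y")
      case False
      then have d0: "0 < d x y" using d_zero[OF x y(1)] d_nonneg[OF x y(1)] by linarith
      have "ln (d x y) \<le> ln (exp (- (\<bar>C0\<bar> / \<delta>)))" using y(2) d0 by (subst ln_le_cancel_iff) (auto simp: r_def)
      then have l: "\<bar>C0\<bar> / \<delta> \<le> - ln (d x y)" by simp
      have l0: "ln (d x y) < 0" using d0 y(2) r by simp
      have "- C0 / ln (d x y) = C0 / (- ln (d x y))" by simp
      also have "\<dots> \<le> \<bar>C0\<bar> / (- ln (d x y))" using l0 by (intro divide_right_mono) auto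
      also have "\<dots> \<le> \<delta>" using l l0 \<delta> by (simp add: field_simps)
      finally show ?thesis using L0'[OF x y(1) d0] y(2) r by simp
    qed (use \<delta> in simp)
    then show ?thesis using y by blast
  qed
  have bd: "b \<le> P x" "P x \<le> b'" if x: "x \<in> space M" for x
  proof -
    show "b \<le> P x"
    proof (rule field_le_epsilon)
      fix e :: real assume "0 < e"
      then show "b \<le> P x + e" using approx[OF x, of e] by fastforce
    qed
    show "P x \<le> b'"
    proof (rule field_le_epsilon)
      fix e :: real assume "0 < e"
      then show "P x \<le> b' + e" using approx[OF x, of e] by fastforce
    qed
  qed
  \<comment> \<open>On a bounded space the limit exponent of the hypothesis is an arbitrary number, hence the truncation.\<close>
  define Pinf where "Pinf = max b (min b' pinf)"
  define C where "C = max \<bar>C0\<bar> \<bar>Cinf\<bar>"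
  have "log_holder P b b' Pinf C"
    unfolding log_holder_def
  proof (intro conjI ballI impI)
    show "1 < b" using b(1) by simp
    show "b \<le> Pinf" by (simp add: Pinf_def)
    show "Pinf \<le> b'" using bd[OF x0] by (simp add: Pinf_def)
    fix x assume x: "x \<in> space M"
    show "b \<le> P x" "P x \<le> b'" by (rule bd[OF x])+
    have "\<bar>P x - Pinf\<bar> \<le> \<bar>P x - pinf\<bar>" using bd[OF x] by (auto simp: Pinf_def max_def min_def)
    also have "\<dots> \<le> Cinf / ln (E x)" using Li'[OF x] by simp
    finally have "\<bar>P x - Pinf\<bar> * ln (E x) \<le> Cinf" using ln_E[OF x] by (simp add: field_simps)
    then show "\<bar>P x - Pinf\<bar> * ln (E x) \<le> C" by (simp add: C_def)
    fix y assume y: "y \<in> space M" "0 < d x y" "d x y < 1/2"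
    then have "\<bar>P x - P y\<bar> < C0 / (- ln (d x y))" using L0'[OF x] by simp
    moreover have "0 < - ln (d x y)" using y by simp
    ultimately have "\<bar>P x - P y\<bar> * (- ln (d x y)) < C0" by (simp only: pos_less_divide_eq)
    then show "\<bar>P x - P y\<bar> * (- ln (d x y)) \<le> C" by (simp add: C_def)
  qed measurable
  then show ?thesis using loc dbl pP by blast
qed

section \<open>Modular and Luxemburg norm for a bounded exponent\<close>

lemma modular_finite_exponent:
  assumes "\<And>x. x \<in> space M \<Longrightarrow> p x = ereal (P x)"
  shows "modular M p g = (\<integral>\<^sup>+x. epow (g x) (P x) \<partial>M)"
proof -
  have "{x \<in> space M. p x = \<infinity>} = {}" using assms by auto
  then have "ess_sup_on M {x \<in> space M. p x = \<infinity>} g = 0" by (simp add: ess_sup_on_def bot_ennreal)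
  moreover have "(\<integral>\<^sup>+ x \<in> {x \<in> space M. p x \<noteq> \<infinity>}. epow (g x) (real_of_ereal (p x)) \<partial>M) = (\<integral>\<^sup>+x. epow (g x) (P x) \<partial>M)"
    using assms by (intro nn_integral_cong) auto
  ultimately show ?thesis by (simp add: modular_def)
qed

lemma var_norm_le: "0 < t \<Longrightarrow> modular M p (\<lambda>x. g x / ennreal t) \<le> 1 \<Longrightarrow> var_norm M p g \<le> ennreal t"
  unfolding var_norm_def by (rule Inf_lower) blast

lemma var_norm_lessD:
  assumes "var_norm M p g < ennreal s"
  shows "\<exists>t>0. t < s \<and> modular M p (\<lambda>x. g x / ennreal t) \<le> 1"
  using assms unfolding var_norm_def Inf_less_iff by (auto simp: ennreal_less_iff)

locale finite_exponent =
  fixes M :: "'a measure" and p :: "'a \<Rightarrow> ereal" and P :: "'a \<Rightarrow> real" and b' :: real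
  assumes P_measurable [measurable]: "P \<in> borel_measurable M"
    and p_eq: "\<And>x. x \<in> space M \<Longrightarrow> p x = ereal (P x)"
    and P_bounds: "\<And>x. x \<in> space M \<Longrightarrow> 1 \<le> P x" "\<And>x. x \<in> space M \<Longrightarrow> P x \<le> b'"
begin

lemma modular_altdef: "modular M p g = (\<integral>\<^sup>+x. epow (g x) (P x) \<partial>M)"
  by (rule modular_finite_exponent) (rule p_eq)

lemma modular_mono:
  assumes "\<And>x. x \<in> space M \<Longrightarrow> g x \<le> h x"
  shows "modular M p g \<le> modular M p h"
  unfolding modular_altdef
  by (intro nn_integral_mono epow_mono assms) (use P_bounds in force)+

lemma var_norm_mono:
  assumes "\<And>x. x \<in> space M \<Longrightarrow> g x \<le> h x"
  shows "var_norm M p g \<le> var_norm M p h"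
  unfolding var_norm_def
proof (rule Inf_superset_mono, safe)
  fix t :: real assume t: "0 < t" "modular M p (\<lambda>x. h x / ennreal t) \<le> 1"
  have "modular M p (\<lambda>x. g x / ennreal t) \<le> modular M p (\<lambda>x. h x / ennreal t)"
    by (intro modular_mono divide_right_mono_ennreal assms)
  then show "\<exists>s. ennreal t = ennreal s \<and> 0 < s \<and> modular M p (\<lambda>x. g x / ennreal s) \<le> 1"
    using t by (intro exI[of _ t]) auto
qed

context
  fixes g :: "'a \<Rightarrow> ennreal" and u :: "'a \<Rightarrow> real"
  assumes u_measurable [measurable]: "u \<in> borel_measurable M" and u_nonneg: "\<And>x. x \<in> space M \<Longrightarrow> 0 \<le> u x"
    and g_eq: "AE x in M. g x = ennreal (u x)"
begin

lemma modular_eq: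
  assumes "0 < t"
  shows "modular M p (\<lambda>x. g x / ennreal t) = (\<integral>\<^sup>+x. ennreal ((u x / t) powr P x) \<partial>M)"
  unfolding modular_altdef
proof (rule nn_integral_cong_AE)
  show "AE x in M. epow (g x / ennreal t) (P x) = ennreal ((u x / t) powr P x)"
    using g_eq AE_space
  proof eventually_elim
    case (elim x)
    then show ?case using u_nonneg[of x] assms by (simp add: divide_ennreal epow_ennreal)
  qed
qed

text \<open>Arbitrarily small t are admissible, and for t < 1 \<le> P the inequality t^P \<le> t
  bounds the modular of u by t.\<close>

lemma var_norm_zeroD:
  assumes "var_norm M p g = 0"
  shows "(\<integral>\<^sup>+x. ennreal (u x powr P x) \<partial>M) = 0"
proof -
  have eps: "(\<integral>\<^sup>+x. ennreal (u x powr P x) \<partial>M) \<le> 0 + ennreal e" if e: "0 < e" for e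
  proof -
    have "var_norm M p g < ennreal (min 1 e)" using assms e by (simp add: ennreal_zero_less_divide min_def)
    then obtain t where t: "0 < t" "t < min 1 e" "modular M p (\<lambda>x. g x / ennreal t) \<le> 1"
      using var_norm_lessD by blast
    have "(\<integral>\<^sup>+x. ennreal (u x powr P x) \<partial>M) \<le> (\<integral>\<^sup>+x. ennreal t * ennreal ((u x / t) powr P x) \<partial>M)"
    proof (rule nn_integral_mono)
      fix x assume x: "x \<in> space M"
      have "t powr P x \<le> t powr 1" using t P_bounds(1)[OF x] by (intro powr_mono') auto
      then have "t powr P x * (u x / t) powr P x \<le> t * (u x / t) powr P x" using t by (intro mult_right_mono) auto
      then have "u x powr P x \<le> t * (u x / t) powr P x" using t by (simp add: powr_divide)
      then have "ennreal (u x powr P x) \<le> ennreal (t * (u x / t) powr P x)" by (rule ennreal_leI)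
      then show "ennreal (u x powr P x) \<le> ennreal t * ennreal ((u x / t) powr P x)" using t by (simp add: ennreal_mult)
    qed
    also have "\<dots> = ennreal t * modular M p (\<lambda>x. g x / ennreal t)"
      unfolding modular_eq[OF t(1)] by (rule nn_integral_cmult) measurable
    also have "\<dots> \<le> ennreal t * 1" using t by (intro mult_left_mono) auto
    also have "\<dots> \<le> ennreal e" using t by (simp add: ennreal_leI)
    finally show ?thesis by simp
  qed
  have "(\<integral>\<^sup>+x. ennreal (u x powr P x) \<partial>M) \<le> 0" by (rule ennreal_le_epsilon) (rule eps)
  then show ?thesis by simp
qed

text \<open>Some admissible t is below 2 n, and n/2 is not admissible. Each comparison changes the
  argument by a factor of at most 2, hence the modular by at most 2^b'. This is the origin of
  \<Gamma> = 2^b' in \<open>ball_norm\<close>.\<close>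

lemma var_norm_unit_modular:
  assumes n: "0 < n" and vn: "var_norm M p g = ennreal n"
  shows "(\<integral>\<^sup>+x. ennreal ((u x / n) powr P x) \<partial>M) \<le> ennreal (2 powr b')"
    and "ennreal (1 / 2 powr b') \<le> (\<integral>\<^sup>+x. ennreal ((u x / n) powr P x) \<partial>M)"
proof -
  have two: "2 powr P x \<le> 2 powr b'" if "x \<in> space M" for x using P_bounds(2)[OF that] by (intro powr_mono) auto
  have "var_norm M p g < ennreal (2 * n)" unfolding vn using n by (simp add: ennreal_less_iff)
  then obtain t where t: "0 < t" "t < 2 * n" "modular M p (\<lambda>x. g x / ennreal t) \<le> 1"
    using var_norm_lessD by blast
  have "(\<integral>\<^sup>+x. ennreal ((u x / n) powr P x) \<partial>M) \<le> (\<integral>\<^sup>+x. ennreal (2 powr b') * ennreal ((u x / t) powr P x) \<partial>M)"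
  proof (rule nn_integral_mono)
    fix x assume x: "x \<in> space M"
    have "u x / n \<le> 2 * (u x / t)" 
      using mult_right_mono[of t "2 * n" "u x"] t n u_nonneg[OF x] by (simp add: field_simps)
    then have "(u x / n) powr P x \<le> (2 * (u x / t)) powr P x" using n u_nonneg[OF x] P_bounds(1)[OF x] by (intro powr_mono2) auto
    also have "\<dots> = 2 powr P x * (u x / t) powr P x" by (rule powr_mult)
    also have "\<dots> \<le> 2 powr b' * (u x / t) powr P x" using two[OF x] by (intro mult_right_mono) auto
    finally have "ennreal ((u x / n) powr P x) \<le> ennreal (2 powr b' * (u x / t) powr P x)" by (rule ennreal_leI)
    then show "ennreal ((u x / n) powr P x) \<le> ennreal (2 powr b') * ennreal ((u x / t) powr P x)" by (simp add: ennreal_mult)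
  qed
  also have "\<dots> = ennreal (2 powr b') * modular M p (\<lambda>x. g x / ennreal t)"
    unfolding modular_eq[OF t(1)] by (rule nn_integral_cmult) measurable
  also have "\<dots> \<le> ennreal (2 powr b') * 1" using t by (intro mult_left_mono) auto
  finally show "(\<integral>\<^sup>+x. ennreal ((u x / n) powr P x) \<partial>M) \<le> ennreal (2 powr b')" by simp
  have n2: "0 < n / 2" using n by simp
  have "\<not> modular M p (\<lambda>x. g x / ennreal (n / 2)) \<le> 1"
    using var_norm_le[OF n2, of M p g] n unfolding vn by (auto simp: ennreal_le_iff)
  then have "1 \<le> (\<integral>\<^sup>+x. ennreal ((u x / (n / 2)) powr P x) \<partial>M)" using modular_eq[OF n2] by simp
  also have "\<dots> \<le> (\<integral>\<^sup>+x. ennreal (2 powr b') * ennreal ((u x / n) powr P x) \<partial>M)"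
  proof (rule nn_integral_mono)
    fix x assume x: "x \<in> space M"
    have "(u x / (n / 2)) powr P x = (2 * (u x / n)) powr P x" by (simp add: field_simps)
    also have "\<dots> = 2 powr P x * (u x / n) powr P x" by (rule powr_mult)
    also have "\<dots> \<le> 2 powr b' * (u x / n) powr P x" using two[OF x] by (intro mult_right_mono) auto
    finally have "ennreal ((u x / (n / 2)) powr P x) \<le> ennreal (2 powr b' * (u x / n) powr P x)" by (rule ennreal_leI)
    then show "ennreal ((u x / (n / 2)) powr P x) \<le> ennreal (2 powr b') * ennreal ((u x / n) powr P x)" by (simp add: ennreal_mult)
  qed
  also have "\<dots> = ennreal (2 powr b') * (\<integral>\<^sup>+x. ennreal ((u x / n) powr P x) \<partial>M)" by (rule nn_integral_cmult) measurable
  finally have 1: "1 \<le> ennreal (2 powr b') * (\<integral>\<^sup>+x. ennreal ((u x / n) powr P x) \<partial>M)" .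
  have "ennreal (1 / 2 powr b') * 1 \<le> ennreal (1 / 2 powr b') * (ennreal (2 powr b') * (\<integral>\<^sup>+x. ennreal ((u x / n) powr P x) \<partial>M))"
    by (rule mult_left_mono[OF 1]) simp
  also have "\<dots> = (\<integral>\<^sup>+x. ennreal ((u x / n) powr P x) \<partial>M)"
    by (subst ennreal_mult_left_assoc) auto
  finally show "ennreal (1 / 2 powr b') \<le> (\<integral>\<^sup>+x. ennreal ((u x / n) powr P x) \<partial>M)" by simp
qed

end
end

section \<open>The Muckenhoupt condition is sufficient\<close>

lemma powr_divide_eq: "(a / b) powr p = a powr p * b powr (- p)" for a b p :: real
  unfolding powr_divide by (simp only: powr_minus divide_inverse)

text \<open>With s = 1/K this converts a modular bound by K into a norm bound by K.\<close>

lemma epow_mult_le: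
  assumes "0 < s" "s \<le> 1" "1 \<le> r"
  shows "epow (ennreal s * a) r \<le> ennreal s * epow a r"
proof (cases "a = \<infinity>")
  case True then show ?thesis using assms by (simp add: epow_def ennreal_mult_top)
next
  case False
  then have "a < \<infinity>" by (simp add: less_top)
  then obtain u where u: "0 \<le> u" "a = ennreal u" by (rule ennreal_finiteE)
  have "s powr r \<le> s powr 1" using assms by (intro powr_mono') auto
  then have "(s * u) powr r \<le> s * u powr r" using assms u by (simp add: powr_mult mult_right_mono)
  then have "ennreal ((s * u) powr r) \<le> ennreal (s * u powr r)" by (rule ennreal_leI)
  moreover have "epow (ennreal s * a) r = ennreal ((s * u) powr r)"
    unfolding u(2) using assms u by (subst ennreal_mult[symmetric]) (auto simp: epow_ennreal)
  moreover have "ennreal s * epow a r = ennreal (s * u powr r)" using assms u by (simp add: epow_ennreal ennreal_mult)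
  ultimately show ?thesis by simp
qed

lemma var_norm_mult_ge:
  assumes a: "0 < a"
  shows "ennreal a * var_norm M p g \<le> var_norm M p (\<lambda>x. ennreal a * g x)"
  unfolding var_norm_def[of M p "\<lambda>x. ennreal a * g x"]
proof (rule Inf_greatest, safe)
  fix t :: real assume t: "0 < t" and m: "modular M p (\<lambda>x. ennreal a * g x / ennreal t) \<le> 1"
  have "ennreal a * inverse (ennreal t) = ennreal (a * inverse t)"
    using a t by (simp only: inverse_ennreal) (intro ennreal_mult[symmetric], auto)
  also have "\<dots> = inverse (ennreal (t / a))" using a t by (subst inverse_ennreal) (auto simp: field_simps)
  finally have i: "ennreal a * inverse (ennreal t) = inverse (ennreal (t / a))" .
  have "ennreal a * g x / ennreal t = g x / ennreal (t / a)" for x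
    unfolding divide_ennreal_def i[symmetric] by (simp only: mult_ac)
  then have "var_norm M p g \<le> ennreal (t / a)" using a t m by (intro var_norm_le) auto
  then have "ennreal a * var_norm M p g \<le> ennreal a * ennreal (t / a)" by (intro mult_left_mono) auto
  also have "\<dots> = ennreal t" using a t by (simp add: ennreal_mult[symmetric])
  finally show "ennreal a * var_norm M p g \<le> ennreal t" .
qed

context quasi_metric_measurable
begin

lemma maxf_scale:
  assumes [measurable]: "f \<in> borel_measurable M" and t: "0 < t"
  shows "maxf d M f x \<le> ennreal t * maxf d M (\<lambda>x. f x / t) x"
  unfolding maxf_def[of d M f]
proof (rule SUP_least)
  fix A assume A: "A \<in> {A \<in> qballs (space M) d. x \<in> A}"
  then have [measurable]: "A \<in> sets M" using ball_sets by (auto simp: qballs_def)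
  have "(\<integral>\<^sup>+y\<in>A. ennreal \<bar>f y\<bar> \<partial>M) = (\<integral>\<^sup>+y. ennreal t * (ennreal \<bar>f y / t\<bar> * indicator A y) \<partial>M)"
  proof (rule nn_integral_cong)
    fix y
    have "ennreal t * ennreal \<bar>f y / t\<bar> = ennreal \<bar>f y\<bar>" using t by (simp add: ennreal_mult[symmetric])
    then show "ennreal \<bar>f y\<bar> * indicator A y = ennreal t * (ennreal \<bar>f y / t\<bar> * indicator A y)"
      by (simp add: mult.assoc[symmetric])
  qed
  also have "\<dots> = ennreal t * (\<integral>\<^sup>+y\<in>A. ennreal \<bar>f y / t\<bar> \<partial>M)" by (rule nn_integral_cmult) measurable
  finally have "(\<integral>\<^sup>+y\<in>A. ennreal \<bar>f y\<bar> \<partial>M) / emeasure M A = ennreal t * ((\<integral>\<^sup>+y\<in>A. ennreal \<bar>f y / t\<bar> \<partial>M) / emeasure M A)"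
    by (simp add: ennreal_times_divide)
  also have "\<dots> \<le> ennreal t * maxf d M (\<lambda>x. f x / t) x"
    unfolding maxf_def using A by (intro mult_left_mono SUP_upper) auto
  finally show "(\<integral>\<^sup>+y\<in>A. ennreal \<bar>f y\<bar> \<partial>M) / emeasure M A \<le> ennreal t * maxf d M (\<lambda>x. f x / t) x" .
qed

lemma ball_normI:
  assumes "1 \<le> \<Gamma>" "1 \<le> D" "W \<in> borel_measurable M" "\<And>y. y \<in> space M \<Longrightarrow> 0 < W y"
    and "\<And>c r. c \<in> space M \<Longrightarrow> 0 < r \<Longrightarrow> 0 < N c r"
    and "\<And>c r. c \<in> space M \<Longrightarrow> 0 < r \<Longrightarrow> ennreal (1 / \<Gamma>) \<le> (\<integral>\<^sup>+y\<in>B c r. ennreal (W y * N c r powr (- P y)) \<partial>M)"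
    and "\<And>c r. c \<in> space M \<Longrightarrow> 0 < r \<Longrightarrow> (\<integral>\<^sup>+y\<in>B c r. ennreal (W y * N c r powr (- P y)) \<partial>M) \<le> ennreal \<Gamma>"
    and "\<And>c r. c \<in> space M \<Longrightarrow> 0 < r \<Longrightarrow> N c (2 * r) \<le> D * N c r"
    and "\<And>c r c' r'. c \<in> space M \<Longrightarrow> 0 < r \<Longrightarrow> c' \<in> space M \<Longrightarrow> 0 < r' \<Longrightarrow> B c r \<subseteq> B c' r' \<Longrightarrow> N c r \<le> N c' r'"
  shows "ball_norm W P N \<Gamma> D"
  unfolding ball_norm_def by (intro conjI ballI allI impI assms)

text \<open>A norm zero would make the ball null. Positivity rules out products of 0 and infinity in
  the Muckenhoupt condition, and the second part supplies the normalised integrals of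
  \<open>ball_norm\<close>.\<close>

lemma var_norm_ball:
  assumes fe: "finite_exponent M p P b'" and dbl: "doubling M D0"
    and [measurable]: "v \<in> borel_measurable M" and v_pos: "\<forall>x\<in>space M. 0 < v x"
    and w: "AE x in M. w x = ennreal (v x)" and c: "c \<in> space M" and r: "0 < r"
  shows "0 < var_norm M p (\<lambda>x. w x * indicator (B c r) x)"
    and "\<And>n. 0 < n \<Longrightarrow> var_norm M p (\<lambda>x. w x * indicator (B c r) x) = ennreal n \<Longrightarrow>
      (\<integral>\<^sup>+y\<in>B c r. ennreal (v y powr P y * n powr (- P y)) \<partial>M) \<le> ennreal (2 powr b') \<and>
      ennreal (1 / 2 powr b') \<le> (\<integral>\<^sup>+y\<in>B c r. ennreal (v y powr P y * n powr (- P y)) \<partial>M)"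
proof -
  interpret finite_exponent M p P b' by fact
  note Dd = doublingD[OF dbl] and v = bspec[OF v_pos]
  have Bm [measurable]: "B c r \<in> sets M" by (rule ball_sets[OF c r])
  define u where "u x = v x * indicat_real (B c r) x" for x
  have um [measurable]: "u \<in> borel_measurable M" unfolding u_def[abs_def] by measurable
  have u0: "0 \<le> u x" if "x \<in> space M" for x using v[OF that] by (simp add: u_def)
  have gu: "AE x in M. w x * indicator (B c r) x = ennreal (u x)"
    using w by eventually_elim (auto simp: u_def indicator_def)
  show "0 < var_norm M p (\<lambda>x. w x * indicator (B c r) x)"
  proof (rule ccontr)
    assume "\<not> ?thesis"
    then have "(\<integral>\<^sup>+x. ennreal (u x powr P x) \<partial>M) = 0" by (intro var_norm_zeroD[OF um u0 gu]) auto
    then have "AE x in M. ennreal (u x powr P x) = 0" by (subst (asm) nn_integral_0_iff_AE) auto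
    then have "AE x in M. x \<notin> B c r"
      using AE_space
    proof eventually_elim
      case (elim x)
      then show ?case using v[of x] by (auto simp: u_def indicator_def split: if_splits)
    qed
    moreover have "(AE x in M. x \<notin> B c r) \<longleftrightarrow> emeasure M (B c r) = 0"
      by (rule AE_iff_measurable[OF Bm]) (auto simp: ball_iff)
    ultimately show False using Dd(4)[OF c r] by simp
  qed
  fix n :: real assume n: "0 < n" and vn: "var_norm M p (\<lambda>x. w x * indicator (B c r) x) = ennreal n"
  have "(\<integral>\<^sup>+x. ennreal ((u x / n) powr P x) \<partial>M) = (\<integral>\<^sup>+y\<in>B c r. ennreal (v y powr P y * n powr (- P y)) \<partial>M)"
  proof (rule nn_integral_cong)
    fix x assume "x \<in> space M"
    then show "ennreal ((u x / n) powr P x) = ennreal (v x powr P x * n powr (- P x)) * indicator (B c r) x"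
      by (simp add: u_def indicator_def powr_divide_eq)
  qed
  then show "(\<integral>\<^sup>+y\<in>B c r. ennreal (v y powr P y * n powr (- P y)) \<partial>M) \<le> ennreal (2 powr b') \<and>
      ennreal (1 / 2 powr b') \<le> (\<integral>\<^sup>+y\<in>B c r. ennreal (v y powr P y * n powr (- P y)) \<partial>M)"
    using var_norm_unit_modular[OF um u0 gu n vn] by simp
qed

text \<open>Young's inequality for the product of v/n and v^(-1)/n', which is 1/(n n'). The numbers
  n and n' need only bound the modulars, so they may be norms over different balls; the proof that
  the norms double relies on this.\<close>

lemma holder_ball:
  assumes dbl: "doubling M D0" and c: "c \<in> space M" and r: "0 < r"
    and [measurable]: "v \<in> borel_measurable M" "P \<in> borel_measurable M" and v: "\<And>x. x \<in> space M \<Longrightarrow> 0 < v x"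
    and P: "\<And>x. x \<in> space M \<Longrightarrow> 1 < P x" and n: "0 < n" "0 < n'" and G: "0 \<le> G" "0 \<le> G'"
    and 1: "(\<integral>\<^sup>+y\<in>B c r. ennreal (v y powr P y * n powr (- P y)) \<partial>M) \<le> ennreal G"
    and 2: "(\<integral>\<^sup>+y\<in>B c r. ennreal (inverse (v y) powr (P y / (P y - 1)) * n' powr (- (P y / (P y - 1)))) \<partial>M) \<le> ennreal G'"
  shows "measure M (B c r) \<le> n * n' * (G + G')"
proof -
  note Dd = doublingD[OF dbl]
  have Bm [measurable]: "B c r \<in> sets M" by (rule ball_sets[OF c r])
  let ?a = "\<lambda>y. ennreal (v y powr P y * n powr (- P y))"
  let ?b = "\<lambda>y. ennreal (inverse (v y) powr (P y / (P y - 1)) * n' powr (- (P y / (P y - 1))))"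
  have "ennreal (measure M (B c r)) = (\<integral>\<^sup>+y. indicator (B c r) y \<partial>M)" using Dd(7)[OF c r] by simp
  also have "\<dots> \<le> (\<integral>\<^sup>+y. ennreal (n * n') * (?a y * indicator (B c r) y + ?b y * indicator (B c r) y) \<partial>M)"
  proof (rule nn_integral_mono)
    fix y assume y: "y \<in> space M"
    have "1 = n * n' * ((v y / n) * (inverse (v y) / n'))" using n v[OF y] by simp
    also have "\<dots> \<le> n * n' * ((v y / n) powr P y + (inverse (v y) / n') powr (P y / (P y - 1)))"
      using n v[OF y] by (intro mult_left_mono young_unit P y) (auto simp: less_imp_le)
    finally have "ennreal 1 \<le> ennreal (n * n' * (v y powr P y * n powr (- P y) + inverse (v y) powr (P y / (P y - 1)) * n' powr (- (P y / (P y - 1)))))"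
      by (intro ennreal_leI) (simp add: powr_divide_eq)
    also have "\<dots> = ennreal (n * n') * (?a y + ?b y)" using n by (subst ennreal_mult) auto
    finally show "indicator (B c r) y \<le> ennreal (n * n') * (?a y * indicator (B c r) y + ?b y * indicator (B c r) y)"
      by (auto simp: indicator_def)
  qed
  also have "\<dots> = ennreal (n * n') * ((\<integral>\<^sup>+y\<in>B c r. ?a y \<partial>M) + (\<integral>\<^sup>+y\<in>B c r. ?b y \<partial>M))"
    by (subst nn_integral_cmult, simp, subst nn_integral_add) auto
  also have "\<dots> \<le> ennreal (n * n') * (ennreal G + ennreal G')" using 1 2 by (intro mult_left_mono add_mono) auto
  also have "\<dots> = ennreal (n * n' * (G + G'))" using n G by (subst ennreal_mult) auto
  finally show ?thesis by (subst (asm) ennreal_le_iff) (use n G in auto)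
qed

end

section \<open>The original weight with a real representative, and sufficiency\<close>

locale weighted_homogeneous_space = quasi_metric_measurable +
  fixes p :: "'a \<Rightarrow> ereal" and P v :: "'a \<Rightarrow> real" and w :: "'a \<Rightarrow> ennreal" and D0 b b' Pinf C :: real
  assumes dbl: "doubling M D0" and lh: "log_holder P b b' Pinf C"
    and p_eq: "\<And>x. x \<in> space M \<Longrightarrow> p x = ereal (P x)"
    and v_measurable [measurable]: "v \<in> borel_measurable M" and v_pos: "\<And>x. x \<in> space M \<Longrightarrow> 0 < v x"
    and w_eq: "AE x in M. w x = ennreal (v x)"
begin

definition P' :: "'a \<Rightarrow> real" where
  "P' y = P y / (P y - 1)"

lemmas L = log_holderD[OF lh]
lemmas lh' = log_holder_conj[OF lh, folded P'_def]
lemmas L' = log_holderD[OF lh']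
lemmas Dd = doublingD[OF dbl]
lemmas [measurable] = L(1) L'(1)

lemma P_gt1: "x \<in> space M \<Longrightarrow> 1 < P x"
  using L(2) L(6)[of x] by linarith

lemma conj_exp_eq: "x \<in> space M \<Longrightarrow> conj_exp p x = ereal (P' x)"
  using P_gt1[of x] by (simp add: conj_exp_def p_eq P'_def one_ereal_def)

lemma finite_exponent_p: "finite_exponent M p P b'"
  by unfold_locales (use L P_gt1 p_eq in \<open>auto intro: less_imp_le\<close>)

lemma finite_exponent_conj: "finite_exponent M (conj_exp p) P' (b / (b - 1))"
proof
  show "1 \<le> P' x" "P' x \<le> b / (b - 1)" if "x \<in> space M" for x
    using L'(2) L'(6,7)[OF that] by auto
qed (auto simp: conj_exp_eq)

lemma inverse_w_eq: "AE x in M. inverse (w x) = ennreal (inverse (v x))"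
  using w_eq AE_space by eventually_elim (simp add: inverse_ennreal v_pos)

abbreviation norm_w where "norm_w c r \<equiv> var_norm M p (\<lambda>x. w x * indicator (B c r) x)"
abbreviation norm_w' where "norm_w' c r \<equiv> var_norm M (conj_exp p) (\<lambda>x. inverse (w x) * indicator (B c r) x)"

lemma v_pos_ball: "\<forall>x\<in>space M. 0 < v x" "\<forall>x\<in>space M. 0 < inverse (v x)"
    and inverse_v: "(\<lambda>x. inverse (v x)) \<in> borel_measurable M"
  using v_pos by auto

lemmas norm_w_ball = var_norm_ball[OF finite_exponent_p dbl v_measurable v_pos_ball(1) w_eq]
lemmas norm_w'_ball = var_norm_ball[OF finite_exponent_conj dbl inverse_v v_pos_ball(2) inverse_w_eq]

lemma muckenhoupt_sufficient:
  assumes A: "A_var d M p w"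
  shows "\<exists>K::real. \<forall>f\<in>borel_measurable M.
    var_norm M p (\<lambda>x. maxf d M f x * w x) \<le> ennreal K * var_norm M p (\<lambda>x. ennreal \<bar>f x\<bar> * w x)"
proof -
  interpret pe: finite_exponent M p P b' by (rule finite_exponent_p)
  interpret ce: finite_exponent M "conj_exp p" P' "b / (b - 1)" by (rule finite_exponent_conj)
  obtain K0 where K0: "\<And>c r. c \<in> space M \<Longrightarrow> 0 < r \<Longrightarrow> norm_w c r * norm_w' c r \<le> ennreal K0 * emeasure M (B c r)"
    using A unfolding A_var_def qballs_def by blast
  define Kn where "Kn = max 1 K0"
  have Kn: "1 \<le> Kn" by (simp add: Kn_def)
  define N where "N c r = enn2real (norm_w c r)" for c r
  define N' where "N' c r = enn2real (norm_w' c r)" for c r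
  have NN: "0 < N c r \<and> norm_w c r = ennreal (N c r) \<and> 0 < N' c r \<and> norm_w' c r = ennreal (N' c r) \<and> N c r * N' c r \<le> Kn * measure M (B c r)"
    if c: "c \<in> space M" and r: "0 < r" for c r
  proof -
    note p1 = norm_w_ball(1)[OF c r] and p2 = norm_w'_ball(1)[OF c r]
    have "norm_w c r * norm_w' c r \<le> ennreal K0 * ennreal (measure M (B c r))" using K0[OF c r] Dd(7)[OF c r] by simp
    also have "\<dots> \<le> ennreal Kn * ennreal (measure M (B c r))" by (intro mult_right_mono ennreal_leI) (auto simp: Kn_def)
    also have "\<dots> = ennreal (Kn * measure M (B c r))" using Kn by (simp add: ennreal_mult)
    finally have le: "norm_w c r * norm_w' c r \<le> ennreal (Kn * measure M (B c r))" .
    then have "norm_w c r * norm_w' c r \<noteq> top" by (auto simp: top_unique)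
    \<comment> \<open>Both factors are positive, so a finite product forces each of them to be
      finite.\<close>
    then have fin: "norm_w c r \<noteq> top" "norm_w' c r \<noteq> top" using p1 p2 by (auto simp: ennreal_mult_eq_top_iff)
    then have e: "norm_w c r = ennreal (N c r)" "norm_w' c r = ennreal (N' c r)" by (simp_all add: N_def N'_def less_top)
    then have pos: "0 < N c r" "0 < N' c r" using p1 p2 by auto
    have "ennreal (N c r * N' c r) \<le> ennreal (Kn * measure M (B c r))" using le e pos by (simp add: ennreal_mult)
    then have "N c r * N' c r \<le> Kn * measure M (B c r)" by (subst (asm) ennreal_le_iff) (use Kn in auto)
    then show ?thesis using e pos by blast
  qed
  define G where "G = (2::real) powr b'"
  define G' where "G' = (2::real) powr (b / (b - 1))"
  have G: "1 \<le> G" "1 \<le> G'" unfolding G_def G'_def using L(2-4) L'(2-4) by (auto intro!: ge_one_powr_ge_zero)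
  define W where "W y = v y powr P y" for y
  define \<sigma> where "\<sigma> y = inverse (v y) powr P' y" for y
  have I1: "(\<integral>\<^sup>+y\<in>B c r. ennreal (W y * N c r powr (- P y)) \<partial>M) \<le> ennreal G"
    "ennreal (1 / G) \<le> (\<integral>\<^sup>+y\<in>B c r. ennreal (W y * N c r powr (- P y)) \<partial>M)" if c: "c \<in> space M" and r: "0 < r" for c r
    unfolding W_def G_def using norm_w_ball(2)[OF c r, of "N c r"] NN[OF c r] by auto
  have I2: "(\<integral>\<^sup>+y\<in>B c r. ennreal (\<sigma> y * N' c r powr (- P' y)) \<partial>M) \<le> ennreal G'"
    "ennreal (1 / G') \<le> (\<integral>\<^sup>+y\<in>B c r. ennreal (\<sigma> y * N' c r powr (- P' y)) \<partial>M)" if c: "c \<in> space M" and r: "0 < r" for c r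
    unfolding \<sigma>_def G'_def using norm_w'_ball(2)[OF c r, of "N' c r"] NN[OF c r] by auto
  have mono: "N c r \<le> N c' r'" "N' c r \<le> N' c' r'"
    if "c \<in> space M" "0 < r" "c' \<in> space M" "0 < r'" "B c r \<subseteq> B c' r'" for c r c' r'
  proof -
    have i: "indicator (B c r) x \<le> (indicator (B c' r') x :: ennreal)" for x using that by (auto simp: indicator_def)
    have "norm_w c r \<le> norm_w c' r'" by (intro pe.var_norm_mono mult_left_mono i) auto
    then show "N c r \<le> N c' r'" using NN[OF that(1,2)] NN[OF that(3,4)] by (auto simp: ennreal_le_iff)
    have "norm_w' c r \<le> norm_w' c' r'" by (intro ce.var_norm_mono mult_left_mono i) auto
    then show "N' c r \<le> N' c' r'" using NN[OF that(1,2)] NN[OF that(3,4)] by (auto simp: ennreal_le_iff)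
  qed
  define DN where "DN = Kn * D0 * (G + G')"
  have DN1: "1 \<le> DN"
  proof -
    have "1 \<le> u * z" if "1 \<le> u" "1 \<le> z" for u z :: real using mult_mono[of 1 u 1 z] that by simp
    then show ?thesis unfolding DN_def using Kn Dd(2) G by simp
  qed
  \<comment> \<open>The Muckenhoupt condition on the double 2B gives N(2B) N'(2B) \<le> Kn D0 mu(B),
    while Hoelder on B with the mixed norms gives mu(B) \<le> N(B) N'(2B) (G + G'). Cancelling
    N'(2B) leaves the claim with constant \<open>DN\<close>; the other half is symmetric.\<close>
  have dN: "N c (2 * r) \<le> DN * N c r" "N' c (2 * r) \<le> DN * N' c r" if c: "c \<in> space M" and r: "0 < r" for c r
  proof -
    have r2: "0 < 2 * r" using r by simp
    have sub: "indicator (B c r) y \<le> (indicator (B c (2 * r)) y :: ennreal)" for y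
      using ball_mono[of r "2 * r" c] r by (auto simp: indicator_def)
    have J1: "(\<integral>\<^sup>+y\<in>B c r. ennreal (W y * N c (2 * r) powr (- P y)) \<partial>M) \<le> ennreal G"
      using I1(1)[OF c r2] by (intro order_trans[OF nn_integral_mono[OF mult_left_mono[OF sub]]]) auto
    have J2: "(\<integral>\<^sup>+y\<in>B c r. ennreal (\<sigma> y * N' c (2 * r) powr (- P' y)) \<partial>M) \<le> ennreal G'"
      using I2(1)[OF c r2] by (intro order_trans[OF nn_integral_mono[OF mult_left_mono[OF sub]]]) auto
    note nn = NN[OF c r] and nn2 = NN[OF c r2]
    have "measure M (B c r) \<le> N c r * N' c (2 * r) * (G + G')"
      by (rule holder_ball[OF dbl c r v_measurable L(1) v_pos P_gt1])
        (use nn nn2 G I1(1)[OF c r] J2 in \<open>auto simp: W_def \<sigma>_def P'_def\<close>)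
    note h1 = this
    have h2: "measure M (B c r) \<le> N c (2 * r) * N' c r * (G + G')"
      by (rule holder_ball[OF dbl c r v_measurable L(1) v_pos P_gt1])
        (use nn nn2 G I2(1)[OF c r] J1 in \<open>auto simp: W_def \<sigma>_def P'_def\<close>)
    have KD: "0 \<le> Kn * D0" using Kn Dd(2) by simp
    have "N c (2 * r) * N' c (2 * r) \<le> Kn * (D0 * measure M (B c r))"
      using nn2 mult_left_mono[OF Dd(8)[OF c r], of Kn] Kn by linarith
    then have h: "N c (2 * r) * N' c (2 * r) \<le> Kn * D0 * measure M (B c r)" by simp
    have "N c (2 * r) * N' c (2 * r) \<le> Kn * D0 * (N c r * N' c (2 * r) * (G + G'))"
      using h mult_left_mono[OF h1 KD] by linarith
    also have "\<dots> = (DN * N c r) * N' c (2 * r)" by (simp add: DN_def mult_ac)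
    finally show "N c (2 * r) \<le> DN * N c r" using nn2 by (simp only: mult_le_cancel_right_pos)
    have "N c (2 * r) * N' c (2 * r) \<le> Kn * D0 * (N c (2 * r) * N' c r * (G + G'))"
      using h mult_left_mono[OF h2 KD] by linarith
    also have "\<dots> = N c (2 * r) * (DN * N' c r)" by (simp add: DN_def mult_ac)
    finally show "N' c (2 * r) \<le> DN * N' c r" using nn2 by (simp only: mult_le_cancel_left_pos)
  qed
  have bn: "ball_norm W P N G DN"
  proof (rule ball_normI[OF G(1) DN1])
    show "W \<in> borel_measurable M" unfolding W_def[abs_def] by measurable
    show "0 < W y" if "y \<in> space M" for y using v_pos[OF that] by (simp add: W_def)
    show "0 < N c r" if "c \<in> space M" "0 < r" for c r using NN[OF that] by blast
  qed (rule I1 dN mono; assumption)+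
  have bn': "ball_norm \<sigma> P' N' G' DN"
  proof (rule ball_normI[OF G(2) DN1])
    show "\<sigma> \<in> borel_measurable M" unfolding \<sigma>_def[abs_def] by measurable
    show "0 < \<sigma> y" if "y \<in> space M" for y using v_pos[OF that] by (simp add: \<sigma>_def)
    show "0 < N' c r" if "c \<in> space M" "0 < r" for c r using NN[OF that] by blast
  qed (rule I2 dN mono; assumption)+
  have mp: "muckenhoupt_pair M d A0 x0 P W \<sigma> N N' Pinf b b' (b' / (b' - 1)) (b / (b - 1)) C (C / (b - 1)\<^sup>2) G G' DN DN D0 Kn"
  proof unfold_locales
    show "doubling M D0" "log_holder P b b' Pinf C" "ball_norm W P N G DN" "1 \<le> Kn" by (rule dbl lh bn Kn)+
    show "log_holder (\<lambda>y. P y / (P y - 1)) (b' / (b' - 1)) (b / (b - 1)) (Pinf / (Pinf - 1)) (C / (b - 1)\<^sup>2)"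
      by (rule log_holder_conj[OF lh])
    show "ball_norm \<sigma> (\<lambda>y. P y / (P y - 1)) N' G' DN" using bn' by (simp add: P'_def[abs_def])
    show "\<sigma> y = W y powr (- 1 / (P y - 1))" if y: "y \<in> space M" for y
    proof -
      have "W y powr (- 1 / (P y - 1)) = v y powr (- P' y)" using P_gt1[OF y] by (simp add: W_def powr_powr P'_def)
      also have "\<dots> = \<sigma> y" using v_pos[OF y] by (simp add: \<sigma>_def powr_def ln_inverse)
      finally show ?thesis by simp
    qed
    show "N c r * N' c r \<le> Kn * measure M (B c r)" if "c \<in> space M" "0 < r" for c r using NN[OF that] by blast
  qed
  interpret mp: muckenhoupt_pair M d A0 x0 P W \<sigma> N N' "\<lambda>y. P y / (P y - 1)" Pinf "Pinf / (Pinf - 1)" b b' "b' / (b' - 1)" "b / (b - 1)" C "C / (b - 1)\<^sup>2" G G' DN DN D0 Kn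
    by (rule mp)
  obtain K where K: "1 \<le> K" "\<And>f. f \<in> borel_measurable M \<Longrightarrow> (\<integral>\<^sup>+x. ennreal ((\<bar>f x\<bar> * v x) powr P x) \<partial>M) \<le> 1 \<Longrightarrow>
     \<exists>U\<in>borel_measurable M. (\<forall>x\<in>space M. epow (maxf d M f x * ennreal (v x)) (P x) \<le> U x) \<and> (\<integral>\<^sup>+x. U x \<partial>M) \<le> ennreal K"
    using mp.maxf_modular_bound[of v] v_pos by (auto simp: W_def)
  have "var_norm M p (\<lambda>x. maxf d M f x * w x) \<le> ennreal K * var_norm M p (\<lambda>x. ennreal \<bar>f x\<bar> * w x)"
    if fm [measurable]: "f \<in> borel_measurable M" for f
  proof -
    let ?X = "var_norm M p (\<lambda>x. maxf d M f x * w x)"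
    \<comment> \<open>The factor is moved to the left so that the norm on the right, an infimum, can
      be treated one admissible t at a time: f/t has modular at most 1, and the bound K for its
      maximal function makes K t admissible on the left.\<close>
    have "ennreal (1 / K) * ?X \<le> var_norm M p (\<lambda>x. ennreal \<bar>f x\<bar> * w x)"
      unfolding var_norm_def[of M p "\<lambda>x. ennreal \<bar>f x\<bar> * w x"]
    proof (rule Inf_greatest, safe)
      fix t :: real assume t: "0 < t" and m: "modular M p (\<lambda>x. ennreal \<bar>f x\<bar> * w x / ennreal t) \<le> 1"
      have "modular M p (\<lambda>x. ennreal \<bar>f x\<bar> * w x / ennreal t) = (\<integral>\<^sup>+x. ennreal ((\<bar>f x\<bar> * v x / t) powr P x) \<partial>M)"
      proof (rule pe.modular_eq[OF _ _ _ t])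
        show "AE x in M. ennreal \<bar>f x\<bar> * w x = ennreal (\<bar>f x\<bar> * v x)"
          using w_eq AE_space by eventually_elim (simp add: ennreal_mult v_pos less_imp_le)
      qed (use v_pos in \<open>auto simp: less_imp_le\<close>)
      then have "(\<integral>\<^sup>+x. ennreal ((\<bar>f x / t\<bar> * v x) powr P x) \<partial>M) \<le> 1" using m t by simp
      then obtain U where [measurable]: "U \<in> borel_measurable M"
        and U: "\<forall>x\<in>space M. epow (maxf d M (\<lambda>x. f x / t) x * ennreal (v x)) (P x) \<le> U x" "(\<integral>\<^sup>+x. U x \<partial>M) \<le> ennreal K"
        using K(2)[of "\<lambda>x. f x / t"] by auto
      have Kt: "0 < K * t" using K(1) t by simp
      have "modular M p (\<lambda>x. maxf d M f x * w x / ennreal (K * t)) \<le> (\<integral>\<^sup>+x. ennreal (1 / K) * U x \<partial>M)"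
        unfolding pe.modular_altdef
      proof (rule nn_integral_mono_AE)
        show "AE x in M. epow (maxf d M f x * w x / ennreal (K * t)) (P x) \<le> ennreal (1 / K) * U x"
          using w_eq AE_space
        proof eventually_elim
          case (elim x)
          let ?m = "maxf d M (\<lambda>x. f x / t) x"
          have "maxf d M f x * w x / ennreal (K * t) \<le> ennreal t * ?m * ennreal (v x) / ennreal (K * t)"
            unfolding elim(1) by (intro divide_right_mono_ennreal mult_right_mono maxf_scale fm t) simp
          also have "\<dots> = ennreal (1 / K) * (?m * ennreal (v x))"
          proof -
            have "ennreal t * inverse (ennreal (K * t)) = ennreal (t * inverse (K * t))"
              unfolding inverse_ennreal[OF Kt] using t K(1) by (intro ennreal_mult[symmetric]) auto
            also have "\<dots> = ennreal (1 / K)" using t by (simp add: field_simps)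
            finally have "ennreal (1 / K) = ennreal t * inverse (ennreal (K * t))" by (rule sym)
            then show ?thesis unfolding divide_ennreal_def by (simp only: mult_ac)
          qed
          finally have "epow (maxf d M f x * w x / ennreal (K * t)) (P x) \<le> epow (ennreal (1 / K) * (?m * ennreal (v x))) (P x)"
            using P_gt1[OF elim(2)] by (intro epow_mono) auto
          also have "\<dots> \<le> ennreal (1 / K) * epow (?m * ennreal (v x)) (P x)"
            using K(1) P_gt1[OF elim(2)] by (intro epow_mult_le) auto
          also have "\<dots> \<le> ennreal (1 / K) * U x" using U(1) elim(2) by (intro mult_left_mono) auto
          finally show ?case .
        qed
      qed
      also have "\<dots> = ennreal (1 / K) * (\<integral>\<^sup>+x. U x \<partial>M)" by (rule nn_integral_cmult) measurable
      also have "\<dots> \<le> ennreal (1 / K) * ennreal K" using U(2) by (intro mult_left_mono) auto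
      also have "\<dots> = 1" using K(1) by (subst ennreal_mult[symmetric]) auto
      finally have "?X \<le> ennreal (K * t)" by (rule var_norm_le[OF Kt])
      then have "ennreal (1 / K) * ?X \<le> ennreal (1 / K) * ennreal (K * t)" by (rule mult_left_mono) simp
      also have "\<dots> = ennreal t" using K(1) t by (subst ennreal_mult[symmetric]) auto
      finally show "ennreal (1 / K) * ?X \<le> ennreal t" .
    qed
    then have "ennreal K * (ennreal (1 / K) * ?X) \<le> ennreal K * var_norm M p (\<lambda>x. ennreal \<bar>f x\<bar> * w x)"
      by (rule mult_left_mono) simp
    then show ?thesis using K(1) by (subst (asm) ennreal_mult_left_assoc) auto
  qed
  then show ?thesis by blast
qed

end

section \<open>The Muckenhoupt condition is necessary\<close>

context weighted_homogeneous_space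
begin

text \<open>Any l below the norm of w^(-1) chi_B has modular greater than 1, and this survives a
  truncation to a set \<open>T\<close> with finite integral J > 1. The test function is built so
  that its integral over the ball is l J while its weighted norm is at most J; J then
  cancels.\<close>

lemma ball_test:
  assumes K: "0 \<le> K" "\<And>f. f \<in> borel_measurable M \<Longrightarrow>
      var_norm M p (\<lambda>x. maxf d M f x * w x) \<le> ennreal K * var_norm M p (\<lambda>x. ennreal \<bar>f x\<bar> * w x)"
    and c: "c \<in> space M" and r: "0 < r" and l: "0 < l" "ennreal l < norm_w' c r"
  shows "ennreal l * norm_w c r \<le> ennreal (K * measure M (B c r))"
proof -
  interpret pe: finite_exponent M p P b' by (rule finite_exponent_p)
  interpret ce: finite_exponent M "conj_exp p" P' "b / (b - 1)" by (rule finite_exponent_conj)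
  have Bm [measurable]: "B c r \<in> sets M" by (rule ball_sets[OF c r])
  have BX: "y \<in> space M" if "y \<in> B c r" for y using that by (simp add: ball_iff)
  define V where "V = measure M (B c r)"
  have V: "0 < V" "emeasure M (B c r) = ennreal V" unfolding V_def using Dd(6,7)[OF c r] by auto
  define s where "s y = inverse (v y) / l" for y
  have sm [measurable]: "s \<in> borel_measurable M" unfolding s_def[abs_def] by measurable
  have s: "0 < s y" if "y \<in> space M" for y using v_pos[OF that] l by (simp add: s_def)
  define h where "h y = ennreal (s y powr P' y)" for y
  have hm [measurable]: "h \<in> borel_measurable M" unfolding h_def[abs_def] by measurable
  \<comment> \<open>On \<open>S k\<close> the inverse of v is bounded, so the modular over it is
    finite; these sets increase to the ball.\<close>
  define S where "S k = {y \<in> B c r. 1 / (real k + 1) \<le> v y}" for k :: nat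
  have Sm [measurable]: "S k \<in> sets M" for k
  proof -
    have "S k = B c r \<inter> {y \<in> space M. 1 / (real k + 1) \<le> v y}" by (auto simp: S_def ball_iff)
    then show ?thesis by simp
  qed
  have "\<not> modular M (conj_exp p) (\<lambda>x. inverse (w x) * indicator (B c r) x / ennreal l) \<le> 1"
    using var_norm_le[OF l(1), of M "conj_exp p" "\<lambda>x. inverse (w x) * indicator (B c r) x"] l(2) by auto
  moreover have "modular M (conj_exp p) (\<lambda>x. inverse (w x) * indicator (B c r) x / ennreal l)
     = (\<integral>\<^sup>+x. ennreal ((inverse (v x) * indicat_real (B c r) x / l) powr P' x) \<partial>M)"
  proof (rule ce.modular_eq[OF _ _ _ l(1)])
    show "AE x in M. inverse (w x) * indicator (B c r) x = ennreal (inverse (v x) * indicat_real (B c r) x)"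
      using inverse_w_eq by eventually_elim (auto simp: indicator_def)
  qed (use v_pos in \<open>auto simp: less_imp_le\<close>)
  ultimately have "1 < (\<integral>\<^sup>+x. ennreal ((inverse (v x) * indicat_real (B c r) x / l) powr P' x) \<partial>M)" by simp
  also have "\<dots> \<le> (\<integral>\<^sup>+x. (SUP k. h x * indicator (S k) x) \<partial>M)"
  proof (rule nn_integral_mono)
    fix x assume x: "x \<in> space M"
    show "ennreal ((inverse (v x) * indicat_real (B c r) x / l) powr P' x) \<le> (SUP k. h x * indicator (S k) x)"
    proof (cases "x \<in> B c r")
      case True
      obtain k :: nat where "1 / (real k + 1) < v x"
        using reals_Archimedean[OF v_pos[OF x]] by (auto simp: inverse_eq_divide add.commute)
      then have "x \<in> S k" using True by (simp add: S_def)
      then have "ennreal ((inverse (v x) * indicat_real (B c r) x / l) powr P' x) = h x * indicator (S k) x"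
        using True by (simp add: h_def s_def)
      also have "\<dots> \<le> (SUP k. h x * indicator (S k) x)" by (rule SUP_upper) simp
      finally show ?thesis .
    qed simp
  qed
  also have "\<dots> = (SUP k. (\<integral>\<^sup>+x. h x * indicator (S k) x \<partial>M))"
  proof (rule nn_integral_monotone_convergence_SUP)
    show "incseq (\<lambda>k x. h x * indicator (S k) x)"
    proof (intro incseq_SucI le_funI mult_left_mono)
      fix k x
      have "1 / (real (Suc k) + 1) \<le> 1 / (real k + 1)" by (simp add: field_simps)
      then have "S k \<subseteq> S (Suc k)" unfolding S_def by (auto intro: order_trans)
      then show "indicator (S k) x \<le> (indicator (S (Suc k)) x :: ennreal)" by (auto simp: indicator_def)
    qed simp
  qed measurable
  finally obtain k where k: "1 < (\<integral>\<^sup>+x. h x * indicator (S k) x \<partial>M)" unfolding less_SUP_iff by blast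
  define T where "T = S k"
  have Tm [measurable]: "T \<in> sets M" by (simp add: T_def)
  have TB: "y \<in> B c r" "y \<in> space M" if "y \<in> T" for y using that BX by (auto simp: T_def S_def)
  define R where "R = max 1 ((real k + 1) / l) powr (b / (b - 1))"
  have "(\<integral>\<^sup>+x. h x * indicator T x \<partial>M) \<le> (\<integral>\<^sup>+x. ennreal R * indicator (B c r) x \<partial>M)"
  proof (rule nn_integral_mono)
    fix x assume x: "x \<in> space M"
    show "h x * indicator T x \<le> ennreal R * indicator (B c r) x"
    proof (cases "x \<in> T")
      case True
      then have "inverse (v x) \<le> inverse (1 / (real k + 1))" unfolding T_def S_def by (intro le_imp_inverse_le) auto
      then have "s x \<le> max 1 ((real k + 1) / l)" using l unfolding s_def by (simp add: divide_right_mono le_max_iff_disj)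
      then have "s x powr P' x \<le> max 1 ((real k + 1) / l) powr P' x"
        using s[OF x] L'(2) L'(6)[OF x] by (intro powr_mono2) auto
      also have "\<dots> \<le> R" unfolding R_def using L'(7)[OF x] by (intro powr_mono) auto
      finally show ?thesis using True TB(1) by (simp add: h_def ennreal_leI)
    qed simp
  qed
  also have "\<dots> = ennreal R * ennreal V" using V by (simp add: nn_integral_cmult_indicator)
  also have "\<dots> < \<infinity>" by (simp add: ennreal_mult_less_top)
  finally obtain J where J: "0 \<le> J" "(\<integral>\<^sup>+x. h x * indicator T x \<partial>M) = ennreal J" by (rule ennreal_finiteE)
  have J1: "1 < J" using k J by (simp add: T_def)
  \<comment> \<open>The extremal function for Hoelder's inequality: f v = s^(P'-1), whose P-th power
    is s^P', and f = l s^P' on \<open>T\<close> because 1/v = l s.\<close>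
  define f where "f y = s y powr (P' y - 1) * inverse (v y) * indicat_real T y" for y
  have fm [measurable]: "f \<in> borel_measurable M" unfolding f_def[abs_def] by measurable
  have f0: "0 \<le> f y" if "y \<in> space M" for y using v_pos[OF that] by (simp add: f_def)
  have If: "(\<integral>\<^sup>+y\<in>B c r. ennreal \<bar>f y\<bar> \<partial>M) = ennreal (l * J)"
  proof -
    have "(\<integral>\<^sup>+y\<in>B c r. ennreal \<bar>f y\<bar> \<partial>M) = (\<integral>\<^sup>+y. ennreal l * (h y * indicator T y) \<partial>M)"
    proof (rule nn_integral_cong)
      fix y assume y: "y \<in> space M"
      show "ennreal \<bar>f y\<bar> * indicator (B c r) y = ennreal l * (h y * indicator T y)"
      proof (cases "y \<in> T")
        case True
        have "s y powr (P' y - 1) * inverse (v y) = l * s y powr P' y"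
        proof -
          have "s y * s y powr (P' y - 1) = s y powr P' y" using powr_mult_base[of "s y" "P' y - 1"] s[OF y] by simp
          moreover have "inverse (v y) = l * s y" using l by (simp add: s_def)
          ultimately show ?thesis by (simp add: mult_ac)
        qed
        then have "\<bar>f y\<bar> = l * s y powr P' y" using True f0[OF y] by (simp add: f_def)
        then show ?thesis using True TB(1)[OF True] l by (simp add: h_def ennreal_mult)
      qed (simp add: f_def)
    qed
    also have "\<dots> = ennreal l * ennreal J" unfolding J(2)[symmetric] by (rule nn_integral_cmult) measurable
    finally show ?thesis using l J by (simp add: ennreal_mult)
  qed
  have nf: "var_norm M p (\<lambda>x. ennreal \<bar>f x\<bar> * w x) \<le> ennreal J"
  proof (rule var_norm_le)
    show J0: "0 < J" using J1 by simp
    have "modular M p (\<lambda>x. ennreal \<bar>f x\<bar> * w x / ennreal J) = (\<integral>\<^sup>+x. ennreal ((f x * v x / J) powr P x) \<partial>M)"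
    proof (rule pe.modular_eq[OF _ _ _ J0])
      show "AE x in M. ennreal \<bar>f x\<bar> * w x = ennreal (f x * v x)"
        using w_eq AE_space by eventually_elim (simp add: ennreal_mult v_pos less_imp_le f0)
    qed (use v_pos f0 in \<open>auto simp: less_imp_le\<close>)
    also have "\<dots> \<le> (\<integral>\<^sup>+x. ennreal (1 / J) * (h x * indicator T x) \<partial>M)"
    proof (rule nn_integral_mono)
      fix x assume x: "x \<in> space M"
      show "ennreal ((f x * v x / J) powr P x) \<le> ennreal (1 / J) * (h x * indicator T x)"
      proof (cases "x \<in> T")
        case True
        have e: "(P' x - 1) * P x = P' x" using P_gt1[OF x] by (simp add: P'_def field_simps)
        have "f x * v x = s x powr (P' x - 1)" using True v_pos[OF x] by (simp add: f_def)
        then have "(f x * v x / J) powr P x = s x powr P' x * J powr (- P x)"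
          by (simp add: powr_divide_eq powr_powr e)
        \<comment> \<open>Here J > 1 is needed: J^(-P) \<le> J^(-1) as P > 1, and the remaining
          integral of s^P' over \<open>T\<close> equals J.\<close>
        also have "\<dots> \<le> s x powr P' x * J powr (- 1)" using J1 P_gt1[OF x] by (intro mult_left_mono powr_mono) auto
        also have "\<dots> = 1 / J * s x powr P' x" using J1 by (simp add: powr_minus divide_inverse)
        finally have "ennreal ((f x * v x / J) powr P x) \<le> ennreal (1 / J * s x powr P' x)" by (rule ennreal_leI)
        also have "\<dots> = ennreal (1 / J) * h x" unfolding h_def using J1 by (intro ennreal_mult) auto
        finally show ?thesis using True by simp
      qed (simp add: f_def)
    qed
    also have "\<dots> = ennreal (1 / J) * ennreal J" unfolding J(2)[symmetric] by (rule nn_integral_cmult) measurable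
    also have "\<dots> = 1" using J1 by (subst ennreal_mult[symmetric]) auto
    finally show "modular M p (\<lambda>x. ennreal \<bar>f x\<bar> * w x / ennreal J) \<le> 1" .
  qed
  have pos: "0 < l * J / V" using l J1 V by simp
  have "ennreal (l * J / V) * norm_w c r \<le> var_norm M p (\<lambda>x. ennreal (l * J / V) * (w x * indicator (B c r) x))"
    by (rule var_norm_mult_ge[OF pos])
  also have "\<dots> \<le> var_norm M p (\<lambda>x. maxf d M f x * w x)"
  proof (rule pe.var_norm_mono)
    fix x assume x: "x \<in> space M"
    show "ennreal (l * J / V) * (w x * indicator (B c r) x) \<le> maxf d M f x * w x"
    proof (cases "x \<in> B c r")
      case True
      have "ennreal (l * J / V) = (\<integral>\<^sup>+y\<in>B c r. ennreal \<bar>f y\<bar> \<partial>M) / emeasure M (B c r)"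
        unfolding If V(2) using V l J by (intro divide_ennreal[symmetric]) auto
      also have "\<dots> \<le> maxf d M f x"
        unfolding maxf_def using True c r by (intro SUP_upper) (auto simp: qballs_def)
      finally show ?thesis using True by (simp add: mult_right_mono)
    qed simp
  qed
  also have "\<dots> \<le> ennreal K * var_norm M p (\<lambda>x. ennreal \<bar>f x\<bar> * w x)" by (rule K(2)) measurable
  also have "\<dots> \<le> ennreal K * ennreal J" using nf by (rule mult_left_mono) simp
  also have "\<dots> = ennreal (K * J)" using K(1) J(1) by (intro ennreal_mult[symmetric])
  finally have "ennreal (V / J) * (ennreal (l * J / V) * norm_w c r) \<le> ennreal (V / J) * ennreal (K * J)"
    by (rule mult_left_mono) simp
  also have "ennreal (V / J) * (ennreal (l * J / V) * norm_w c r) = ennreal l * norm_w c r"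
    using V J1 pos by (subst ennreal_mult_left_assoc) auto
  also have "ennreal (V / J) * ennreal (K * J) = ennreal (K * V)"
    using V J1 K(1) by (subst ennreal_mult[symmetric]) auto
  finally show ?thesis by (simp add: V_def)
qed

text \<open>Letting l increase to the norm of w^(-1) chi_B in \<open>ball_test\<close> gives the
  product bound. That norm may be infinite a priori, so its supremum is reached through real l
  only.\<close>

lemma muckenhoupt_necessary:
  assumes K: "\<forall>f\<in>borel_measurable M.
      var_norm M p (\<lambda>x. maxf d M f x * w x) \<le> ennreal K * var_norm M p (\<lambda>x. ennreal \<bar>f x\<bar> * w x)"
  shows "A_var d M p w"
proof -
  \<comment> \<open>A negative constant is read as 0 by \<open>ennreal\<close>, so the hypothesis is
    unchanged.\<close>
  define K' where "K' = max 0 K"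
  have K'K: "ennreal K' = ennreal K" by (cases "0 \<le> K") (auto simp: K'_def ennreal_neg max_def)
  have K'0: "0 \<le> K'" by (simp add: K'_def)
  have "norm_w c r * norm_w' c r \<le> ennreal K' * emeasure M (B c r)" if c: "c \<in> space M" and r: "0 < r" for c r
  proof -
    define V where "V = measure M (B c r)"
    have V: "0 < V" "emeasure M (B c r) = ennreal V" unfolding V_def using Dd(6,7)[OF c r] by auto
    have test: "ennreal l * norm_w c r \<le> ennreal (K' * V)" if "0 < l" "ennreal l < norm_w' c r" for l
      unfolding V_def by (rule ball_test[OF K'0 _ c r that]) (use K in \<open>simp add: K'K\<close>)
    note p1 = norm_w_ball(1)[OF c r] and p2 = norm_w'_ball(1)[OF c r]
    \<comment> \<open>A single admissible l > 0 shows that the norm of w chi_B is finite; only then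
      may it be divided out.\<close>
    obtain q where q: "0 < q" "q < norm_w' c r" using dense[OF p2] by blast
    have "q < \<infinity>" using q(2) by (rule less_le_trans) simp
    then obtain l0 where l0: "0 \<le> l0" "q = ennreal l0" by (rule ennreal_finiteE)
    have l0p: "0 < l0" using q l0 by simp
    have "ennreal l0 * norm_w c r < \<infinity>" using test[OF l0p] q l0 by (auto intro: le_less_trans)
    then have "norm_w c r < \<infinity>" using l0p by (auto simp: ennreal_mult_less_top)
    then obtain n where n: "0 \<le> n" "norm_w c r = ennreal n" by (rule ennreal_finiteE)
    have n0: "0 < n" using p1 n by simp
    have "norm_w' c r \<le> ennreal (K' * V / n)"
    proof (rule ccontr)
      assume "\<not> ?thesis"
      then have "ennreal (K' * V / n) < norm_w' c r" by simp
      then obtain q where q: "ennreal (K' * V / n) < q" "q < norm_w' c r" using dense by blast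
      have "q < \<infinity>" using q(2) by (rule less_le_trans) simp
      then obtain l where l: "0 \<le> l" "q = ennreal l" by (rule ennreal_finiteE)
      have 0: "0 \<le> K' * V / n" using K'0 V n0 by simp
      have lt: "K' * V / n < l" using q(1) 0 l by (simp add: ennreal_less_iff)
      then have "ennreal l * norm_w c r \<le> ennreal (K' * V)" using 0 q l by (intro test) auto
      then have "ennreal (l * n) \<le> ennreal (K' * V)" using l n by (simp add: ennreal_mult)
      then have "l * n \<le> K' * V" by (subst (asm) ennreal_le_iff) (use K'0 V in auto)
      then show False using lt n0 by (simp add: field_simps)
    qed
    then have "norm_w c r * norm_w' c r \<le> ennreal n * ennreal (K' * V / n)" unfolding n(2) by (rule mult_left_mono) simp
    also have "\<dots> = ennreal (K' * V)" using n0 K'0 V by (subst ennreal_mult[symmetric]) auto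
    also have "\<dots> = ennreal K' * emeasure M (B c r)" using K'0 V by (simp add: ennreal_mult)
    finally show ?thesis .
  qed
  then show ?thesis unfolding A_var_def qballs_def by (intro exI[of _ K']) auto
qed

end

theorem theorem1p13:
  fixes d :: "'a \<Rightarrow> 'a \<Rightarrow> real" and M :: "'a measure"
    and p :: "'a \<Rightarrow> ereal" and w :: "'a \<Rightarrow> ennreal"
  assumes "homogeneous_space d M"
    and "exponent M p"
    and "LH d (space M) p"
    and "1 < ess_inf_exp M p"
    and "ess_sup_exp M p < \<infinity>"
    and "weight d M w"
  shows "(\<exists>C::real. \<forall>f \<in> borel_measurable M.
            var_norm M p (\<lambda>x. maxf d M f x * w x) \<le> ennreal C * var_norm M p (\<lambda>x. ennreal \<bar>f x\<bar> * w x))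
         \<longleftrightarrow> A_var d M p w"
proof -
  obtain A0 x0 D P b b' Pinf C where loc: "quasi_metric_measurable M d A0 x0"
    and dbl: "quasi_metric_measurable.doubling M d M D"
    and lh: "quasi_metric_measurable.log_holder M d x0 P b b' Pinf C" and pP: "\<forall>x\<in>space M. p x = ereal (P x)"
    using log_holder_exponent[OF assms(1-5)] by blast
  \<comment> \<open>A version of w that is positive and real at every point; the value 1 replaces w
    on the null set where w is 0 or infinite.\<close>
  define v where "v x = (if 0 < w x \<and> w x < \<infinity> then enn2real (w x) else 1)" for x
  have wm: "w \<in> borel_measurable M" and w_ae: "AE x in M. 0 < w x \<and> w x < \<infinity>"
    using assms(6) by (auto simp: weight_def)
  interpret weighted_homogeneous_space M d A0 x0 p P v w D b b' Pinf C
  proof (intro weighted_homogeneous_space.intro weighted_homogeneous_space_axioms.intro)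
    show "v \<in> borel_measurable M" unfolding v_def[abs_def] using wm by measurable
    show "0 < v x" for x by (auto simp: v_def enn2real_positive_iff)
    show "AE x in M. w x = ennreal (v x)" using w_ae by eventually_elim (simp add: v_def)
    show "p x = ereal (P x)" if "x \<in> space M" for x using pP that by blast
  qed (rule loc dbl lh)+
  show ?thesis using muckenhoupt_sufficient muckenhoupt_necessary by blast
qed

end
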